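(* Let $k$ be a field and let $A=k[x_1;\tau_1,\delta_1]\cdots[x_n;\tau_n,\delta_n]$ be an iterated skew polynomial ring, where $\tau_i(x_j)=\lambda_{ij}x_j$ and $\delta_i\tau_i=q_i\tau_i\delta_i$, with $q_i\ne1$, for some $\lambda_{ij},q_i\in k^\times$ and all $j<i$. Assume that each $\delta_i$ extends to a locally nilpotent, iterative higher $q_i$-skew $\tau_i$-derivation $\{d_{i,m}\}_{m=0}^\infty$ on the subalgebra $k[x_1;\tau_1,\delta_1]\cdots[x_{i-1};\tau_{i-1},\delta_{i-1}]$. Let $P$ be a completely prime ideal of $A$ and set $\lambda_{ii}=1$ and $\lambda_{ji}=\lambda_{ij}^{-1}$. Then for $\boldsymbol\lambda=(\lambda_{ij})\in M_n(k)$ there is a completely prime ideal $Q\subseteq\mathcal O_{\boldsymbol\lambda}(k^n)$ such that $$\operatorname{Fract}A/P\cong\operatorname{Fract}\mathcal O_{\boldsymbol\lambda}(k^n)/Q.$$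
   Context: Conventions: $k$ has arbitrary characteristic. In a skew polynomial ring $R[x;\tau,\delta]$, $R$ is a $k$-algebra, $\tau$ is a $k$-algebra automorphism of $R$, $\delta$ is a $k$-linear $\tau$-derivation ($\delta(rs)=\tau(r)\delta(s)+\delta(r)s$), and $xr=\tau(r)x+\delta(r)$. An ideal is completely prime if the factor ring is a domain. $\operatorname{Fract}$ denotes the division ring of fractions. The multiparameter quantum affine space $\mathcal O_{\boldsymbol\lambda}(k^n)$, for a multiplicatively antisymmetric matrix $\boldsymbol\lambda$, is the $k$-algebra with generators $x_1,\dots,x_n$ and relations $x_ix_j=\lambda_{ij}x_jx_i$ for all $i,j$. For an indeterminate $t$: $(m)_t=t^{m-1}+\cdots+t+1$, $(m)!_t=(m)_t\cdots(1)_t$, $(0)!_t=1$, $\binom{n}{m}_t=\frac{(n)!_t}{(m)!_t(n-m)!_t}$ (a polynomial in $t$), and $\binom{n}{m}_q$ is its value at $t=q$. A higher $q$-skew $\tau$-derivation on a $k$-algebra $R$ is a sequence $d_0,d_1,d_2,\dots$ of $k$-linear operators on $R$ with $d_0=\mathrm{id}$, $d_n(rs)=\sum_{i=0}^n\tau^{n-i}d_i(r)\,d_{n-i}(s)$ for all $r,s\in R$ and all $n$, and $d_i\tau=q^i\tau d_i$ for all $i$. It is locally nilpotent if for every $r\in R$ there is $n\ge0$ with $d_i(r)=0$ for all $i\ge n$. It is iterative if $d_id_j=\binom{i+j}{j}_qd_{i+j}$ for all $i,j$. A $\tau$-derivation $\delta$ with $\delta\tau=q\tau\delta$ extends to $\{d_i\}$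 if $d_1=\delta$. *)

theory Defs
  imports "HOL-Algebra.Algebra" "HOL-Computational_Algebra.Polynomial"
begin

section \<open>Algebras over a field\<close>

locale assoc_algebra = K: field K + M: module K A + A: ring A for K (structure) and A (structure) +
  assumes smult_assoc_left:
    "\<lbrakk> c \<in> carrier K; a \<in> carrier A; b \<in> carrier A \<rbrakk> \<Longrightarrow>
       c \<odot>\<^bsub>A\<^esub> (a \<otimes>\<^bsub>A\<^esub> b) = (c \<odot>\<^bsub>A\<^esub> a) \<otimes>\<^bsub>A\<^esub> b"
  and smult_assoc_right:
    "\<lbrakk> c \<in> carrier K; a \<in> carrier A; b \<in> carrier A \<rbrakk> \<Longrightarrow>
       c \<odot>\<^bsub>A\<^esub> (a \<otimes>\<^bsub>A\<^esub> b) = a \<otimes>\<^bsub>A\<^esub> (c \<odot>\<^bsub>A\<^esub> b)"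

definition is_subalgebra ::
  "('k, 'c) ring_scheme \<Rightarrow> ('k, 'a, 'm) module_scheme \<Rightarrow> 'a set \<Rightarrow> bool" where
  "is_subalgebra K A B \<longleftrightarrow>
     subring B A \<and> (\<forall>c\<in>carrier K. \<forall>b\<in>B. c \<odot>\<^bsub>A\<^esub> b \<in> B)"

definition linear_operator ::
  "('k, 'c) ring_scheme \<Rightarrow> ('k, 'a, 'm) module_scheme \<Rightarrow> ('a \<Rightarrow> 'a) \<Rightarrow> bool" where
  "linear_operator K R f \<longleftrightarrow>
     f \<in> carrier R \<rightarrow> carrier R \<and>
     (\<forall>r\<in>carrier R. \<forall>s\<in>carrier R. f (r \<oplus>\<^bsub>R\<^esub> s) = f r \<oplus>\<^bsub>R\<^esub> f s) \<and>
     (\<forall>c\<in>carrier K. \<forall>r\<in>carrier R. f (c \<odot>\<^bsub>R\<^esub> r) = c \<odot>\<^bsub>R\<^esub> f r)"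

definition alg_iso ::
  "('k, 'c) ring_scheme \<Rightarrow> ('k, 'a, 'm) module_scheme \<Rightarrow> ('k, 'b, 'n) module_scheme
    \<Rightarrow> ('a \<Rightarrow> 'b) set" where
  "alg_iso K R S =
     {h \<in> ring_iso R S. \<forall>c\<in>carrier K. \<forall>r\<in>carrier R. h (c \<odot>\<^bsub>R\<^esub> r) = c \<odot>\<^bsub>S\<^esub> h r}"

definition alg_isomorphic ::
  "('k, 'c) ring_scheme \<Rightarrow> ('k, 'a, 'm) module_scheme \<Rightarrow> ('k, 'b, 'n) module_scheme \<Rightarrow> bool" where
  "alg_isomorphic K R S \<longleftrightarrow> alg_iso K R S \<noteq> {}"

text \<open>The library quotient ring, with the scalar action induced on cosets.\<close>

definition quot_algebra ::
  "('k, 'a, 'm) module_scheme \<Rightarrow> 'a set \<Rightarrow> ('k, 'a set) module" where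
  "quot_algebra A I =
     ring.extend (A Quot I) (module.fields (\<lambda>c U. \<Union>x\<in>U. I +>\<^bsub>A\<^esub> (c \<odot>\<^bsub>A\<^esub> x)))"


section \<open>Completely prime ideals and division rings of fractions\<close>

text \<open>The library locale \<open>domain\<close> is commutative, hence the following notion.\<close>

definition nc_domain :: "('a, 'm) ring_scheme \<Rightarrow> bool" where
  "nc_domain R \<longleftrightarrow> ring R \<and> \<one>\<^bsub>R\<^esub> \<noteq> \<zero>\<^bsub>R\<^esub> \<and>
     (\<forall>a\<in>carrier R. \<forall>b\<in>carrier R.
        a \<otimes>\<^bsub>R\<^esub> b = \<zero>\<^bsub>R\<^esub> \<longrightarrow> a = \<zero>\<^bsub>R\<^esub> \<or> b = \<zero>\<^bsub>R\<^esub>)"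

definition completely_prime :: "'a set \<Rightarrow> ('a, 'm) ring_scheme \<Rightarrow> bool" where
  "completely_prime P R \<longleftrightarrow> ideal P R \<and> nc_domain (R Quot P)"

definition right_Ore_domain :: "('a, 'm) ring_scheme \<Rightarrow> bool" where
  "right_Ore_domain R \<longleftrightarrow> nc_domain R \<and>
     (\<forall>a\<in>carrier R. \<forall>b\<in>carrier R - {\<zero>\<^bsub>R\<^esub>}.
        \<exists>u\<in>carrier R - {\<zero>\<^bsub>R\<^esub>}. \<exists>v\<in>carrier R. a \<otimes>\<^bsub>R\<^esub> u = b \<otimes>\<^bsub>R\<^esub> v)"

text \<open>
  Ore localisation at the nonzero elements: the pair \<open>(a, b)\<close> stands for the right fraction
  \<open>a b\<^sup>-\<^sup>1\<close>. Two fractions are equal when they have a common expansion. The construction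
  is meaningful, and gives the division ring of fractions, for right Ore domains. The operations
  are unions of equivalence classes over all choices of representatives and common multiples;
  for a right Ore domain all these classes coincide.
\<close>

definition frac_rel :: "('a, 'm) ring_scheme \<Rightarrow> (('a \<times> 'a) \<times> ('a \<times> 'a)) set" where
  "frac_rel R =
     {((a, b), (c, d)). a \<in> carrier R \<and> b \<in> carrier R - {\<zero>\<^bsub>R\<^esub>} \<and>
        c \<in> carrier R \<and> d \<in> carrier R - {\<zero>\<^bsub>R\<^esub>} \<and>
        (\<exists>u\<in>carrier R. \<exists>v\<in>carrier R. a \<otimes>\<^bsub>R\<^esub> u = c \<otimes>\<^bsub>R\<^esub> v \<and>
           b \<otimes>\<^bsub>R\<^esub> u = d \<otimes>\<^bsub>R\<^esub> v \<and> b \<otimes>\<^bsub>R\<^esub> u \<noteq> \<zero>\<^bsub>R\<^esub>)}"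

definition frac_class :: "('a, 'm) ring_scheme \<Rightarrow> 'a \<Rightarrow> 'a \<Rightarrow> ('a \<times> 'a) set" where
  "frac_class R a b = frac_rel R `` {(a, b)}"

text \<open>If \<open>b u = d v\<close> then \<open>a b\<^sup>-\<^sup>1 + c d\<^sup>-\<^sup>1 = (a u + c v) (b u)\<^sup>-\<^sup>1\<close>.\<close>

definition frac_add ::
  "('a, 'm) ring_scheme \<Rightarrow> ('a \<times> 'a) set \<Rightarrow> ('a \<times> 'a) set \<Rightarrow> ('a \<times> 'a) set" where
  "frac_add R U V =
     \<Union>{frac_class R (a \<otimes>\<^bsub>R\<^esub> u \<oplus>\<^bsub>R\<^esub> c \<otimes>\<^bsub>R\<^esub> v) (b \<otimes>\<^bsub>R\<^esub> u) | a b c d u v.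
        (a, b) \<in> U \<and> (c, d) \<in> V \<and> u \<in> carrier R \<and> v \<in> carrier R \<and>
        b \<otimes>\<^bsub>R\<^esub> u = d \<otimes>\<^bsub>R\<^esub> v \<and> b \<otimes>\<^bsub>R\<^esub> u \<noteq> \<zero>\<^bsub>R\<^esub>}"

text \<open>If \<open>c u = b v\<close> then \<open>b\<^sup>-\<^sup>1 c = v u\<^sup>-\<^sup>1\<close>, so \<open>a b\<^sup>-\<^sup>1 c d\<^sup>-\<^sup>1 = (a v) (d u)\<^sup>-\<^sup>1\<close>.\<close>

definition frac_mult ::
  "('a, 'm) ring_scheme \<Rightarrow> ('a \<times> 'a) set \<Rightarrow> ('a \<times> 'a) set \<Rightarrow> ('a \<times> 'a) set" where
  "frac_mult R U V =
     \<Union>{frac_class R (a \<otimes>\<^bsub>R\<^esub> v) (d \<otimes>\<^bsub>R\<^esub> u) | a b c d u v.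
        (a, b) \<in> U \<and> (c, d) \<in> V \<and> u \<in> carrier R - {\<zero>\<^bsub>R\<^esub>} \<and> v \<in> carrier R \<and>
        c \<otimes>\<^bsub>R\<^esub> u = b \<otimes>\<^bsub>R\<^esub> v}"

definition fract_algebra :: "('k, 'a, 'm) module_scheme \<Rightarrow> ('k, ('a \<times> 'a) set) module" where
  "fract_algebra R =
     \<lparr> carrier = (carrier R \<times> (carrier R - {\<zero>\<^bsub>R\<^esub>})) // frac_rel R,
       monoid.mult = frac_mult R,
       one = frac_class R \<one>\<^bsub>R\<^esub> \<one>\<^bsub>R\<^esub>,
       ring.zero = frac_class R \<zero>\<^bsub>R\<^esub> \<one>\<^bsub>R\<^esub>,
       add = frac_add R,
       module.smult = (\<lambda>k U. \<Union>(a, b)\<in>U. frac_class R (k \<odot>\<^bsub>R\<^esub> a) b) \<rparr>"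


section \<open>Skew polynomial rings\<close>

definition skew_derivation ::
  "('k, 'c) ring_scheme \<Rightarrow> ('k, 'a, 'm) module_scheme \<Rightarrow> ('a \<Rightarrow> 'a) \<Rightarrow> ('a \<Rightarrow> 'a) \<Rightarrow> bool" where
  "skew_derivation K R \<tau> \<delta> \<longleftrightarrow>
     linear_operator K R \<delta> \<and>
     (\<forall>r\<in>carrier R. \<forall>s\<in>carrier R.
        \<delta> (r \<otimes>\<^bsub>R\<^esub> s) = \<tau> r \<otimes>\<^bsub>R\<^esub> \<delta> s \<oplus>\<^bsub>R\<^esub> \<delta> r \<otimes>\<^bsub>R\<^esub> s)"

text \<open>
  \<open>S = R[x; \<tau>, \<delta>]\<close> inside an ambient algebra \<open>A\<close>: the subalgebra \<open>S\<close> contains \<open>R\<close> and \<open>x\<close>,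
  it is a free left \<open>R\<close>-module with basis \<open>1, x, x\<^sup>2, \<dots>\<close>, and \<open>x r = \<tau>(r) x + \<delta>(r)\<close>.
\<close>

definition skew_polynomial_ring ::
  "('k, 'c) ring_scheme \<Rightarrow> ('k, 'a, 'm) module_scheme \<Rightarrow> 'a set \<Rightarrow> 'a set \<Rightarrow> 'a
    \<Rightarrow> ('a \<Rightarrow> 'a) \<Rightarrow> ('a \<Rightarrow> 'a) \<Rightarrow> bool" where
  "skew_polynomial_ring K A S R x \<tau> \<delta> \<longleftrightarrow>
     is_subalgebra K A R \<and> is_subalgebra K A S \<and> R \<subseteq> S \<and> x \<in> S \<and>
     \<tau> \<in> alg_iso K (A\<lparr>carrier := R\<rparr>) (A\<lparr>carrier := R\<rparr>) \<and>
     skew_derivation K (A\<lparr>carrier := R\<rparr>) \<tau> \<delta> \<and>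
     (\<forall>r\<in>R. x \<otimes>\<^bsub>A\<^esub> r = \<tau> r \<otimes>\<^bsub>A\<^esub> x \<oplus>\<^bsub>A\<^esub> \<delta> r) \<and>
     (\<forall>s\<in>S. \<exists>!c :: nat \<Rightarrow> 'a. c \<in> UNIV \<rightarrow> R \<and> finite {j. c j \<noteq> \<zero>\<^bsub>A\<^esub>} \<and>
        s = (\<Oplus>\<^bsub>A\<^esub>j\<in>{j. c j \<noteq> \<zero>\<^bsub>A\<^esub>}. c j \<otimes>\<^bsub>A\<^esub> (x [^]\<^bsub>A\<^esub> j)))"

text \<open>
  \<open>B i\<close> is the subalgebra \<open>k[x\<^sub>1; \<tau>\<^sub>1, \<delta>\<^sub>1]\<cdots>[x\<^sub>i; \<tau>\<^sub>i, \<delta>\<^sub>i]\<close> of \<open>A = B n\<close>, and \<open>B 0\<close> is the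
  (injective) image of \<open>k\<close>.
\<close>

definition iterated_skew_polynomial_ring ::
  "('k, 'c) ring_scheme \<Rightarrow> ('k, 'a, 'm) module_scheme \<Rightarrow> nat \<Rightarrow> (nat \<Rightarrow> 'a set) \<Rightarrow> (nat \<Rightarrow> 'a)
    \<Rightarrow> (nat \<Rightarrow> 'a \<Rightarrow> 'a) \<Rightarrow> (nat \<Rightarrow> 'a \<Rightarrow> 'a) \<Rightarrow> bool" where
  "iterated_skew_polynomial_ring K A n B x \<tau> \<delta> \<longleftrightarrow>
     assoc_algebra K A \<and>
     inj_on (\<lambda>c. c \<odot>\<^bsub>A\<^esub> \<one>\<^bsub>A\<^esub>) (carrier K) \<and>
     B 0 = (\<lambda>c. c \<odot>\<^bsub>A\<^esub> \<one>\<^bsub>A\<^esub>) ` carrier K \<and>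
     B n = carrier A \<and>
     (\<forall>i\<in>{1..n}. skew_polynomial_ring K A (B i) (B (i - 1)) (x i) (\<tau> i) (\<delta> i))"


section \<open>Higher skew derivations\<close>

definition t_number :: "nat \<Rightarrow> int poly" where
  "t_number m = (\<Sum>i<m. monom 1 i)"

definition t_factorial :: "nat \<Rightarrow> int poly" where
  "t_factorial m = (\<Prod>i=1..m. t_number i)"

definition t_binomial :: "nat \<Rightarrow> nat \<Rightarrow> int poly" where
  "t_binomial n m = t_factorial n div (t_factorial m * t_factorial (n - m))"

text \<open>The division above is exact.\<close>

lemma t_number_add: "t_number (m + k) = t_number m + monom 1 m * t_number k"
  by (induction k) (simp_all add: t_number_def mult_monom algebra_simps)

lemma t_factorial_Suc: "t_factorial (Suc m) = t_number (Suc m) * t_factorial m"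
  by (simp add: t_factorial_def mult.commute)

lemma t_factorial_dvd: "t_factorial m * t_factorial k dvd t_factorial (m + k)"
proof (induction "m + k" arbitrary: m k)
  case 0
  then show ?case by (simp add: t_factorial_def)
next
  case (Suc N)
  show ?case
  proof (cases "m = 0 \<or> k = 0")
    case True
    then show ?thesis by (auto simp: t_factorial_def)
  next
    case False
    then obtain a b where m: "m = Suc a" and k: "k = Suc b"
      by (meson not0_implies_Suc)
    have N: "N = a + Suc b" "N = Suc a + b" using Suc(2) m k by auto
    have "t_factorial a * t_factorial (Suc b) dvd t_factorial N"
      using Suc(1)[OF N(1)] N(1) by simp
    then have 1: "t_factorial m * t_factorial k dvd t_number m * t_factorial N"
      unfolding m k t_factorial_Suc[of a] by (simp add: mult.assoc mult_dvd_mono)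
    have "t_factorial (Suc a) * t_factorial b dvd t_factorial N"
      using Suc(1)[OF N(2)] N(2) by simp
    then have "t_number k * (t_factorial (Suc a) * t_factorial b) dvd t_number k * t_factorial N"
      by (rule mult_dvd_mono[OF dvd_refl])
    then have "t_factorial m * t_factorial k dvd t_number k * t_factorial N"
      unfolding m k t_factorial_Suc[of b] by (simp only: ac_simps)
    then have 2: "t_factorial m * t_factorial k dvd monom 1 m * (t_number k * t_factorial N)"
      by (rule dvd_mult)
    have "t_factorial (m + k) = t_number m * t_factorial N + monom 1 m * (t_number k * t_factorial N)"
      using t_factorial_Suc[of N] Suc(2) t_number_add[of m k] by (simp add: algebra_simps)
    then show ?thesis using 1 2 by (simp add: dvd_add)
  qed
qed

lemma t_binomial_mult:
  "m \<le> n \<Longrightarrow> t_binomial n m * (t_factorial m * t_factorial (n - m)) = t_factorial n"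
  using t_factorial_dvd[of m "n - m"] by (simp add: t_binomial_def)

definition eval_int_poly :: "('k, 'c) ring_scheme \<Rightarrow> int poly \<Rightarrow> 'k \<Rightarrow> 'k" where
  "eval_int_poly K p q =
     (\<Oplus>\<^bsub>K\<^esub>i\<in>{..degree p}. add_pow K (coeff p i) (q [^]\<^bsub>K\<^esub> i))"

definition higher_skew_derivation ::
  "('k, 'c) ring_scheme \<Rightarrow> ('k, 'a, 'm) module_scheme \<Rightarrow> 'k \<Rightarrow> ('a \<Rightarrow> 'a)
    \<Rightarrow> (nat \<Rightarrow> 'a \<Rightarrow> 'a) \<Rightarrow> bool" where
  "higher_skew_derivation K R q \<tau> d \<longleftrightarrow>
     (\<forall>m. linear_operator K R (d m)) \<and>
     (\<forall>r\<in>carrier R. d 0 r = r) \<and>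
     (\<forall>m. \<forall>r\<in>carrier R. \<forall>s\<in>carrier R.
        d m (r \<otimes>\<^bsub>R\<^esub> s) = (\<Oplus>\<^bsub>R\<^esub>i\<in>{..m}. (\<tau> ^^ (m - i)) (d i r) \<otimes>\<^bsub>R\<^esub> d (m - i) s)) \<and>
     (\<forall>m. \<forall>r\<in>carrier R. d m (\<tau> r) = (q [^]\<^bsub>K\<^esub> m) \<odot>\<^bsub>R\<^esub> \<tau> (d m r))"

definition locally_nilpotent ::
  "('k, 'a, 'm) module_scheme \<Rightarrow> (nat \<Rightarrow> 'a \<Rightarrow> 'a) \<Rightarrow> bool" where
  "locally_nilpotent R d \<longleftrightarrow> (\<forall>r\<in>carrier R. \<exists>m. \<forall>i\<ge>m. d i r = \<zero>\<^bsub>R\<^esub>)"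

definition iterative ::
  "('k, 'c) ring_scheme \<Rightarrow> ('k, 'a, 'm) module_scheme \<Rightarrow> 'k \<Rightarrow> (nat \<Rightarrow> 'a \<Rightarrow> 'a) \<Rightarrow> bool" where
  "iterative K R q d \<longleftrightarrow>
     (\<forall>i j. \<forall>r\<in>carrier R.
        d i (d j r) = eval_int_poly K (t_binomial (i + j) j) q \<odot>\<^bsub>R\<^esub> d (i + j) r)"

definition extends_skew_derivation ::
  "('k, 'a, 'm) module_scheme \<Rightarrow> (nat \<Rightarrow> 'a \<Rightarrow> 'a) \<Rightarrow> ('a \<Rightarrow> 'a) \<Rightarrow> bool" where
  "extends_skew_derivation R d \<delta> \<longleftrightarrow> (\<forall>r\<in>carrier R. d 1 r = \<delta> r)"


section \<open>Multiparameter quantum affine space\<close>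

text \<open>
  The free algebra on \<open>x\<^sub>1, \<dots>, x\<^sub>n\<close>: finitely supported functions on the words in the letters
  \<open>1, \<dots>, n\<close>, with the product induced by concatenation of words.
\<close>

definition free_algebra :: "('k, 'c) ring_scheme \<Rightarrow> nat \<Rightarrow> ('k, nat list \<Rightarrow> 'k) module" where
  "free_algebra K n =
     \<lparr> carrier = {f. (\<forall>w. f w \<in> carrier K) \<and> (\<forall>w. w \<notin> lists {1..n} \<longrightarrow> f w = \<zero>\<^bsub>K\<^esub>) \<and>
                  finite {w. f w \<noteq> \<zero>\<^bsub>K\<^esub>}},
       monoid.mult = (\<lambda>f g w. \<Oplus>\<^bsub>K\<^esub>l\<in>{..length w}. f (take l w) \<otimes>\<^bsub>K\<^esub> g (drop l w)),
       one = (\<lambda>w. if w = [] then \<one>\<^bsub>K\<^esub> else \<zero>\<^bsub>K\<^esub>),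
       ring.zero = (\<lambda>w. \<zero>\<^bsub>K\<^esub>),
       add = (\<lambda>f g w. f w \<oplus>\<^bsub>K\<^esub> g w),
       module.smult = (\<lambda>c f w. c \<otimes>\<^bsub>K\<^esub> f w) \<rparr>"

definition free_gen :: "('k, 'c) ring_scheme \<Rightarrow> nat \<Rightarrow> nat list \<Rightarrow> 'k" where
  "free_gen K i = (\<lambda>w. if w = [i] then \<one>\<^bsub>K\<^esub> else \<zero>\<^bsub>K\<^esub>)"

definition quantum_relations ::
  "('k, 'c) ring_scheme \<Rightarrow> nat \<Rightarrow> (nat \<Rightarrow> nat \<Rightarrow> 'k) \<Rightarrow> (nat list \<Rightarrow> 'k) set" where
  "quantum_relations K n \<Lambda> =
     (let F = free_algebra K n; g = free_gen K in
       {g i \<otimes>\<^bsub>F\<^esub> g j \<ominus>\<^bsub>F\<^esub> \<Lambda> i j \<odot>\<^bsub>F\<^esub> (g j \<otimes>\<^bsub>F\<^esub> g i) | i j. i \<in> {1..n} \<and> j \<in> {1..n}})"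

definition quantum_affine_space ::
  "('k, 'c) ring_scheme \<Rightarrow> nat \<Rightarrow> (nat \<Rightarrow> nat \<Rightarrow> 'k) \<Rightarrow> ('k, (nat list \<Rightarrow> 'k) set) module" where
  "quantum_affine_space K n \<Lambda> =
     quot_algebra (free_algebra K n) (genideal (free_algebra K n) (quantum_relations K n \<Lambda>))"

end

theory Submission
  imports Defs
begin

text \<open>
  By the skew Hilbert basis theorem \<open>A\<close> is right noetherian, so the domain \<open>A/P\<close> is right Ore. Let \<open>D\<close> be
  its division ring of fractions, and let \<open>X\<^sub>i\<close> be the image of \<open>x\<^sub>i\<close> in \<open>D\<close>. One finds successively
  elements \<open>y\<^sub>i = X\<^sub>i - c\<^sub>i\<close> of \<open>D\<close> with \<open>y\<^sub>i y\<^sub>j = \<lambda>\<^sub>i\<^sub>j y\<^sub>j y\<^sub>i\<close> for \<open>j < i\<close>, where \<open>c\<^sub>i\<close> is a Laurent polynomial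
  in those \<open>y\<^sub>j\<close> with \<open>j < i\<close> that are nonzero. Then \<open>D\<close> is also the division ring of fractions of the
  subalgebra generated by \<open>y\<^sub>1, \<dots>, y\<^sub>n\<close>, which is a factor of the quantum affine space by a completely
  prime ideal.

  To find \<open>c\<^sub>i\<close>, consider the commuting operators \<open>N\<^sub>j v = \<lambda>\<^sub>i\<^sub>j y\<^sub>j v y\<^sub>j\<^sup>-\<^sup>1\<close> on \<open>D\<close>; \<open>X\<^sub>i - c\<^sub>i\<close> has to be fixed by all
  of them. Laurent monomials in the \<open>y\<^sub>j\<close> are joint eigenvectors, and \<open>X\<^sub>i - N\<^sub>j X\<^sub>i\<close> is a linear combination
  of monomials of the same weight as \<open>x\<^sub>i\<close>, the weight being given by the eigenvalues of the
  \<open>\<tau>\<^sub>l\<close> with \<open>l \<ge> i\<close>. As \<open>q\<^sub>i \<noteq> 1\<close>, none of these monomials is fixed by all \<open>N\<^sub>j\<close>, and linear algebra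
  provides \<open>c\<^sub>i\<close>. Weights are recorded separately from elements of \<open>D\<close> because \<open>\<tau>\<^sub>l\<close> need not
  preserve \<open>P\<close>, hence need not act on the image of its domain in \<open>D\<close>.
\<close>

section \<open>Right noetherian rings and the skew Hilbert basis theorem\<close>

text \<open>The commutators that are known involve \<open>x_j\<close>:
  \<open>X_i X_j - \<lambda>_ij X_j X_i\<close> is the image of \<open>\<delta>_i(x_j)\<close>. The
  operators \<open>N_j\<close>, however, conjugate by \<open>y_j = X_j - c_j\<close>. The bridge is
  a skew Leibniz rule: the map \<open>r -> X_i r - w r X_i\<close>, with \<open>w\<close> the
  eigenvalue of \<open>\<tau>_i\<close> attached to \<open>r\<close>, shifts weights by that of
  \<open>x_i\<close>, and this property passes to products and inverses. As \<open>c_j\<close>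
  involves only the \<open>y_p\<close> with \<open>p < j\<close>, the property passes from
  \<open>X_j\<close> to \<open>y_j\<close> by induction on \<open>j\<close>. For this each
  \<open>c_j\<close> has to be homogeneous, so its weight is part of the induction. Since
  \<open>P\<close> need not be homogeneous, one element of \<open>D\<close> may be a combination of
  monomials of several weights, and monomials may be linearly dependent. Therefore the linear
  algebra is done with spanning sets, never with bases or gradings: homogeneity is decided in
  \<open>A\<close>, where the \<open>\<tau>_l\<close> act, and carried over to \<open>D\<close>
  monomial by monomial.\<close>

inductive_set right_span :: "('a, 'm) ring_scheme \<Rightarrow> 'a set \<Rightarrow> 'a set \<Rightarrow> 'a set"
  for A :: "('a, 'm) ring_scheme" and S T :: "'a set" where
  right_span_zero: "\<zero>\<^bsub>A\<^esub> \<in> right_span A S T"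
| right_span_step: "\<lbrakk> t \<in> T; s \<in> S; z \<in> right_span A S T \<rbrakk> \<Longrightarrow> t \<otimes>\<^bsub>A\<^esub> s \<oplus>\<^bsub>A\<^esub> z \<in> right_span A S T"

text \<open>The ascending chain condition read off sequences: a sequence none of whose terms lies in
  the right ideal generated by its predecessors amounts to a strictly ascending chain. The ring is a
  set inside the ambient \<open>A\<close>, so that all stages of an iterated extension share one set
  of operations.\<close>

definition right_noetherian :: "('a, 'm) ring_scheme \<Rightarrow> 'a set \<Rightarrow> bool" where
  "right_noetherian A S \<longleftrightarrow> (\<forall>f :: nat \<Rightarrow> 'a. range f \<subseteq> S \<longrightarrow> (\<exists>m. f m \<in> right_span A S (f ` {..<m})))"

lemma right_span_mono: "T \<subseteq> T' \<Longrightarrow> right_span A S T \<subseteq> right_span A S T'"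
proof
  fix z assume "z \<in> right_span A S T" and "T \<subseteq> T'"
  then show "z \<in> right_span A S T'" by induction (auto intro: right_span.intros)
qed

lemma right_span_finite_support:
  assumes "z \<in> right_span A S (range f)"
  shows "\<exists>m. z \<in> right_span A S (f ` {..<m::nat})"
  using assms
proof induction
  case right_span_zero
  then show ?case by (auto intro: right_span.intros)
next
  case (right_span_step t s z)
  then obtain m i where m: "z \<in> right_span A S (f ` {..<m})" and t: "t = f i" by auto
  have "f ` {..<m} \<subseteq> f ` {..<max m (Suc i)}" by auto
  from right_span_mono[OF this] have "t \<otimes>\<^bsub>A\<^esub> s \<oplus>\<^bsub>A\<^esub> z \<in> right_span A S (f ` {..<max m (Suc i)})"
    using m right_span_step(2)
    by (intro right_span.right_span_step) (auto simp: t)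
  then show ?case ..
qed

lemma right_span_finite_support_set:
  assumes "finite G" and "G \<subseteq> right_span A S (range f)"
  shows "\<exists>m. G \<subseteq> right_span A S (f ` {..<m::nat})"
  using assms
proof (induction G rule: finite_induct)
  case (insert z G)
  then obtain m m' where m: "G \<subseteq> right_span A S (f ` {..<m})" "z \<in> right_span A S (f ` {..<m'})"
    using right_span_finite_support[of z A S f] by auto
  have "f ` {..<m} \<subseteq> f ` {..<max m m'}" "f ` {..<m'} \<subseteq> f ` {..<max m m'}" by auto
  from this[THEN right_span_mono[of _ _ A S]] have "insert z G \<subseteq> right_span A S (f ` {..<max m m'})"
    using m by blast
  then show ?case ..
qed auto

section \<open>Right ideals generated by a set\<close>

context ring begin

lemma right_span_subset:
  assumes "subring S R" "T \<subseteq> carrier R" "z \<in> right_span R S T"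
  shows "z \<in> carrier R"
  using assms(3) by induction (use assms(2) subringE(1)[OF assms(1)] in auto)

lemma right_span_closed_subring:
  assumes "subring S R" "T \<subseteq> S" "z \<in> right_span R S T"
  shows "z \<in> S"
  using assms(3)
  by induction (use assms(1,2) subringE[OF assms(1)] in auto)

lemma right_span_add:
  assumes S: "subring S R" and T: "T \<subseteq> carrier R"
    and y: "y \<in> right_span R S T" and z: "z \<in> right_span R S T"
  shows "y \<oplus> z \<in> right_span R S T"
  using y
proof induction
  case right_span_zero
  then show ?case using z right_span_subset[OF S T z] by simp
next
  case (right_span_step t s y)
  have "t \<otimes> s \<oplus> y \<oplus> z = t \<otimes> s \<oplus> (y \<oplus> z)"
    using right_span_step T S subringE(1)[OF S] right_span_subset[OF S T]
    by (intro a_assoc) (auto intro: z)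
  then show ?case using right_span_step by (auto intro: right_span.intros)
qed

lemma right_span_mult:
  assumes S: "subring S R" and T: "T \<subseteq> carrier R"
    and z: "z \<in> right_span R S T" and s: "s \<in> S"
  shows "z \<otimes> s \<in> right_span R S T"
  using z
proof induction
  case right_span_zero
  have "s \<in> carrier R" using s subringE(1)[OF S] by auto
  then show ?case by (auto intro: right_span.intros)
next
  case (right_span_step t r y)
  then have c: "t \<in> carrier R" "r \<in> carrier R" "y \<in> carrier R" "s \<in> carrier R"
    using T s subringE(1)[OF S] right_span_subset[OF S T] by auto
  have "(t \<otimes> r \<oplus> y) \<otimes> s = t \<otimes> (r \<otimes> s) \<oplus> y \<otimes> s"
    using c by algebra
  then show ?case using right_span_step s subringE(6)[OF S]
    by (auto intro: right_span.intros)
qed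

lemma right_span_incl:
  assumes S: "subring S R" and T: "T \<subseteq> carrier R" and t: "t \<in> T"
  shows "t \<in> right_span R S T"
  using right_span.right_span_step[OF t subringE(3)[OF S] right_span_zero, of R] T t
  by auto

lemma right_span_minus:
  assumes S: "subring S R" and T: "T \<subseteq> carrier R"
    and y: "y \<in> right_span R S T" and z: "z \<in> right_span R S T"
  shows "y \<ominus> z \<in> right_span R S T"
proof -
  have c: "y \<in> carrier R" "z \<in> carrier R" using right_span_subset[OF S T] y z by auto
  have "\<ominus> \<one> \<in> S" using subringE[OF S] by auto
  then have "y \<oplus> z \<otimes> \<ominus> \<one> \<in> right_span R S T"
    by (intro right_span_add right_span_mult S T y z)
  moreover have "y \<oplus> z \<otimes> \<ominus> \<one> = y \<ominus> z" using c by (simp add: r_minus minus_eq)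
  ultimately show ?thesis by simp
qed

lemma right_span_trans:
  assumes S: "subring S R" and T: "T \<subseteq> carrier R" and T': "T' \<subseteq> right_span R S T"
  shows "right_span R S T' \<subseteq> right_span R S T"
proof
  fix z assume "z \<in> right_span R S T'"
  then show "z \<in> right_span R S T"
    by induction (use T' in \<open>auto intro!: right_span_zero right_span_add right_span_mult S T\<close>)
qed

text \<open>If \<open>b\<close> had no nonzero right multiple in \<open>a R\<close>, the right ideals generated by
  \<open>b, a b, \<dots>, a\<^sup>m b\<close> would increase strictly.\<close>

lemma right_noetherian_imp_Ore:
  assumes dom: "nc_domain R" and noeth: "right_noetherian R (carrier R)"
  shows "right_Ore_domain R"
proof -
  have C: "subring (carrier R) R" by (rule carrier_is_subring)
  have nz: "\<And>a b. \<lbrakk> a \<in> carrier R; b \<in> carrier R; a \<otimes> b = \<zero> \<rbrakk> \<Longrightarrow> a = \<zero> \<or> b = \<zero>"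
    and one: "\<one> \<noteq> \<zero>"
    using dom unfolding nc_domain_def by auto
  have common: "\<exists>u\<in>carrier R. \<exists>v\<in>carrier R. u \<noteq> \<zero> \<and> b \<otimes> u = a \<otimes> v"
    if a: "a \<in> carrier R" "a \<noteq> \<zero>" and b: "b \<in> carrier R" "b \<noteq> \<zero>" for a b
  proof (rule ccontr)
    assume "\<not> ?thesis"
    then have no: "\<And>u v. \<lbrakk> u \<in> carrier R; v \<in> carrier R; b \<otimes> u = a \<otimes> v \<rbrakk> \<Longrightarrow> u = \<zero>" by blast
    define f where "f i = a [^] i \<otimes> b" for i :: nat
    have f: "range f \<subseteq> carrier R" using a b by (auto simp: f_def)
    then have fm: "\<And>m. f ` {..<m} \<subseteq> carrier R" by auto
    \<comment> \<open>Every generator except the first is \<open>a\<close> times its predecessor, so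
      an element of the span of the first \<open>Suc m\<close> of them is a right multiple of
      \<open>b\<close> plus \<open>a\<close> times an element of the span of the first
      \<open>m\<close>.\<close>
    have split: "\<exists>r\<in>carrier R. \<exists>t\<in>right_span R (carrier R) (f ` {..<m}). z = b \<otimes> r \<oplus> a \<otimes> t"
      if "z \<in> right_span R (carrier R) (f ` {..<Suc m})" for z m
      using that
    proof induction
      case right_span_zero
      then show ?case using a b
        by (intro bexI[of _ \<zero>]) (auto intro: right_span.intros)
    next
      case (right_span_step t s z)
      then obtain i r t' where i: "i < Suc m" "t = f i" and r: "r \<in> carrier R"
        and t': "t' \<in> right_span R (carrier R) (f ` {..<m})" and z: "z = b \<otimes> r \<oplus> a \<otimes> t'"
        by auto
      have t'c: "t' \<in> carrier R" using right_span_subset[OF C fm t'] .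
      have s: "s \<in> carrier R" by fact
      show ?case
      proof (cases i)
        case 0
        have "t \<otimes> s \<oplus> z = b \<otimes> (s \<oplus> r) \<oplus> a \<otimes> t'"
          using a b s r t'c unfolding z i(2) 0 f_def by (simp add: r_distr a_assoc)
        then show ?thesis using s r t' by blast
      next
        case (Suc j)
        have fj: "f j \<in> carrier R" "f j \<otimes> s \<oplus> t' \<in> right_span R (carrier R) (f ` {..<m})"
          using f t' s i(1) Suc by (auto intro!: right_span.right_span_step)
        have "t = a \<otimes> f j" unfolding i(2) Suc f_def using a b
          by (subst nat_pow_Suc2) (simp_all add: m_assoc)
        then have "t \<otimes> s \<oplus> z = b \<otimes> r \<oplus> a \<otimes> (f j \<otimes> s \<oplus> t')"
          unfolding z using a(1) b(1) s r t'c fj(1) by algebra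
        then show ?thesis using fj r by blast
      qed
    qed
    have "f m \<notin> right_span R (carrier R) (f ` {..<m})" for m
    proof (induction m)
      case 0
      have "right_span R (carrier R) {} \<subseteq> {\<zero>}" by (auto elim: right_span.cases)
      then show ?case using a b by (auto simp: f_def)
    next
      case (Suc m)
      show ?case
      proof
        assume "f (Suc m) \<in> right_span R (carrier R) (f ` {..<Suc m})"
        from split[OF this] obtain r t where r: "r \<in> carrier R"
          and t: "t \<in> right_span R (carrier R) (f ` {..<m})" and eq: "f (Suc m) = b \<otimes> r \<oplus> a \<otimes> t"
          by blast
        have tc: "t \<in> carrier R" using right_span_subset[OF C fm t] .
        have fmc: "f m \<in> carrier R" using f by auto
        have "f (Suc m) = a \<otimes> f m" unfolding f_def using a b
          by (subst nat_pow_Suc2) (simp_all add: m_assoc)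
        then have eq': "a \<otimes> f m = b \<otimes> r \<oplus> a \<otimes> t" using eq by simp
        \<comment> \<open>Isolating \<open>b r\<close> exhibits it as a right multiple of
          \<open>a\<close>, so \<open>r = 0\<close> by the choice of \<open>a\<close> and
          \<open>b\<close>; cancelling \<open>a\<close> then puts \<open>f m\<close> into the span
          of its predecessors.\<close>
        have "b \<otimes> r = (b \<otimes> r \<oplus> a \<otimes> t) \<ominus> a \<otimes> t" using a(1) b(1) r tc by algebra
        also have "\<dots> = a \<otimes> (f m \<ominus> t)" unfolding eq'[symmetric] using a(1) fmc tc by algebra
        finally have "b \<otimes> r = a \<otimes> (f m \<ominus> t)" .
        moreover from this have "r = \<zero>" using no[of r "f m \<ominus> t"] r fmc tc by simp
        ultimately have "a \<otimes> (f m \<ominus> t) = \<zero>" using b by simp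
        then have "f m \<ominus> t = \<zero>" using nz a fmc tc by blast
        then have "f m = t" using fmc tc by simp
        then show False using Suc t by simp
      qed
    qed
    then show False using noeth f unfolding right_noetherian_def by blast
  qed
  have "\<exists>u\<in>carrier R - {\<zero>}. \<exists>v\<in>carrier R. a \<otimes> u = b \<otimes> v"
    if a: "a \<in> carrier R" and b: "b \<in> carrier R - {\<zero>}" for a b
  proof (cases "a = \<zero>")
    case True
    then show ?thesis using b one by (intro bexI[of _ \<one>] bexI[of _ \<zero>]) auto
  next
    case False
    then show ?thesis using common[of b a] a b by blast
  qed
  then show ?thesis using dom unfolding right_Ore_domain_def by blast
qed

end

text \<open>The index is a strict bound for the degree: at 0 there is only zero, and the coefficient
  added at \<open>Suc N\<close> belongs to \<open>x^N\<close>. Leading coefficients may vanish, so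
  over a subring the sets increase with the index.\<close>

primrec left_polys :: "('a, 'm) ring_scheme \<Rightarrow> 'a set \<Rightarrow> 'a \<Rightarrow> nat \<Rightarrow> 'a set" where
  "left_polys A S x 0 = {\<zero>\<^bsub>A\<^esub>}"
| "left_polys A S x (Suc N) =
     {c \<otimes>\<^bsub>A\<^esub> x [^]\<^bsub>A\<^esub> N \<oplus>\<^bsub>A\<^esub> f | c f. c \<in> S \<and> f \<in> left_polys A S x N}"

section \<open>The skew Hilbert basis theorem\<close>

locale skew_extension = ring A for A (structure) +
  fixes R S :: "'a set" and x :: 'a and \<tau> \<delta> :: "'a \<Rightarrow> 'a"
  assumes R: "subring R A" and S: "subring S A" and R_sub_S: "R \<subseteq> S" and x_S: "x \<in> S"
    and \<tau>: "\<tau> ` R = R" and \<delta>: "\<And>r. r \<in> R \<Longrightarrow> \<delta> r \<in> R"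
    and x_mult: "\<And>r. r \<in> R \<Longrightarrow> x \<otimes> r = \<tau> r \<otimes> x \<oplus> \<delta> r"
    and generate: "\<And>s. s \<in> S \<Longrightarrow> \<exists>N. s \<in> left_polys A R x N"
begin

abbreviation "Fl \<equiv> left_polys A R x"

lemma R_carr [simp, intro]: "r \<in> R \<Longrightarrow> r \<in> carrier A"
  and S_carr [simp, intro]: "r \<in> S \<Longrightarrow> r \<in> carrier A"
  and x_carr [simp]: "x \<in> carrier A"
  using subringE(1)[OF R] subringE(1)[OF S] x_S by auto

lemma \<tau>_closed [simp, intro]: "r \<in> R \<Longrightarrow> \<tau> r \<in> R"
  using \<tau> by auto

lemma \<tau>_pow_image: "(\<tau> ^^ N) ` R = R"
proof (induction N)
  case (Suc N)
  have "(\<tau> ^^ Suc N) ` R = \<tau> ` (\<tau> ^^ N) ` R" by (simp add: image_image)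
  then show ?case using Suc \<tau> by simp
qed simp

lemma Fl_carr: "f \<in> Fl N \<Longrightarrow> f \<in> S"
  using subringE[OF S] R_sub_S x_S
proof (induction N arbitrary: f)
  case (Suc N)
  have "x [^] N \<in> S" using subringE(3,6)[OF S] x_S by (induction N) auto
  then show ?case using Suc by (auto simp: left_polys.simps(2))
qed auto

lemma Fl_SucI: "c \<in> R \<Longrightarrow> f \<in> Fl N \<Longrightarrow> c \<otimes> x [^] N \<oplus> f \<in> Fl (Suc N)"
  by auto

lemma Fl_SucE:
  assumes "f \<in> Fl (Suc N)"
  obtains c g where "f = c \<otimes> x [^] N \<oplus> g" "c \<in> R" "g \<in> Fl N"
  using assms by auto

declare left_polys.simps(2) [simp del]

lemma Fl_Suc: "f \<in> Fl N \<Longrightarrow> f \<in> Fl (Suc N)"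
  using Fl_SucI[OF subringE(2)[OF R], of f N] Fl_carr[of f N] by (simp add: S_carr)

lemma Fl_zero: "\<zero> \<in> Fl N"
  by (induction N) (auto intro: Fl_Suc)

lemma Fl_monom: "c \<in> R \<Longrightarrow> c \<otimes> x [^] N \<in> Fl (Suc N)"
  using Fl_SucI[OF _ Fl_zero, of c N] by (simp add: R_carr)

lemma Fl_add: "f \<in> Fl N \<Longrightarrow> g \<in> Fl N \<Longrightarrow> f \<oplus> g \<in> Fl N"
proof (induction N arbitrary: f g)
  case (Suc N)
  obtain c f' where f: "f = c \<otimes> x [^] N \<oplus> f'" "c \<in> R" "f' \<in> Fl N"
    using Suc.prems(1) by (rule Fl_SucE)
  obtain d g' where g: "g = d \<otimes> x [^] N \<oplus> g'" "d \<in> R" "g' \<in> Fl N"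
    using Suc.prems(2) by (rule Fl_SucE)
  have "c \<in> carrier A" "d \<in> carrier A" "f' \<in> carrier A" "g' \<in> carrier A" "x [^] N \<in> carrier A"
    using f g Fl_carr by auto
  then have "f \<oplus> g = (c \<oplus> d) \<otimes> x [^] N \<oplus> (f' \<oplus> g')"
    unfolding f(1) g(1) by algebra
  moreover have "c \<oplus> d \<in> R" using f g subringE(7)[OF R] by blast
  ultimately show ?case using f g Suc.IH Fl_SucI by metis
qed auto

lemma Fl_lmult: "r \<in> R \<Longrightarrow> f \<in> Fl N \<Longrightarrow> r \<otimes> f \<in> Fl N"
proof (induction N arbitrary: f)
  case (Suc N)
  then obtain c f' where f: "f = c \<otimes> x [^] N \<oplus> f'" "c \<in> R" "f' \<in> Fl N"
    by (auto elim: Fl_SucE)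
  have "c \<in> carrier A" "f' \<in> carrier A" "x [^] N \<in> carrier A" "r \<in> carrier A"
    using f Suc.prems Fl_carr by auto
  then have "r \<otimes> f = (r \<otimes> c) \<otimes> x [^] N \<oplus> r \<otimes> f'"
    unfolding f(1) by algebra
  moreover have "r \<otimes> c \<in> R" using f Suc.prems subringE(6)[OF R] by blast
  ultimately show ?case using f Suc.IH Suc.prems(1) Fl_SucI by metis
qed auto

lemma Fl_uminus: "f \<in> Fl N \<Longrightarrow> \<ominus> f \<in> Fl N"
proof -
  assume f: "f \<in> Fl N"
  have "\<ominus> \<one> \<in> R" using subringE[OF R] by auto
  then have "\<ominus> \<one> \<otimes> f \<in> Fl N" using f by (rule Fl_lmult)
  then show ?thesis using Fl_carr[OF f] by (simp add: l_minus)
qed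

lemma Fl_rmult_x: "f \<in> Fl N \<Longrightarrow> f \<otimes> x \<in> Fl (Suc N)"
proof (induction N arbitrary: f)
  case (Suc N)
  then obtain c f' where f: "f = c \<otimes> x [^] N \<oplus> f'" "c \<in> R" "f' \<in> Fl N"
    by (auto elim: Fl_SucE)
  have "f' \<in> carrier A" using f Fl_carr by auto
  then have "f \<otimes> x = c \<otimes> x [^] Suc N \<oplus> f' \<otimes> x"
    using f(2) unfolding f(1) by (simp add: l_distr m_assoc R_carr)
  moreover have "f' \<otimes> x \<in> Fl (Suc N)" using Suc f by blast
  ultimately show ?case using f Fl_SucI by metis
qed (simp add: Fl_zero)

lemma Fl_lmult_x: "f \<in> Fl N \<Longrightarrow> x \<otimes> f \<in> Fl (Suc N)"
proof (induction N arbitrary: f)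
  case 0
  then show ?case by (simp add: Fl_zero)
next
  case (Suc N)
  then obtain c f' where f: "f = c \<otimes> x [^] N \<oplus> f'" "c \<in> R" "f' \<in> Fl N"
    by (auto elim: Fl_SucE)
  have car: "f' \<in> carrier A" "c \<in> carrier A" "\<tau> c \<in> carrier A" "\<delta> c \<in> carrier A" "x [^] N \<in> carrier A"
    using f Fl_carr \<delta> by auto
  have "x \<otimes> f = (x \<otimes> c) \<otimes> x [^] N \<oplus> x \<otimes> f'"
    unfolding f(1) using car x_carr by algebra
  also have "\<dots> = \<tau> c \<otimes> (x \<otimes> x [^] N) \<oplus> (\<delta> c \<otimes> x [^] N \<oplus> x \<otimes> f')"
    unfolding x_mult[OF f(2)] using car x_carr by algebra
  also have "\<dots> = \<tau> c \<otimes> x [^] Suc N \<oplus> (\<delta> c \<otimes> x [^] N \<oplus> x \<otimes> f')"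
    by (simp only: nat_pow_Suc2[OF x_carr])
  finally have "x \<otimes> f = \<tau> c \<otimes> x [^] Suc N \<oplus> (\<delta> c \<otimes> x [^] N \<oplus> x \<otimes> f')" .
  moreover have "\<delta> c \<otimes> x [^] N \<oplus> x \<otimes> f' \<in> Fl (Suc N)"
    using Suc f \<delta> by (intro Fl_add Fl_monom) auto
  ultimately show ?case using f Fl_SucI \<tau>_closed by metis
qed

text \<open>Each passage of \<open>x\<close> across a coefficient applies \<tau>, while the terms
  coming from \<delta> drop in degree; hence only the \<open>N\<close>-th iterate of \<tau> is
  visible in the leading coefficient.\<close>

lemma pow_x_mult:
  "r \<in> R \<Longrightarrow> \<exists>f\<in>Fl N. x [^] N \<otimes> r = (\<tau> ^^ N) r \<otimes> x [^] N \<oplus> f"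
proof (induction N)
  case 0
  then show ?case by (auto simp: R_carr)
next
  case (Suc N)
  then obtain f where f: "f \<in> Fl N" "x [^] N \<otimes> r = (\<tau> ^^ N) r \<otimes> x [^] N \<oplus> f" by auto
  let ?t = "(\<tau> ^^ N) r"
  have t: "?t \<in> R" using \<tau>_pow_image[of N] Suc(2) by auto
  have car: "f \<in> carrier A" "?t \<in> carrier A" "\<tau> ?t \<in> carrier A" "\<delta> ?t \<in> carrier A" "x [^] N \<in> carrier A"
    "r \<in> carrier A"
    using f(1) Fl_carr \<delta> t Suc(2) by auto
  have "x [^] Suc N \<otimes> r = x \<otimes> (x [^] N \<otimes> r)"
    unfolding nat_pow_Suc2[OF x_carr] using car by (intro m_assoc) auto
  also have "\<dots> = (x \<otimes> ?t) \<otimes> x [^] N \<oplus> x \<otimes> f"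
    unfolding f(2) using car x_carr by algebra
  also have "\<dots> = \<tau> ?t \<otimes> (x \<otimes> x [^] N) \<oplus> (\<delta> ?t \<otimes> x [^] N \<oplus> x \<otimes> f)"
    unfolding x_mult[OF t] using car x_carr by algebra
  also have "\<dots> = (\<tau> ^^ Suc N) r \<otimes> x [^] Suc N \<oplus> (\<delta> ?t \<otimes> x [^] N \<oplus> x \<otimes> f)"
    by (simp only: nat_pow_Suc2[OF x_carr] funpow.simps o_apply)
  finally have "x [^] Suc N \<otimes> r = (\<tau> ^^ Suc N) r \<otimes> x [^] Suc N \<oplus> (\<delta> ?t \<otimes> x [^] N \<oplus> x \<otimes> f)" .
  moreover have "\<delta> ?t \<otimes> x [^] N \<oplus> x \<otimes> f \<in> Fl (Suc N)"
    using f t \<delta> by (intro Fl_add Fl_monom Fl_lmult_x) auto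
  ultimately show ?case by blast
qed

lemma Fl_rmult: "r \<in> R \<Longrightarrow> f \<in> Fl N \<Longrightarrow> f \<otimes> r \<in> Fl N"
proof (induction N arbitrary: f)
  case 0
  then show ?case by auto
next
  case (Suc N)
  then obtain c f' where f: "f = c \<otimes> x [^] N \<oplus> f'" "c \<in> R" "f' \<in> Fl N"
    by (auto elim: Fl_SucE)
  obtain g where g: "g \<in> Fl N" "x [^] N \<otimes> r = (\<tau> ^^ N) r \<otimes> x [^] N \<oplus> g"
    using pow_x_mult Suc by blast
  have t: "(\<tau> ^^ N) r \<in> R" using \<tau>_pow_image[of N] Suc by auto
  have car: "f' \<in> carrier A" "c \<in> carrier A" "g \<in> carrier A" "x [^] N \<in> carrier A" "r \<in> carrier A"
    "(\<tau> ^^ N) r \<in> carrier A"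
    using f g Fl_carr Suc t by auto
  have "f \<otimes> r = c \<otimes> (x [^] N \<otimes> r) \<oplus> f' \<otimes> r" unfolding f(1) using car by algebra
  also have "\<dots> = (c \<otimes> (\<tau> ^^ N) r) \<otimes> x [^] N \<oplus> (c \<otimes> g \<oplus> f' \<otimes> r)"
    unfolding g(2) using car by algebra
  finally have eq: "f \<otimes> r = (c \<otimes> (\<tau> ^^ N) r) \<otimes> x [^] N \<oplus> (c \<otimes> g \<oplus> f' \<otimes> r)" .
  have "c \<otimes> g \<oplus> f' \<otimes> r \<in> Fl N" using Fl_add[OF Fl_lmult[OF f(2) g(1)] Suc.IH[OF Suc.prems(1) f(3)]] .
  moreover have "c \<otimes> (\<tau> ^^ N) r \<in> R" using f(2) t subringE(6)[OF R] by auto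
  ultimately show ?case unfolding eq by (rule Fl_SucI[rotated])
qed

text \<open>The multiplier is \<open>x^e r'\<close>, where the iterate of \<tau> of order
  \<open>N + e\<close> sends \<open>r'\<close> to \<open>r\<close>; surjectivity of \<tau> on
  \<open>R\<close> provides \<open>r'\<close>. Thus right multiples of a polynomial realise all
  right multiples of its leading coefficient, in every degree from \<open>N\<close> on.\<close>

lemma leading_term_mult:
  assumes c: "c \<in> R" and f: "f \<in> Fl N" and r: "r \<in> R"
  shows "\<exists>s\<in>S. \<exists>g\<in>Fl (N + e). (c \<otimes> x [^] N \<oplus> f) \<otimes> s = (c \<otimes> r) \<otimes> x [^] (N + e) \<oplus> g"
proof -
  obtain r' where r': "r' \<in> R" "(\<tau> ^^ (N + e)) r' = r"
    using r \<tau>_pow_image[of "N + e"] by (metis imageE)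
  have xe: "x [^] e \<in> S" using subringE(3,6)[OF S] x_S by (induction e) auto
  have fe: "f \<otimes> x [^] e \<in> Fl (N + e)"
  proof (induction e)
    case 0
    then show ?case using f Fl_carr[OF f] by simp
  next
    case (Suc e)
    have "f \<otimes> x [^] Suc e = f \<otimes> x [^] e \<otimes> x" using Fl_carr[OF f] by (simp add: m_assoc)
    then show ?case using Fl_rmult_x[OF Suc] by (simp del: nat_pow_Suc)
  qed
  obtain g where g: "g \<in> Fl (N + e)" "x [^] (N + e) \<otimes> r' = r \<otimes> x [^] (N + e) \<oplus> g"
    using pow_x_mult[OF r'(1), of "N + e"] r' by auto
  have car: "c \<in> carrier A" "f \<in> carrier A" "r \<in> carrier A" "r' \<in> carrier A" "g \<in> carrier A"
    "x [^] N \<in> carrier A" "x [^] e \<in> carrier A" "x [^] (N + e) \<in> carrier A"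
    using c f r r' g Fl_carr by auto
  have "(c \<otimes> x [^] N \<oplus> f) \<otimes> (x [^] e \<otimes> r') = c \<otimes> ((x [^] N \<otimes> x [^] e) \<otimes> r') \<oplus> (f \<otimes> x [^] e) \<otimes> r'"
    using car by algebra
  also have "\<dots> = c \<otimes> (x [^] (N + e) \<otimes> r') \<oplus> (f \<otimes> x [^] e) \<otimes> r'"
    by (simp only: nat_pow_mult[OF x_carr])
  also have "\<dots> = (c \<otimes> r) \<otimes> x [^] (N + e) \<oplus> (c \<otimes> g \<oplus> (f \<otimes> x [^] e) \<otimes> r')"
    unfolding g(2) using car by algebra
  finally have "(c \<otimes> x [^] N \<oplus> f) \<otimes> (x [^] e \<otimes> r')
      = (c \<otimes> r) \<otimes> x [^] (N + e) \<oplus> (c \<otimes> g \<oplus> (f \<otimes> x [^] e) \<otimes> r')" .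
  moreover have "c \<otimes> g \<oplus> (f \<otimes> x [^] e) \<otimes> r' \<in> Fl (N + e)"
    using Fl_add[OF Fl_lmult[OF c g(1)] Fl_rmult[OF r'(1) fe]] .
  moreover have "x [^] e \<otimes> r' \<in> S" using xe r' R_sub_S subringE(6)[OF S] by auto
  ultimately show ?thesis by blast
qed

text \<open>Hilbert's argument: in a right ideal that is not finitely generated, choose successively
  elements of least degree outside the right ideal of their predecessors. As soon as a leading
  coefficient falls into the right ideal generated by the earlier ones, cancelling the leading term
  contradicts minimality.\<close>

theorem right_noetherian_extension:
  assumes noeth: "right_noetherian A R"
  shows "right_noetherian A S"
proof (rule ccontr)
  assume "\<not> ?thesis"
  then obtain f :: "nat \<Rightarrow> 'a" where f: "range f \<subseteq> S"
    and fm: "\<And>m. f m \<notin> right_span A S (f ` {..<m})"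
    unfolding right_noetherian_def by blast
  define I where "I = right_span A S (range f)"
  have rf: "range f \<subseteq> carrier A" using f by auto
  have IS: "I \<subseteq> S" using right_span_closed_subring[OF S f] unfolding I_def by auto
  then have Ic: "I \<subseteq> carrier A" by auto
  have ex: "\<exists>g. g \<in> I - right_span A S G" if G: "finite G" "G \<subseteq> I" for G
  proof -
    obtain m where "G \<subseteq> right_span A S (f ` {..<m})"
      using right_span_finite_support_set G unfolding I_def by blast
    then have "right_span A S G \<subseteq> right_span A S (f ` {..<m})"
      using rf by (intro right_span_trans[OF S]) auto
    then have "f m \<notin> right_span A S G" using fm by blast
    moreover have "f m \<in> I" unfolding I_def by (rule right_span_incl[OF S rf]) auto
    ultimately show ?thesis by blast
  qed
  \<comment> \<open>On \<open>I\<close> this is one more than the usual degree: it is 0 only for the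
    zero element, and otherwise the leading power is \<open>x^(deg g - 1)\<close>.\<close>
  define deg where "deg g = (LEAST N. g \<in> Fl N)" for g
  have deg: "g \<in> Fl (deg g)" if "g \<in> I" for g
    unfolding deg_def using generate[of g] IS that by (metis LeastI subsetD)
  have deg_le: "deg g \<le> N" if "g \<in> Fl N" for g N
    unfolding deg_def using that by (rule Least_le)
  define pick where "pick G = arg_min deg (\<lambda>g. g \<in> I - right_span A S G)" for G
  have pick: "pick G \<in> I - right_span A S G"
    and pick_min: "\<And>h. h \<in> I - right_span A S G \<Longrightarrow> deg (pick G) \<le> deg h"
    if G: "finite G" "G \<subseteq> I" for G
    using arg_min_nat_lemma[of "\<lambda>g. g \<in> I - right_span A S G" _ deg] ex[OF G]
    unfolding pick_def by blast+
  \<comment> \<open>Each choice depends on all elements picked before, so the recursion runs over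
    the finite sets of these.\<close>
  define gs where "gs = rec_nat {} (\<lambda>_ G. insert (pick G) G)"
  define g where "g m = pick (gs m)" for m :: nat
  have gs: "gs m = g ` {..<m}" for m
    by (induction m) (simp_all add: gs_def g_def lessThan_Suc)
  have gs_I: "gs m \<subseteq> I" for m
  proof (induction m)
    case (Suc m)
    have "pick (gs m) \<in> I" using pick[of "gs m"] Suc gs by auto
    then show ?case using Suc unfolding gs_def by simp
  qed (simp add: gs_def)
  have g_new: "g m \<in> I - right_span A S (g ` {..<m})"
    and g_min: "\<And>h. h \<in> I - right_span A S (g ` {..<m}) \<Longrightarrow> deg (g m) \<le> deg h" for m
    using pick[of "gs m"] pick_min[of "gs m"] gs_I[of m] gs[of m] by (auto simp: g_def[of m])
  have gI: "g m \<in> I" for m using g_new by blast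
  have gc: "g ` {..<m} \<subseteq> carrier A" for m using gI Ic by auto
  have deg_mono: "deg (g i) \<le> deg (g m)" if "i \<le> m" for i m
  proof (rule g_min)
    have "g ` {..<i} \<subseteq> g ` {..<m}" using that by auto
    then show "g m \<in> I - right_span A S (g ` {..<i})" using g_new[of m] right_span_mono by blast
  qed
  have pos: "deg (g m) \<noteq> 0" for m
  proof
    assume "deg (g m) = 0"
    then have "g m = \<zero>" using deg[OF gI[of m]] by simp
    then show False using g_new[of m] by (auto intro: right_span_zero)
  qed
  define N where "N m = deg (g m) - 1" for m
  have SucN: "deg (g m) = Suc (N m)" for m using pos[of m] unfolding N_def by simp
  have "\<exists>a b. a \<in> R \<and> b \<in> Fl (N m) \<and> g m = a \<otimes> x [^] N m \<oplus> b" for m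
    using deg[OF gI[of m]] unfolding SucN by (auto elim: Fl_SucE)
  then obtain a b where a: "\<And>m. a m \<in> R" and b: "\<And>m. b m \<in> Fl (N m)"
    and g: "\<And>m. g m = a m \<otimes> x [^] N m \<oplus> b m"
    by metis
  obtain m where m: "a m \<in> right_span A R (a ` {..<m})"
    using noeth a unfolding right_noetherian_def by blast
  \<comment> \<open>Every \<open>z\<close> in the right ideal generated by the earlier leading
    coefficients occurs as coefficient of \<open>x^(N m)\<close> in an element of the right ideal
    generated by the earlier \<open>g i\<close>. The degrees are nondecreasing, so each
    \<open>g i\<close> can be raised to degree \<open>N m\<close> by a power of
    \<open>x\<close>.\<close>
  have "\<exists>h\<in>right_span A S (g ` {..<m}). \<exists>k\<in>Fl (N m). h = z \<otimes> x [^] N m \<oplus> k"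
    if "z \<in> right_span A R (a ` {..<m})" for z
    using that
  proof induction
    case right_span_zero
    then show ?case using Fl_zero[of "N m"]
      by (intro bexI[of _ \<zero>]) (auto intro: right_span.intros)
  next
    case (right_span_step t r z)
    then obtain i h k where i: "i < m" "t = a i" and h: "h \<in> right_span A S (g ` {..<m})"
      and k: "k \<in> Fl (N m)" "h = z \<otimes> x [^] N m \<oplus> k" by auto
    have "N i \<le> N m" using deg_mono[of i m] i unfolding N_def by simp
    then obtain e where e: "N m = N i + e" by (auto simp: le_iff_add)
    obtain s l where s: "s \<in> S" and l: "l \<in> Fl (N m)"
      and eq: "g i \<otimes> s = (t \<otimes> r) \<otimes> x [^] N m \<oplus> l"
      using leading_term_mult[OF a[of i] b[of i] right_span_step(2), of e]
      unfolding e[symmetric] g[of i] i(2) by blast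
    have tr: "t \<in> carrier A" "r \<in> carrier A" using i a right_span_step(2) by auto
    have z: "z \<in> carrier A"
      using right_span_subset[OF R _ right_span_step(3)] a by auto
    have kl: "k \<in> carrier A" "l \<in> carrier A" using k l Fl_carr by auto
    have "g i \<otimes> s \<oplus> h = (t \<otimes> r \<oplus> z) \<otimes> x [^] N m \<oplus> (l \<oplus> k)"
      unfolding eq k(2) using tr z kl nat_pow_closed[OF x_carr, of "N m"] by algebra
    moreover have "g i \<otimes> s \<oplus> h \<in> right_span A S (g ` {..<m})"
      using i s h by (intro right_span.right_span_step) auto
    ultimately show ?case using Fl_add[OF l k(1)] by blast
  qed
  from this[OF m] obtain h k where h: "h \<in> right_span A S (g ` {..<m})"
    and k: "k \<in> Fl (N m)" "h = a m \<otimes> x [^] N m \<oplus> k" by blast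
  have hI: "h \<in> I" using h right_span_trans[OF S rf, of "g ` {..<m}"] gI
    unfolding I_def by blast
  have diffI: "g m \<ominus> h \<in> I" using gI hI unfolding I_def by (intro right_span_minus[OF S rf])
  have hc: "h \<in> carrier A" "g m \<in> carrier A" using hI gI Ic by auto
  \<comment> \<open>Subtracting \<open>h\<close> does not bring \<open>g m\<close> into the span,
    but it removes the leading term.\<close>
  have "g m \<ominus> h \<notin> right_span A S (g ` {..<m})"
  proof
    assume "g m \<ominus> h \<in> right_span A S (g ` {..<m})"
    from right_span_add[OF S gc this h] have "(g m \<ominus> h) \<oplus> h \<in> right_span A S (g ` {..<m})" .
    moreover have "(g m \<ominus> h) \<oplus> h = g m" using hc by algebra
    ultimately show False using g_new[of m] by simp
  qed
  then have "deg (g m) \<le> deg (g m \<ominus> h)" using g_min diffI by blast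
  moreover have "g m \<ominus> h = b m \<oplus> \<ominus> k"
  proof -
    have "a m \<in> carrier A" "b m \<in> carrier A" "k \<in> carrier A" "x [^] N m \<in> carrier A"
      using a b[THEN Fl_carr] k Fl_carr by auto
    then show ?thesis unfolding g[of m] k(2) by algebra
  qed
  then have "deg (g m \<ominus> h) \<le> N m"
    using b k by (intro deg_le) (auto intro: Fl_add Fl_uminus)
  ultimately show False unfolding SucN by simp
qed

end

section \<open>Division rings of fractions\<close>

locale ore_domain = ring R for R (structure) +
  assumes ore_domain: "right_Ore_domain R"
begin

abbreviation "Rnz \<equiv> carrier R - {\<zero>}"
abbreviation "cl \<equiv> frac_class R"

lemma mult_eq_zero: "\<lbrakk> a \<in> carrier R; b \<in> carrier R; a \<otimes> b = \<zero> \<rbrakk> \<Longrightarrow> a = \<zero> \<or> b = \<zero>"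
  and one_nonzero: "\<one> \<in> Rnz"
  and ore: "\<lbrakk> a \<in> carrier R; b \<in> Rnz \<rbrakk> \<Longrightarrow> \<exists>u\<in>Rnz. \<exists>v\<in>carrier R. a \<otimes> u = b \<otimes> v"
  using ore_domain unfolding right_Ore_domain_def nc_domain_def by auto

lemma Rnz_mult: "\<lbrakk> a \<in> Rnz; b \<in> Rnz \<rbrakk> \<Longrightarrow> a \<otimes> b \<in> Rnz"
  using mult_eq_zero by auto

lemma nc_r_cancel:
  assumes "s \<in> Rnz" "a \<in> carrier R" "b \<in> carrier R" "a \<otimes> s = b \<otimes> s"
  shows "a = b"
proof -
  have "(a \<ominus> b) \<otimes> s = \<zero>" using assms by (simp add: minus_eq l_distr l_minus r_neg)
  then have "a \<ominus> b = \<zero>" using mult_eq_zero assms by blast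
  then show ?thesis using assms by simp
qed

lemma nc_l_cancel:
  assumes "s \<in> Rnz" "a \<in> carrier R" "b \<in> carrier R" "s \<otimes> a = s \<otimes> b"
  shows "a = b"
proof -
  have "s \<otimes> (a \<ominus> b) = \<zero>" using assms by (simp add: minus_eq r_distr r_minus r_neg)
  then have "a \<ominus> b = \<zero>" using mult_eq_zero assms by blast
  then show ?thesis using assms by simp
qed

text \<open>From one common expansion to all of them: two common multiples of the denominators have
  a further common multiple by the Ore condition, and cancellation brings the equality back. The
  universal form frees the later proofs of well-definedness from any choice.\<close>

lemma frac_rel_imp_all:
  assumes rel: "((a, b), (c, d)) \<in> frac_rel R"
    and u: "u \<in> carrier R" and v: "v \<in> carrier R" and eq: "b \<otimes> u = d \<otimes> v"
  shows "a \<otimes> u = c \<otimes> v"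
proof -
  from rel obtain u0 v0 where C: "a \<in> carrier R" "b \<in> Rnz" "c \<in> carrier R" "d \<in> Rnz"
    and u0: "u0 \<in> carrier R" "v0 \<in> carrier R" "a \<otimes> u0 = c \<otimes> v0" "b \<otimes> u0 = d \<otimes> v0"
    "b \<otimes> u0 \<noteq> \<zero>"
    unfolding frac_rel_def by blast
  have u0nz: "u0 \<in> Rnz" using u0(1,5) C by (cases "u0 = \<zero>") simp_all
  obtain t s where t: "t \<in> Rnz" and s: "s \<in> carrier R" and ts: "u \<otimes> t = u0 \<otimes> s"
    using ore[OF u u0nz] by blast
  have Cs: "a \<in> carrier R" "b \<in> carrier R" "c \<in> carrier R" "d \<in> carrier R" "t \<in> carrier R"
    using C t by auto
  have "d \<otimes> (v \<otimes> t) = b \<otimes> u \<otimes> t" using Cs v unfolding eq by (simp add: m_assoc)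
  also have "\<dots> = b \<otimes> u0 \<otimes> s" using Cs u u0(1) s ts by (simp add: m_assoc)
  also have "\<dots> = d \<otimes> (v0 \<otimes> s)" unfolding u0(4) using Cs u0 s by (simp add: m_assoc)
  finally have vt: "v \<otimes> t = v0 \<otimes> s" using nc_l_cancel[OF C(4)] v Cs u0 s by simp
  have "a \<otimes> u \<otimes> t = a \<otimes> u0 \<otimes> s" using Cs u u0(1) s ts by (simp add: m_assoc)
  also have "\<dots> = c \<otimes> (v0 \<otimes> s)" unfolding u0(3) using Cs u0 s by (simp add: m_assoc)
  also have "\<dots> = c \<otimes> v \<otimes> t" unfolding vt[symmetric] using Cs v by (simp add: m_assoc)
  finally show ?thesis using nc_r_cancel[OF t] Cs u v by simp
qed

text \<open>The Ore condition supplies a common multiple of the denominators, so the universal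
  condition is never vacuous.\<close>

lemma frac_relI:
  assumes C: "a \<in> carrier R" "b \<in> Rnz" "c \<in> carrier R" "d \<in> Rnz"
    and all: "\<And>u v. \<lbrakk> u \<in> carrier R; v \<in> carrier R; b \<otimes> u = d \<otimes> v \<rbrakk> \<Longrightarrow> a \<otimes> u = c \<otimes> v"
  shows "((a, b), (c, d)) \<in> frac_rel R"
proof -
  obtain u v where u: "u \<in> Rnz" and v: "v \<in> carrier R" and eq: "b \<otimes> u = d \<otimes> v"
    using ore C by blast
  have "b \<otimes> u \<noteq> \<zero>" using mult_eq_zero u C by blast
  then show ?thesis unfolding frac_rel_def using C u v eq all[OF _ v eq] by blast
qed

lemma frac_rel_iff:
  assumes "a \<in> carrier R" "b \<in> Rnz" "c \<in> carrier R" "d \<in> Rnz"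
  shows "((a, b), (c, d)) \<in> frac_rel R \<longleftrightarrow>
    (\<forall>u\<in>carrier R. \<forall>v\<in>carrier R. b \<otimes> u = d \<otimes> v \<longrightarrow> a \<otimes> u = c \<otimes> v)"
  using frac_rel_imp_all frac_relI[OF assms] by blast

lemma frac_rel_carrier:
  "((a, b), (c, d)) \<in> frac_rel R \<Longrightarrow> a \<in> carrier R \<and> b \<in> Rnz \<and> c \<in> carrier R \<and> d \<in> Rnz"
  unfolding frac_rel_def by auto

lemma frac_rel_sym: "((a, b), (c, d)) \<in> frac_rel R \<Longrightarrow> ((c, d), (a, b)) \<in> frac_rel R"
  unfolding frac_rel_def by (auto) metis

lemma frac_rel_trans:
  assumes r: "((a, b), (c, d)) \<in> frac_rel R" and s: "((c, d), (e, f)) \<in> frac_rel R"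
  shows "((a, b), (e, f)) \<in> frac_rel R"
proof -
  note C = frac_rel_carrier[OF r] frac_rel_carrier[OF s]
  obtain u v where u: "u \<in> Rnz" and v: "v \<in> carrier R" and uv: "b \<otimes> u = d \<otimes> v"
    using ore[of b d] C by blast
  have au: "a \<otimes> u = c \<otimes> v" using frac_rel_imp_all[OF r _ v uv] u by blast
  have "b \<otimes> u \<in> Rnz" using Rnz_mult u C by blast
  then have dv: "d \<otimes> v \<in> Rnz" unfolding uv .
  obtain s' t where s': "s' \<in> Rnz" and t: "t \<in> carrier R" and st: "d \<otimes> v \<otimes> s' = f \<otimes> t"
    using ore[of "d \<otimes> v" f] C dv by blast
  have Cs: "a \<in> carrier R" "b \<in> carrier R" "c \<in> carrier R" "d \<in> carrier R" "e \<in> carrier R"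
    "f \<in> carrier R" "u \<in> carrier R" "s' \<in> carrier R" using C u s' by auto
  have st': "d \<otimes> (v \<otimes> s') = f \<otimes> t" using st Cs v by (simp add: m_assoc)
  have "c \<otimes> (v \<otimes> s') = e \<otimes> t" using frac_rel_imp_all[OF s _ t st'] v Cs by blast
  then have "a \<otimes> (u \<otimes> s') = e \<otimes> t" using au Cs v by (simp flip: m_assoc)
  moreover have "b \<otimes> (u \<otimes> s') = f \<otimes> t" using uv st Cs v by (simp flip: m_assoc)
  moreover have "b \<otimes> (u \<otimes> s') \<in> Rnz" using C u s' by (intro Rnz_mult) auto
  ultimately show ?thesis unfolding frac_rel_def using C t Cs m_closed[of u s'] by blast
qed

lemma frac_rel_equiv: "equiv (carrier R \<times> Rnz) (frac_rel R)"
proof (rule equivI)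
  show "frac_rel R \<subseteq> (carrier R \<times> Rnz) \<times> (carrier R \<times> Rnz)"
    unfolding frac_rel_def by auto
  show "refl_on (carrier R \<times> Rnz) (frac_rel R)"
  proof (rule refl_onI)
    fix p assume "p \<in> carrier R \<times> Rnz"
    then obtain a b where p: "p = (a, b)" "a \<in> carrier R" "b \<in> Rnz" by auto
    then have "a \<otimes> \<one> = a \<otimes> \<one>" "b \<otimes> \<one> = b \<otimes> \<one>" "b \<otimes> \<one> \<noteq> \<zero>" by auto
    then show "(p, p) \<in> frac_rel R" unfolding frac_rel_def p(1) using p(2,3) one_closed by blast
  qed
  show "sym (frac_rel R)" using frac_rel_sym by (auto intro!: symI)
  show "trans (frac_rel R)" using frac_rel_trans by (auto intro!: transI)
qed

lemma frac_class_eq_iff_rel: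
  assumes "a \<in> carrier R" "b \<in> Rnz" "c \<in> carrier R" "d \<in> Rnz"
  shows "cl a b = cl c d \<longleftrightarrow> ((a, b), (c, d)) \<in> frac_rel R"
  unfolding frac_class_def using eq_equiv_class_iff[OF frac_rel_equiv] assms by auto

lemma frac_class_eq_iff:
  assumes "a \<in> carrier R" "b \<in> Rnz" "c \<in> carrier R" "d \<in> Rnz"
  shows "cl a b = cl c d \<longleftrightarrow>
    (\<forall>u\<in>carrier R. \<forall>v\<in>carrier R. b \<otimes> u = d \<otimes> v \<longrightarrow> a \<otimes> u = c \<otimes> v)"
  unfolding frac_class_eq_iff_rel[OF assms] frac_rel_iff[OF assms] ..

lemma frac_class_mem_iff:
  assumes "a \<in> carrier R" "b \<in> Rnz"
  shows "(c, d) \<in> cl a b \<longleftrightarrow> c \<in> carrier R \<and> d \<in> Rnz \<and> cl c d = cl a b"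
proof
  assume "(c, d) \<in> cl a b"
  then have r: "((a, b), (c, d)) \<in> frac_rel R" unfolding frac_class_def by auto
  then show "c \<in> carrier R \<and> d \<in> Rnz \<and> cl c d = cl a b"
    using frac_rel_carrier[OF r] frac_class_eq_iff_rel assms by metis
next
  assume "c \<in> carrier R \<and> d \<in> Rnz \<and> cl c d = cl a b"
  then have "((a, b), (c, d)) \<in> frac_rel R" using frac_class_eq_iff_rel[of a b c d] assms by auto
  then show "(c, d) \<in> cl a b" unfolding frac_class_def by auto
qed

lemma frac_class_expand:
  assumes "a \<in> carrier R" "b \<in> Rnz" "s \<in> Rnz"
  shows "cl (a \<otimes> s) (b \<otimes> s) = cl a b"
proof -
  have "a \<otimes> s \<otimes> \<one> = a \<otimes> s" "b \<otimes> s \<otimes> \<one> = b \<otimes> s" "b \<otimes> s \<otimes> \<one> \<in> Rnz"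
    using assms Rnz_mult by (auto simp: Rnz_mult)
  then have "((a \<otimes> s, b \<otimes> s), (a, b)) \<in> frac_rel R"
    unfolding frac_rel_def using assms Rnz_mult[of b s]
    by (simp, intro conjI bexI[of _ \<one>] bexI[of _ s]) auto
  then show ?thesis using frac_class_eq_iff_rel assms Rnz_mult[of b s] by auto
qed

lemma frac_mult_class:
  assumes C: "a \<in> carrier R" "b \<in> Rnz" "c \<in> carrier R" "d \<in> Rnz"
    and u: "u \<in> Rnz" and v: "v \<in> carrier R" and eq: "c \<otimes> u = b \<otimes> v"
  shows "frac_mult R (cl a b) (cl c d) = cl (a \<otimes> v) (d \<otimes> u)"
proof -
  have eqs: "cl (a' \<otimes> v') (d' \<otimes> u') = cl (a \<otimes> v) (d \<otimes> u)"
    if m: "(a', b') \<in> cl a b" "(c', d') \<in> cl c d" and u': "u' \<in> Rnz" and v': "v' \<in> carrier R"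
      and eq': "c' \<otimes> u' = b' \<otimes> v'" for a' b' c' d' u' v'
  proof -
    have C': "a' \<in> carrier R" "b' \<in> Rnz" "cl a' b' = cl a b"
      "c' \<in> carrier R" "d' \<in> Rnz" "cl c' d' = cl c d"
      using m C frac_class_mem_iff by auto
    then have ab: "\<And>s t. \<lbrakk> s \<in> carrier R; t \<in> carrier R; b' \<otimes> s = b \<otimes> t \<rbrakk> \<Longrightarrow> a' \<otimes> s = a \<otimes> t"
      and cd: "\<And>s t. \<lbrakk> s \<in> carrier R; t \<in> carrier R; d' \<otimes> s = d \<otimes> t \<rbrakk> \<Longrightarrow> c' \<otimes> s = c \<otimes> t"
      using frac_class_eq_iff[OF C'(1,2) C(1,2)] frac_class_eq_iff[OF C'(4,5) C(3,4)] by simp_all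
    show ?thesis
    proof (subst frac_class_eq_iff)
      show "d' \<otimes> u' \<in> Rnz" "d \<otimes> u \<in> Rnz" using C C' u u' Rnz_mult by blast+
      show "\<forall>s\<in>carrier R. \<forall>t\<in>carrier R. d' \<otimes> u' \<otimes> s = d \<otimes> u \<otimes> t \<longrightarrow> a' \<otimes> v' \<otimes> s = a \<otimes> v \<otimes> t"
      proof (intro ballI impI)
        fix s t assume s: "s \<in> carrier R" and t: "t \<in> carrier R"
          and "d' \<otimes> u' \<otimes> s = d \<otimes> u \<otimes> t"
        then have "c' \<otimes> (u' \<otimes> s) = c \<otimes> (u \<otimes> t)"
          using C C' u u' s t by (intro cd) (auto simp: m_assoc)
        then have "c' \<otimes> u' \<otimes> s = c \<otimes> u \<otimes> t" using C C' u u' s t by (simp add: m_assoc)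
        then have "b' \<otimes> (v' \<otimes> s) = b \<otimes> (v \<otimes> t)"
          unfolding eq eq' using C C' v v' s t by (simp add: m_assoc)
        then have "a' \<otimes> (v' \<otimes> s) = a \<otimes> (v \<otimes> t)" using v v' s t by (intro ab) auto
        then show "a' \<otimes> v' \<otimes> s = a \<otimes> v \<otimes> t" using C C' v v' s t by (simp add: m_assoc)
      qed
    qed (use C C' v v' in auto)
  qed
  show ?thesis unfolding frac_mult_def
  proof (intro Union_subsetI subset_antisym)
    show "\<Union>{cl (a' \<otimes> v') (d' \<otimes> u') |a' b' c' d' u' v'.
        (a', b') \<in> cl a b \<and> (c', d') \<in> cl c d \<and> u' \<in> Rnz \<and> v' \<in> carrier R \<and>
        c' \<otimes> u' = b' \<otimes> v'} \<subseteq> cl (a \<otimes> v) (d \<otimes> u)"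
      using eqs by blast
    have "(a, b) \<in> cl a b" "(c, d) \<in> cl c d" using frac_class_mem_iff C by auto
    then show "cl (a \<otimes> v) (d \<otimes> u) \<subseteq> \<Union>{cl (a' \<otimes> v') (d' \<otimes> u') |a' b' c' d' u' v'.
        (a', b') \<in> cl a b \<and> (c', d') \<in> cl c d \<and> u' \<in> Rnz \<and> v' \<in> carrier R \<and>
        c' \<otimes> u' = b' \<otimes> v'}"
      using u v eq by blast
  qed
qed

lemma frac_add_class:
  assumes C: "a \<in> carrier R" "b \<in> Rnz" "c \<in> carrier R" "d \<in> Rnz"
    and u: "u \<in> carrier R" and v: "v \<in> carrier R" and eq: "b \<otimes> u = d \<otimes> v" and nz: "b \<otimes> u \<noteq> \<zero>"
  shows "frac_add R (cl a b) (cl c d) = cl (a \<otimes> u \<oplus> c \<otimes> v) (b \<otimes> u)"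
proof -
  have eqs: "cl (a' \<otimes> u' \<oplus> c' \<otimes> v') (b' \<otimes> u') = cl (a \<otimes> u \<oplus> c \<otimes> v) (b \<otimes> u)"
    if m: "(a', b') \<in> cl a b" "(c', d') \<in> cl c d" and u': "u' \<in> carrier R" and v': "v' \<in> carrier R"
      and eq': "b' \<otimes> u' = d' \<otimes> v'" and nz': "b' \<otimes> u' \<noteq> \<zero>" for a' b' c' d' u' v'
  proof -
    have C': "a' \<in> carrier R" "b' \<in> Rnz" "cl a' b' = cl a b"
      "c' \<in> carrier R" "d' \<in> Rnz" "cl c' d' = cl c d"
      using m C frac_class_mem_iff by auto
    then have ab: "\<And>s t. \<lbrakk> s \<in> carrier R; t \<in> carrier R; b' \<otimes> s = b \<otimes> t \<rbrakk> \<Longrightarrow> a' \<otimes> s = a \<otimes> t"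
      and cd: "\<And>s t. \<lbrakk> s \<in> carrier R; t \<in> carrier R; d' \<otimes> s = d \<otimes> t \<rbrakk> \<Longrightarrow> c' \<otimes> s = c \<otimes> t"
      using frac_class_eq_iff[OF C'(1,2) C(1,2)] frac_class_eq_iff[OF C'(4,5) C(3,4)] by simp_all
    show ?thesis
    proof (subst frac_class_eq_iff)
      show "b' \<otimes> u' \<in> Rnz" "b \<otimes> u \<in> Rnz" using C C' u u' nz nz' by auto
      show "\<forall>s\<in>carrier R. \<forall>t\<in>carrier R. b' \<otimes> u' \<otimes> s = b \<otimes> u \<otimes> t \<longrightarrow>
          (a' \<otimes> u' \<oplus> c' \<otimes> v') \<otimes> s = (a \<otimes> u \<oplus> c \<otimes> v) \<otimes> t"
      proof (intro ballI impI)
        fix s t assume s: "s \<in> carrier R" and t: "t \<in> carrier R"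
          and e: "b' \<otimes> u' \<otimes> s = b \<otimes> u \<otimes> t"
        then have 1: "a' \<otimes> (u' \<otimes> s) = a \<otimes> (u \<otimes> t)"
          using C C' u u' s t by (intro ab) (auto simp: m_assoc)
        have "c' \<otimes> (v' \<otimes> s) = c \<otimes> (v \<otimes> t)"
          using e C C' v v' s t unfolding eq eq' by (intro cd) (auto simp: m_assoc)
        then show "(a' \<otimes> u' \<oplus> c' \<otimes> v') \<otimes> s = (a \<otimes> u \<oplus> c \<otimes> v) \<otimes> t"
          using 1 C C' u u' v v' s t by (simp add: l_distr m_assoc)
      qed
    qed (use C C' u u' v v' in auto)
  qed
  show ?thesis unfolding frac_add_def
  proof (intro subset_antisym)
    show "\<Union>{cl (a' \<otimes> u' \<oplus> c' \<otimes> v') (b' \<otimes> u') |a' b' c' d' u' v'.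
        (a', b') \<in> cl a b \<and> (c', d') \<in> cl c d \<and> u' \<in> carrier R \<and> v' \<in> carrier R \<and>
        b' \<otimes> u' = d' \<otimes> v' \<and> b' \<otimes> u' \<noteq> \<zero>} \<subseteq> cl (a \<otimes> u \<oplus> c \<otimes> v) (b \<otimes> u)"
      using eqs by blast
    have "(a, b) \<in> cl a b" "(c, d) \<in> cl c d" using frac_class_mem_iff C by auto
    then show "cl (a \<otimes> u \<oplus> c \<otimes> v) (b \<otimes> u) \<subseteq> \<Union>{cl (a' \<otimes> u' \<oplus> c' \<otimes> v') (b' \<otimes> u') |a' b' c' d' u' v'.
        (a', b') \<in> cl a b \<and> (c', d') \<in> cl c d \<and> u' \<in> carrier R \<and> v' \<in> carrier R \<and>
        b' \<otimes> u' = d' \<otimes> v' \<and> b' \<otimes> u' \<noteq> \<zero>}"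
      using u v eq nz by blast
  qed
qed

lemma frac_add_same:
  assumes "a \<in> carrier R" "b \<in> carrier R" "s \<in> Rnz"
  shows "frac_add R (cl a s) (cl b s) = cl (a \<oplus> b) s"
  using frac_add_class[of a s b s \<one> \<one>] assms by auto

definition fracs where "fracs = {cl a b | a b. a \<in> carrier R \<and> b \<in> Rnz}"

lemma fracsI: "a \<in> carrier R \<Longrightarrow> b \<in> Rnz \<Longrightarrow> cl a b \<in> fracs"
  unfolding fracs_def by auto

lemma fracsE:
  assumes "U \<in> fracs"
  obtains a b where "U = cl a b" "a \<in> carrier R" "b \<in> Rnz"
  using assms unfolding fracs_def by auto

lemma quotient_eq_fracs: "(carrier R \<times> Rnz) // frac_rel R = fracs"
  unfolding fracs_def quotient_def frac_class_def by auto

text \<open>Over a common denominator addition takes place in the numerators; this reduces the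
  additive laws to those of \<open>R\<close>.\<close>

lemma common_denominator:
  assumes "U \<in> fracs" "V \<in> fracs"
  obtains a b s where "U = cl a s" "V = cl b s" "a \<in> carrier R" "b \<in> carrier R" "s \<in> Rnz"
proof -
  obtain a b where U: "U = cl a b" "a \<in> carrier R" "b \<in> Rnz" using assms(1) by (rule fracsE)
  obtain c d where V: "V = cl c d" "c \<in> carrier R" "d \<in> Rnz" using assms(2) by (rule fracsE)
  obtain u v where u: "u \<in> Rnz" and v: "v \<in> carrier R" and uv: "b \<otimes> u = d \<otimes> v"
    using ore[of b d] U V by blast
  have s: "b \<otimes> u \<in> Rnz" using Rnz_mult u U by blast
  then have "v \<in> Rnz" using uv v V by auto
  then have "U = cl (a \<otimes> u) (b \<otimes> u)" "V = cl (c \<otimes> v) (b \<otimes> u)"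
    unfolding U(1) V(1) using frac_class_expand[OF U(2,3) u] frac_class_expand[OF V(2,3), of v] uv
    by simp_all
  then show thesis using that s U V u v by auto
qed

lemma common_denominator3:
  assumes "U \<in> fracs" "V \<in> fracs" "W \<in> fracs"
  obtains a b c s where "U = cl a s" "V = cl b s" "W = cl c s"
    "a \<in> carrier R" "b \<in> carrier R" "c \<in> carrier R" "s \<in> Rnz"
proof -
  obtain a b s where UV: "U = cl a s" "V = cl b s" "a \<in> carrier R" "b \<in> carrier R" "s \<in> Rnz"
    using common_denominator assms(1,2) by blast
  obtain c d where W: "W = cl c d" "c \<in> carrier R" "d \<in> Rnz" using assms(3) by (rule fracsE)
  obtain u v where u: "u \<in> Rnz" and v: "v \<in> carrier R" and uv: "s \<otimes> u = d \<otimes> v"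
    using ore[of s d] UV W by blast
  have s: "s \<otimes> u \<in> Rnz" using Rnz_mult u UV by blast
  then have "v \<in> Rnz" using uv v W by auto
  then have "U = cl (a \<otimes> u) (s \<otimes> u)" "V = cl (b \<otimes> u) (s \<otimes> u)" "W = cl (c \<otimes> v) (s \<otimes> u)"
    unfolding UV(1,2) W(1)
    using frac_class_expand[OF UV(3,5) u] frac_class_expand[OF UV(4,5) u] frac_class_expand[OF W(2,3), of v] uv
    by simp_all
  then show thesis using that s UV W u v by auto
qed

lemma frac_class_eq_zero_iff:
  assumes "a \<in> carrier R" "b \<in> Rnz"
  shows "cl a b = cl \<zero> \<one> \<longleftrightarrow> a = \<zero>"
proof
  assume "cl a b = cl \<zero> \<one>"
  then have "b \<otimes> \<one> = \<one> \<otimes> b \<longrightarrow> a \<otimes> \<one> = \<zero> \<otimes> b"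
    using frac_class_eq_iff[OF assms zero_closed one_nonzero] assms by blast
  then show "a = \<zero>" using assms by simp
qed (use frac_class_eq_iff[OF assms zero_closed one_nonzero] assms in auto)

lemma frac_add_group:
  assumes "U \<in> fracs" "V \<in> fracs" "W \<in> fracs"
  shows "frac_add R U V \<in> fracs" "frac_add R U V = frac_add R V U"
    "frac_add R (frac_add R U V) W = frac_add R U (frac_add R V W)"
    "frac_add R (cl \<zero> \<one>) U = U" "\<exists>U'\<in>fracs. frac_add R U' U = cl \<zero> \<one>"
proof -
  obtain a b c s where U: "U = cl a s" and V: "V = cl b s" and W: "W = cl c s" and
    C: "a \<in> carrier R" "b \<in> carrier R" "c \<in> carrier R" "s \<in> Rnz"
    using common_denominator3[OF assms] by metis
  show "frac_add R U V \<in> fracs" "frac_add R U V = frac_add R V U"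
    "frac_add R (frac_add R U V) W = frac_add R U (frac_add R V W)"
    unfolding U V W using C by (auto simp: frac_add_same a_ac intro: fracsI)
  have z: "cl \<zero> \<one> = cl \<zero> s" using frac_class_eq_zero_iff[OF zero_closed C(4)] by simp
  show "frac_add R (cl \<zero> \<one>) U = U" unfolding U z using C by (simp add: frac_add_same)
  show "\<exists>U'\<in>fracs. frac_add R U' U = cl \<zero> \<one>"
    by (rule bexI[of _ "cl (\<ominus> a) s"]) (use C z in \<open>auto simp: U frac_add_same l_neg intro!: fracsI\<close>)
qed

lemma frac_mult_monoid:
  assumes U: "U \<in> fracs" and V: "V \<in> fracs" and W: "W \<in> fracs"
  shows "frac_mult R U V \<in> fracs"
    "frac_mult R (frac_mult R U V) W = frac_mult R U (frac_mult R V W)"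
    "frac_mult R (cl \<one> \<one>) U = U" "frac_mult R U (cl \<one> \<one>) = U"
proof -
  obtain a b where U: "U = cl a b" "a \<in> carrier R" "b \<in> Rnz" using U by (rule fracsE)
  obtain c d where V: "V = cl c d" "c \<in> carrier R" "d \<in> Rnz" using V by (rule fracsE)
  obtain e f where W: "W = cl e f" "e \<in> carrier R" "f \<in> Rnz" using W by (rule fracsE)
  obtain u v where u: "u \<in> Rnz" and v: "v \<in> carrier R" and uv: "c \<otimes> u = b \<otimes> v"
    using ore[of c b] U V by blast
  have du: "d \<otimes> u \<in> Rnz" using Rnz_mult u V by blast
  have UV: "frac_mult R U V = cl (a \<otimes> v) (d \<otimes> u)"
    unfolding U(1) V(1) using U V u v uv by (intro frac_mult_class)
  then show "frac_mult R U V \<in> fracs" using U v du by (auto intro: fracsI)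
  \<comment> \<open>The multiplier \<open>t\<close> is taken against the denominator
    \<open>d u\<close> of the product of the first two factors; since \<open>e s = d (u t)\<close>,
    it serves for the other bracketing as well.\<close>
  obtain s t where s: "s \<in> Rnz" and t: "t \<in> carrier R" and st: "e \<otimes> s = d \<otimes> u \<otimes> t"
    using ore[of e "d \<otimes> u"] W du by blast
  have fs: "f \<otimes> s \<in> Rnz" using Rnz_mult W s by blast
  have C: "u \<in> carrier R" "d \<in> carrier R" "b \<in> carrier R" "s \<in> carrier R" "f \<in> carrier R"
    using u V U s W by auto
  have "frac_mult R (frac_mult R U V) W = cl (a \<otimes> v \<otimes> t) (f \<otimes> s)"
    unfolding UV W(1) using U v du W s t st by (intro frac_mult_class) auto
  moreover have "frac_mult R V W = cl (c \<otimes> (u \<otimes> t)) (f \<otimes> s)"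
    unfolding V(1) W(1) using V W s t st C by (intro frac_mult_class) (auto simp: m_assoc)
  moreover have "frac_mult R (cl a b) (cl (c \<otimes> (u \<otimes> t)) (f \<otimes> s)) = cl (a \<otimes> (v \<otimes> t)) ((f \<otimes> s) \<otimes> \<one>)"
  proof (rule frac_mult_class)
    have "c \<otimes> (u \<otimes> t) \<otimes> \<one> = (c \<otimes> u) \<otimes> t" using V C t by (simp add: m_assoc)
    then show "c \<otimes> (u \<otimes> t) \<otimes> \<one> = b \<otimes> (v \<otimes> t)" unfolding uv using U v t by (simp add: m_assoc)
  qed (use U V C t fs v one_nonzero in auto)
  ultimately show "frac_mult R (frac_mult R U V) W = frac_mult R U (frac_mult R V W)"
    unfolding U(1) using U(2) v t fs C by (simp add: m_assoc)
  show "frac_mult R (cl \<one> \<one>) U = U"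
    using frac_mult_class[of \<one> \<one> a b \<one> a] U one_nonzero by auto
  show "frac_mult R U (cl \<one> \<one>) = U"
    using frac_mult_class[of a b \<one> \<one> b \<one>] U one_nonzero by auto
qed

lemma frac_distr:
  assumes U: "U \<in> fracs" and V: "V \<in> fracs" and W: "W \<in> fracs"
  shows "frac_mult R (frac_add R U V) W = frac_add R (frac_mult R U W) (frac_mult R V W)"
    "frac_mult R W (frac_add R U V) = frac_add R (frac_mult R W U) (frac_mult R W V)"
proof -
  obtain a b s where UV: "U = cl a s" "V = cl b s" and
    C: "a \<in> carrier R" "b \<in> carrier R" "s \<in> Rnz"
    using common_denominator[OF U V] by metis
  obtain e f where W: "W = cl e f" "e \<in> carrier R" "f \<in> Rnz" using W by (rule fracsE)
  obtain u v where u: "u \<in> Rnz" and v: "v \<in> carrier R" and uv: "e \<otimes> u = s \<otimes> v"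
    using ore[of e s] C W by blast
  have fu: "f \<otimes> u \<in> Rnz" using Rnz_mult u W by blast
  have "frac_mult R (cl z s) W = cl (z \<otimes> v) (f \<otimes> u)" if "z \<in> carrier R" for z
    unfolding W(1) using that C W u v uv by (intro frac_mult_class)
  then show "frac_mult R (frac_add R U V) W = frac_add R (frac_mult R U W) (frac_mult R V W)"
    unfolding UV using C v fu by (simp add: frac_add_same l_distr)
  \<comment> \<open>Multiplication from the left asks for one multiplier that brings both numerators
    into the right ideal of \<open>f\<close>: \<open>u1\<close> does so for \<open>a\<close>, and
    \<open>u2\<close> then does so for \<open>b u1\<close> without disturbing
    \<open>a\<close>.\<close>
  obtain u1 v1 where u1: "u1 \<in> Rnz" and v1: "v1 \<in> carrier R" and uv1: "a \<otimes> u1 = f \<otimes> v1"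
    using ore[of a f] C W by blast
  obtain u2 v2 where u2: "u2 \<in> Rnz" and v2: "v2 \<in> carrier R" and uv2: "(b \<otimes> u1) \<otimes> u2 = f \<otimes> v2"
    using ore[of "b \<otimes> u1" f] C W u1 by auto
  let ?u = "u1 \<otimes> u2"
  have Cs: "u1 \<in> carrier R" "u2 \<in> carrier R" "s \<in> carrier R" "f \<in> carrier R" using u1 u2 C W by auto
  have un: "?u \<in> Rnz" using Rnz_mult u1 u2 by blast
  have su: "s \<otimes> ?u \<in> Rnz" using Rnz_mult un C by blast
  have a: "a \<otimes> ?u = f \<otimes> (v1 \<otimes> u2)" using uv1 C W Cs v1 by (simp flip: m_assoc)
  have b: "b \<otimes> ?u = f \<otimes> v2" using uv2 C Cs by (simp add: m_assoc)
  have "frac_mult R W (cl z s) = cl (e \<otimes> t) (s \<otimes> ?u)"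
    if "z \<in> carrier R" "t \<in> carrier R" "z \<otimes> ?u = f \<otimes> t" for z t
    unfolding W(1) using that C W un by (intro frac_mult_class) auto
  note m = this
  have ab: "(a \<oplus> b) \<otimes> ?u = f \<otimes> (v1 \<otimes> u2 \<oplus> v2)"
    using a b C Cs v1 v2 by (simp add: l_distr r_distr)
  show "frac_mult R W (frac_add R U V) = frac_add R (frac_mult R W U) (frac_mult R W V)"
    unfolding UV frac_add_same[OF C]
    using m[OF _ _ a] m[OF _ _ b] m[OF _ _ ab] C Cs v1 v2 W su by (simp add: frac_add_same r_distr)
qed

end

locale ore_algebra = assoc_algebra K R for K and R (structure) +
  assumes ore: "right_Ore_domain R"

sublocale ore_algebra \<subseteq> O: ore_domain R
  using A.ring_axioms ore by (simp add: ore_domain_def ore_domain_axioms_def)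

context ore_algebra begin

abbreviation "F \<equiv> fract_algebra R"
abbreviation "cl \<equiv> frac_class R"

lemma fract_simps:
  "carrier F = O.fracs" "monoid.mult F = frac_mult R"
  "\<one>\<^bsub>F\<^esub> = cl \<one> \<one>" "\<zero>\<^bsub>F\<^esub> = cl \<zero> \<one>" "ring.add F = frac_add R"
  unfolding fract_algebra_def by (simp_all add: O.quotient_eq_fracs)

lemma fract_ring: "ring F"
proof (rule ringI)
  show "abelian_group F"
    using O.frac_add_group O.fracsI[OF M.zero_closed O.one_nonzero]
    by (intro abelian_groupI) (simp_all add: fract_simps)
  show "monoid F"
    using O.frac_mult_monoid O.fracsI[OF A.one_closed O.one_nonzero]
    by (intro monoidI) (simp_all add: fract_simps)
qed (use O.frac_distr in \<open>simp_all add: fract_simps\<close>)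

lemma fract_smult:
  assumes k: "k \<in> carrier K" and C: "a \<in> carrier R" "b \<in> O.Rnz"
  shows "k \<odot>\<^bsub>F\<^esub> cl a b = cl (k \<odot> a) b"
proof -
  have "cl (k \<odot> c) d = cl (k \<odot> a) b" if "(c, d) \<in> cl a b" for c d
  proof -
    have C': "c \<in> carrier R" "d \<in> O.Rnz" "cl c d = cl a b"
      using O.frac_class_mem_iff[OF C] that by auto
    then have "\<And>u v. \<lbrakk> u \<in> carrier R; v \<in> carrier R; d \<otimes> u = b \<otimes> v \<rbrakk> \<Longrightarrow> c \<otimes> u = a \<otimes> v"
      using O.frac_class_eq_iff[OF C'(1,2) C] by simp
    then show ?thesis
      using O.frac_class_eq_iff[of "k \<odot> c" d "k \<odot> a" b] C C' k
      by (simp flip: smult_assoc_left)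
  qed
  moreover have "(a, b) \<in> cl a b" using O.frac_class_mem_iff[OF C] C by auto
  ultimately have "(\<Union>(c, d)\<in>cl a b. cl (k \<odot> c) d) = cl (k \<odot> a) b" by blast
  then show ?thesis unfolding fract_algebra_def by simp
qed

lemma fract_mult_denominator:
  assumes "a \<in> carrier R" "b \<in> O.Rnz" "c \<in> O.Rnz"
  shows "frac_mult R (cl a b) (cl b c) = cl a c"
  using O.frac_mult_class[of a b b c "\<one>" "\<one>"] assms O.one_nonzero by auto

lemma fract_assoc_algebra: "assoc_algebra K F"
proof -
  interpret FR: ring F by (rule fract_ring)
  have smult_fracs: "k \<odot>\<^bsub>F\<^esub> U \<in> O.fracs" if k: "k \<in> carrier K" and U: "U \<in> O.fracs" for k U
  proof -
    obtain a b where "U = cl a b" "a \<in> carrier R" "b \<in> O.Rnz" using U by (rule O.fracsE)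
    then show ?thesis using k fract_smult[of k a b] O.fracsI[of "k \<odot> a" b] by simp
  qed
  have *: "module_axioms K F"
  proof
    fix k l U V assume k: "k \<in> carrier K" and U: "U \<in> carrier F"
    then show "k \<odot>\<^bsub>F\<^esub> U \<in> carrier F" by (simp add: fract_simps smult_fracs)
    {
      assume l: "l \<in> carrier K"
      from U obtain a b where U: "U = cl a b" "a \<in> carrier R" "b \<in> O.Rnz"
        unfolding fract_simps by (rule O.fracsE)
      show "(k \<oplus>\<^bsub>K\<^esub> l) \<odot>\<^bsub>F\<^esub> U = k \<odot>\<^bsub>F\<^esub> U \<oplus>\<^bsub>F\<^esub> l \<odot>\<^bsub>F\<^esub> U"
        "(k \<otimes>\<^bsub>K\<^esub> l) \<odot>\<^bsub>F\<^esub> U = k \<odot>\<^bsub>F\<^esub> (l \<odot>\<^bsub>F\<^esub> U)"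
        unfolding U(1) using k l U
        by (simp_all add: fract_smult O.frac_add_same fract_simps M.smult_l_distr M.smult_assoc1)
    }
    assume V: "V \<in> carrier F"
    obtain a b s where "U = cl a s" "V = cl b s" "a \<in> carrier R" "b \<in> carrier R" "s \<in> O.Rnz"
      using O.common_denominator U V unfolding fract_simps by metis
    then show "k \<odot>\<^bsub>F\<^esub> (U \<oplus>\<^bsub>F\<^esub> V) = k \<odot>\<^bsub>F\<^esub> U \<oplus>\<^bsub>F\<^esub> k \<odot>\<^bsub>F\<^esub> V"
      using k by (simp add: fract_smult O.frac_add_same fract_simps M.smult_r_distr)
  next
    fix U assume "U \<in> carrier F"
    then obtain a b where "U = cl a b" "a \<in> carrier R" "b \<in> O.Rnz"
      unfolding fract_simps by (rule O.fracsE)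
    then show "\<one>\<^bsub>K\<^esub> \<odot>\<^bsub>F\<^esub> U = U" by (simp add: fract_smult)
  qed
  have "k \<odot>\<^bsub>F\<^esub> (U \<otimes>\<^bsub>F\<^esub> V) = (k \<odot>\<^bsub>F\<^esub> U) \<otimes>\<^bsub>F\<^esub> V \<and> k \<odot>\<^bsub>F\<^esub> (U \<otimes>\<^bsub>F\<^esub> V) = U \<otimes>\<^bsub>F\<^esub> (k \<odot>\<^bsub>F\<^esub> V)"
    if k: "k \<in> carrier K" and U: "U \<in> carrier F" and V: "V \<in> carrier F" for k U V
  proof -
    obtain a b where U: "U = cl a b" "a \<in> carrier R" "b \<in> O.Rnz"
      using U unfolding fract_simps by (rule O.fracsE)
    obtain c d where V: "V = cl c d" "c \<in> carrier R" "d \<in> O.Rnz"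
      using V unfolding fract_simps by (rule O.fracsE)
    obtain u v where u: "u \<in> O.Rnz" and v: "v \<in> carrier R" and uv: "c \<otimes> u = b \<otimes> v"
      using O.ore[of c b] U V by blast
    have uv': "(k \<odot> c) \<otimes> u = b \<otimes> (k \<odot> v)"
      using uv k U V u v by (simp flip: smult_assoc_left smult_assoc_right)
    have "d \<otimes> u \<in> O.Rnz" using O.Rnz_mult V u by blast
    then have "k \<odot>\<^bsub>F\<^esub> (U \<otimes>\<^bsub>F\<^esub> V) = cl (k \<odot> (a \<otimes> v)) (d \<otimes> u)"
      unfolding U(1) V(1) fract_simps O.frac_mult_class[OF U(2,3) V(2,3) u v uv]
      using k U v by (intro fract_smult) auto
    moreover have "(k \<odot>\<^bsub>F\<^esub> U) \<otimes>\<^bsub>F\<^esub> V = cl ((k \<odot> a) \<otimes> v) (d \<otimes> u)"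
      unfolding U(1) V(1) fract_simps fract_smult[OF k U(2,3)]
      using O.frac_mult_class[OF _ U(3) V(2,3) u v uv] k U by simp
    moreover have "U \<otimes>\<^bsub>F\<^esub> (k \<odot>\<^bsub>F\<^esub> V) = cl (a \<otimes> (k \<odot> v)) (d \<otimes> u)"
      unfolding U(1) V(1) fract_simps fract_smult[OF k V(2,3)]
      using O.frac_mult_class[OF U(2,3) _ V(3) u _ uv'] k V v by simp
    ultimately show ?thesis
      using k U v by (simp flip: smult_assoc_left smult_assoc_right)
  qed
  then have "assoc_algebra_axioms K F"
    by (intro assoc_algebra_axioms.intro) metis+
  then show ?thesis
    using * FR.ring_axioms K.field_axioms K.cring_axioms FR.abelian_group_axioms
    by (simp add: assoc_algebra_def module_def)
qed

lemma fract_one_not_zero: "\<one>\<^bsub>F\<^esub> \<noteq> \<zero>\<^bsub>F\<^esub>"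
  using O.frac_class_eq_zero_iff[of "\<one>" "\<one>"] O.one_nonzero by (auto simp: fract_simps)

lemma fract_Units: "Units F = carrier F - {\<zero>\<^bsub>F\<^esub>}"
proof -
  interpret FR: ring F by (rule fract_ring)
  have "U \<in> Units F" if "U \<in> carrier F - {\<zero>\<^bsub>F\<^esub>}" for U
  proof -
    have "U \<in> O.fracs" using that unfolding fract_simps by simp
    then obtain a b where U: "U = cl a b" "a \<in> carrier R" "b \<in> O.Rnz" by (rule O.fracsE)
    then have a: "a \<in> O.Rnz" using that O.frac_class_eq_zero_iff unfolding fract_simps by auto
    have "cl a a = \<one>\<^bsub>F\<^esub>" "cl b b = \<one>\<^bsub>F\<^esub>"
      using O.frac_class_expand[OF A.one_closed O.one_nonzero, of a]
        O.frac_class_expand[OF A.one_closed O.one_nonzero, of b] a U by (auto simp: fract_simps)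
    then have "U \<otimes>\<^bsub>F\<^esub> cl b a = \<one>\<^bsub>F\<^esub>" "cl b a \<otimes>\<^bsub>F\<^esub> U = \<one>\<^bsub>F\<^esub>"
      using fract_mult_denominator[of a b a] fract_mult_denominator[of b a b] a U
      by (auto simp: fract_simps)
    moreover have "cl b a \<in> carrier F" using a U by (auto simp: fract_simps intro: O.fracsI)
    ultimately show ?thesis using that unfolding Units_def by blast
  qed
  moreover have "\<zero>\<^bsub>F\<^esub> \<notin> Units F"
    using fract_one_not_zero unfolding Units_def by auto
  ultimately show ?thesis using FR.Units_closed by auto
qed

lemma fract_embedding:
  "(\<lambda>a. cl a \<one>) \<in> ring_hom R F"
  "\<And>k a. \<lbrakk> k \<in> carrier K; a \<in> carrier R \<rbrakk> \<Longrightarrow> cl (k \<odot> a) \<one> = k \<odot>\<^bsub>F\<^esub> cl a \<one>"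
  "\<And>a. a \<in> carrier R \<Longrightarrow> cl a \<one> = \<zero>\<^bsub>F\<^esub> \<longleftrightarrow> a = \<zero>"
  "\<And>a b. \<lbrakk> a \<in> carrier R; b \<in> O.Rnz \<rbrakk> \<Longrightarrow> cl a b \<otimes>\<^bsub>F\<^esub> cl b \<one> = cl a \<one>"
proof -
  have "cl (a \<otimes> b) \<one> = frac_mult R (cl a \<one>) (cl b \<one>)"
    if "a \<in> carrier R" "b \<in> carrier R" for a b
    using O.frac_mult_class[of a "\<one>" b "\<one>" "\<one>" b] that O.one_nonzero by auto
  then show "(\<lambda>a. cl a \<one>) \<in> ring_hom R F"
    using O.one_nonzero
    by (intro ring_hom_memI) (auto simp: fract_simps O.frac_add_same intro: O.fracsI)
qed (use O.one_nonzero in \<open>simp_all add: fract_smult O.frac_class_eq_zero_iff fract_simps fract_mult_denominator\<close>)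

end

section \<open>Quotient algebras and induced homomorphisms\<close>

lemma ring_cong:
  assumes "ring R" and "carrier S = carrier R" "monoid.mult S = monoid.mult R"
    "\<one>\<^bsub>S\<^esub> = \<one>\<^bsub>R\<^esub>" "\<zero>\<^bsub>S\<^esub> = \<zero>\<^bsub>R\<^esub>" "ring.add S = ring.add R"
  shows "ring S"
proof -
  interpret R: ring R by fact
  show ?thesis
  proof (rule ringI)
    show "abelian_group S"
      by (rule abelian_groupI) (use assms R.a_assoc R.a_comm in \<open>auto intro: R.add.l_inv_ex\<close>)
    show "monoid S"
      by (rule monoidI) (use assms R.m_assoc in auto)
  qed (use assms R.l_distr R.r_distr in auto)
qed

lemma quot_algebra_simps:
  "carrier (quot_algebra A I) = carrier (A Quot I)"
  "monoid.mult (quot_algebra A I) = monoid.mult (A Quot I)"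
  "\<one>\<^bsub>quot_algebra A I\<^esub> = \<one>\<^bsub>A Quot I\<^esub>" "\<zero>\<^bsub>quot_algebra A I\<^esub> = \<zero>\<^bsub>A Quot I\<^esub>"
  "ring.add (quot_algebra A I) = ring.add (A Quot I)"
  by (simp_all add: quot_algebra_def ring.extend_def module.fields_def)

text \<open>Complete primeness refers to the plain quotient ring, whereas fractions are formed over
  the quotient with scalars.\<close>

lemma nc_domain_quot_algebra:
  assumes "ideal I A" shows "nc_domain (quot_algebra A I) \<longleftrightarrow> nc_domain (A Quot I)"
proof -
  have "ring (A Quot I)" using assms by (rule ideal.quotient_is_ring)
  moreover from this have "ring (quot_algebra A I)" by (rule ring_cong) (rule quot_algebra_simps)+
  ultimately show ?thesis unfolding nc_domain_def quot_algebra_simps by simp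
qed

lemma carrier_Quot: "carrier (A Quot I) = (\<lambda>a. I +>\<^bsub>A\<^esub> a) ` carrier A"
  unfolding FactRing_def A_RCOSETS_def' by auto

context assoc_algebra begin

lemma smult_uminus: "\<lbrakk> c \<in> carrier K; a \<in> carrier A \<rbrakk> \<Longrightarrow> c \<odot>\<^bsub>A\<^esub> (\<ominus>\<^bsub>A\<^esub> a) = \<ominus>\<^bsub>A\<^esub> (c \<odot>\<^bsub>A\<^esub> a)"
  by (metis M.add.inv_closed M.add.inv_equality M.r_neg M.l_neg M.smult_closed M.smult_r_distr M.smult_r_null)

lemma smult_minus:
  "\<lbrakk> c \<in> carrier K; a \<in> carrier A; b \<in> carrier A \<rbrakk>
    \<Longrightarrow> c \<odot>\<^bsub>A\<^esub> (a \<ominus>\<^bsub>A\<^esub> b) = c \<odot>\<^bsub>A\<^esub> a \<ominus>\<^bsub>A\<^esub> c \<odot>\<^bsub>A\<^esub> b"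
  by (simp add: a_minus_def M.smult_r_distr smult_uminus)

text \<open>Because \<open>c a = (c 1) a\<close>, a ring ideal is automatically a subspace.\<close>

lemma ideal_smult_closed:
  assumes "ideal I A" "c \<in> carrier K" "a \<in> I" shows "c \<odot>\<^bsub>A\<^esub> a \<in> I"
proof -
  interpret I: ideal I A by fact
  have "(c \<odot>\<^bsub>A\<^esub> \<one>\<^bsub>A\<^esub>) \<otimes>\<^bsub>A\<^esub> a \<in> I" using assms by (intro I.I_l_closed) auto
  then show ?thesis using assms I.a_Hcarr by (simp flip: smult_assoc_left)
qed

lemma quot_smult:
  assumes I: "ideal I A" and c: "c \<in> carrier K" and a: "a \<in> carrier A"
  shows "c \<odot>\<^bsub>quot_algebra A I\<^esub> (I +>\<^bsub>A\<^esub> a) = I +>\<^bsub>A\<^esub> (c \<odot>\<^bsub>A\<^esub> a)"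
proof -
  interpret I: ideal I A by fact
  have "I +>\<^bsub>A\<^esub> (c \<odot>\<^bsub>A\<^esub> b) = I +>\<^bsub>A\<^esub> (c \<odot>\<^bsub>A\<^esub> a)" if b: "b \<in> I +>\<^bsub>A\<^esub> a" for b
  proof -
    have bc: "b \<in> carrier A" using b a I.a_elemrcos_carrier by blast
    have "b \<ominus>\<^bsub>A\<^esub> a \<in> I" using I.a_rcos_module_minus[OF A.ring_axioms a bc] b by simp
    then have "c \<odot>\<^bsub>A\<^esub> b \<ominus>\<^bsub>A\<^esub> c \<odot>\<^bsub>A\<^esub> a \<in> I"
      using ideal_smult_closed[OF I c] smult_minus[OF c bc a] by metis
    then have "c \<odot>\<^bsub>A\<^esub> b \<in> I +>\<^bsub>A\<^esub> (c \<odot>\<^bsub>A\<^esub> a)"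
      using I.a_rcos_module_minus[OF A.ring_axioms, of "c \<odot>\<^bsub>A\<^esub> a" "c \<odot>\<^bsub>A\<^esub> b"] c a bc by simp
    then show ?thesis using I.a_repr_independence'[of "c \<odot>\<^bsub>A\<^esub> b" "c \<odot>\<^bsub>A\<^esub> a"] c a by simp
  qed
  moreover have "a \<in> I +>\<^bsub>A\<^esub> a" using I.a_rcos_self a by simp
  ultimately have "(\<Union>b\<in>I +>\<^bsub>A\<^esub> a. I +>\<^bsub>A\<^esub> (c \<odot>\<^bsub>A\<^esub> b)) = I +>\<^bsub>A\<^esub> (c \<odot>\<^bsub>A\<^esub> a)" by blast
  then show ?thesis by (simp add: quot_algebra_def ring.extend_def module.fields_def)
qed

lemma quot_hom:
  assumes I: "ideal I A"
  shows "(\<lambda>a. I +>\<^bsub>A\<^esub> a) \<in> ring_hom A (quot_algebra A I)"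
  using ideal.rcos_ring_hom[OF I] unfolding ring_hom_def quot_algebra_simps by simp

lemma quot_assoc_algebra:
  assumes I: "ideal I A" shows "assoc_algebra K (quot_algebra A I)"
proof -
  interpret I: ideal I A by fact
  let ?Q = "quot_algebra A I"
  interpret Q: ring ?Q
    using I.quotient_is_ring by (rule ring_cong) (rule quot_algebra_simps)+
  note hom = quot_hom[OF I]
  have C: "carrier ?Q = (\<lambda>a. I +>\<^bsub>A\<^esub> a) ` carrier A"
    unfolding quot_algebra_simps carrier_Quot ..
  have add: "\<And>a b. \<lbrakk> a \<in> carrier A; b \<in> carrier A \<rbrakk> \<Longrightarrow>
      (I +>\<^bsub>A\<^esub> a) \<oplus>\<^bsub>?Q\<^esub> (I +>\<^bsub>A\<^esub> b) = I +>\<^bsub>A\<^esub> (a \<oplus>\<^bsub>A\<^esub> b)"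
    and mult: "\<And>a b. \<lbrakk> a \<in> carrier A; b \<in> carrier A \<rbrakk> \<Longrightarrow>
      (I +>\<^bsub>A\<^esub> a) \<otimes>\<^bsub>?Q\<^esub> (I +>\<^bsub>A\<^esub> b) = I +>\<^bsub>A\<^esub> (a \<otimes>\<^bsub>A\<^esub> b)"
    using ring_hom_add[OF hom] ring_hom_mult[OF hom] by simp_all
  have "module_axioms K ?Q"
    by standard
      (auto simp: C quot_smult[OF I] add M.smult_l_distr M.smult_r_distr M.smult_assoc1)
  moreover have "assoc_algebra_axioms K ?Q"
    by standard
      (auto simp: C quot_smult[OF I] mult smult_assoc_left[symmetric] smult_assoc_right[symmetric])
  ultimately show ?thesis
    using Q.ring_axioms K.field_axioms K.cring_axioms Q.abelian_group_axioms
    by (simp add: assoc_algebra_def module_def)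
qed

lemma quot_induced_hom:
  assumes D: "assoc_algebra K D" and I: "ideal I A"
    and \<phi>: "\<phi> \<in> ring_hom A D" and \<phi>_smult: "\<And>c a. \<lbrakk> c \<in> carrier K; a \<in> carrier A \<rbrakk> \<Longrightarrow> \<phi> (c \<odot>\<^bsub>A\<^esub> a) = c \<odot>\<^bsub>D\<^esub> \<phi> a"
    and ker: "\<And>a. a \<in> I \<Longrightarrow> \<phi> a = \<zero>\<^bsub>D\<^esub>"
  obtains \<psi> where "\<psi> \<in> ring_hom (quot_algebra A I) D" "\<And>a. a \<in> carrier A \<Longrightarrow> \<psi> (I +>\<^bsub>A\<^esub> a) = \<phi> a"
    "\<And>c U. \<lbrakk> c \<in> carrier K; U \<in> carrier (quot_algebra A I) \<rbrakk> \<Longrightarrow> \<psi> (c \<odot>\<^bsub>quot_algebra A I\<^esub> U) = c \<odot>\<^bsub>D\<^esub> \<psi> U"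
proof -
  interpret I: ideal I A by fact
  interpret D: assoc_algebra K D by fact
  let ?Q = "quot_algebra A I"
  \<comment> \<open>The value at a coset is taken at an arbitrary representative; as \<phi> vanishes
    on \<open>I\<close>, the choice does not matter.\<close>
  define \<psi> where "\<psi> U = \<phi> (SOME a. a \<in> U)" for U
  interpret \<phi>: ring_hom_ring A D \<phi>
    using A.ring_axioms D.A.ring_axioms \<phi> by (rule ring_hom_ringI2)
  have val: "\<psi> (I +>\<^bsub>A\<^esub> a) = \<phi> a" if a: "a \<in> carrier A" for a
  proof -
    have "a \<in> I +>\<^bsub>A\<^esub> a" using I.a_rcos_self a by simp
    then have b: "(SOME b. b \<in> I +>\<^bsub>A\<^esub> a) \<in> I +>\<^bsub>A\<^esub> a" (is "?b \<in> _") by (rule someI)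
    then have bc: "?b \<in> carrier A" using a I.a_elemrcos_carrier by blast
    have "?b \<ominus>\<^bsub>A\<^esub> a \<in> I" using I.a_rcos_module_minus[OF A.ring_axioms a bc] b by simp
    then have "\<phi> ?b \<ominus>\<^bsub>D\<^esub> \<phi> a = \<zero>\<^bsub>D\<^esub>" using ker[of "?b \<ominus>\<^bsub>A\<^esub> a"] bc a by (simp add: a_minus_def)
    then show ?thesis unfolding \<psi>_def using bc a by simp
  qed
  note hom = quot_hom[OF I]
  have C: "carrier ?Q = (\<lambda>a. I +>\<^bsub>A\<^esub> a) ` carrier A"
    unfolding quot_algebra_simps carrier_Quot ..
  have "\<psi> \<in> ring_hom ?Q D"
  proof (rule ring_hom_memI)
    fix U V assume "U \<in> carrier ?Q" "V \<in> carrier ?Q"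
    then obtain a b where ab: "U = I +>\<^bsub>A\<^esub> a" "a \<in> carrier A" "V = I +>\<^bsub>A\<^esub> b" "b \<in> carrier A"
      unfolding C by auto
    then show "\<psi> U \<in> carrier D" by (simp add: val)
    show "\<psi> (U \<otimes>\<^bsub>?Q\<^esub> V) = \<psi> U \<otimes>\<^bsub>D\<^esub> \<psi> V"
      unfolding ab(1,3) ring_hom_mult[OF hom ab(2,4), symmetric] using ab(2,4) by (simp add: val)
    show "\<psi> (U \<oplus>\<^bsub>?Q\<^esub> V) = \<psi> U \<oplus>\<^bsub>D\<^esub> \<psi> V"
      unfolding ab(1,3) ring_hom_add[OF hom ab(2,4), symmetric] using ab(2,4) by (simp add: val)
  next
    show "\<psi> \<one>\<^bsub>?Q\<^esub> = \<one>\<^bsub>D\<^esub>" using ring_hom_one[OF hom] val[of "\<one>\<^bsub>A\<^esub>"] by simp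
  qed
  moreover have "\<psi> (c \<odot>\<^bsub>?Q\<^esub> U) = c \<odot>\<^bsub>D\<^esub> \<psi> U" if "c \<in> carrier K" "U \<in> carrier ?Q" for c U
    using that unfolding C by (auto simp: quot_smult[OF I] val \<phi>_smult)
  ultimately show thesis using that val by blast
qed

end

section \<open>Recognising a division ring of fractions\<close>

locale fraction_embedding = R: assoc_algebra K R + D: assoc_algebra K D
  for K and R and D (structure) +
  fixes \<iota>
  assumes D_Units: "Units D = carrier D - {\<zero>}"
    and \<iota>_hom: "\<iota> \<in> ring_hom R D"
    and \<iota>_smult: "\<And>c a. \<lbrakk> c \<in> carrier K; a \<in> carrier R \<rbrakk> \<Longrightarrow> \<iota> (c \<odot>\<^bsub>R\<^esub> a) = c \<odot> \<iota> a"
    and \<iota>_inj: "\<And>a. \<lbrakk> a \<in> carrier R; \<iota> a = \<zero> \<rbrakk> \<Longrightarrow> a = \<zero>\<^bsub>R\<^esub>"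
    and fractions: "\<And>z. z \<in> carrier D \<Longrightarrow>
      \<exists>a\<in>carrier R. \<exists>b\<in>carrier R - {\<zero>\<^bsub>R\<^esub>}. z \<otimes> \<iota> b = \<iota> a"
begin

sublocale \<iota>: ring_hom_ring R D \<iota>
  using R.A.ring_axioms D.A.ring_axioms \<iota>_hom by (rule ring_hom_ringI2)

abbreviation "Rnz \<equiv> carrier R - {\<zero>\<^bsub>R\<^esub>}"

lemma \<iota>_inject: "\<lbrakk> a \<in> carrier R; b \<in> carrier R; \<iota> a = \<iota> b \<rbrakk> \<Longrightarrow> a = b"
proof -
  assume a: "a \<in> carrier R" "b \<in> carrier R" "\<iota> a = \<iota> b"
  then have "\<iota> (a \<ominus>\<^bsub>R\<^esub> b) = \<zero>" by (simp add: a_minus_def D.M.r_neg)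
  then show ?thesis using \<iota>_inj[of "a \<ominus>\<^bsub>R\<^esub> b"] a by simp
qed

lemma \<iota>_Units: "b \<in> Rnz \<Longrightarrow> \<iota> b \<in> Units D"
  unfolding D_Units using \<iota>_inj by auto

lemma D_mult_eq_zero:
  assumes "y \<in> carrier D" "z \<in> carrier D" "y \<otimes> z = \<zero>"
  shows "y = \<zero> \<or> z = \<zero>"
proof (rule disjCI)
  assume "z \<noteq> \<zero>"
  then have "z \<in> Units D" using assms D_Units by auto
  then have "y = y \<otimes> z \<otimes> inv z" using assms(1,2) by (simp add: D.A.m_assoc)
  then show "y = \<zero>" unfolding assms(3) using \<open>z \<in> Units D\<close> by simp
qed

text \<open>The Ore condition is forced by the fractions: writing \<open>b^-1 a\<close> as
  \<open>v u^-1\<close> gives \<open>a u = b v\<close>. Zero divisors are excluded by the embedding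
  into \<open>D\<close>.\<close>

lemma right_Ore: "right_Ore_domain R"
proof -
  have one: "\<one> \<noteq> \<zero>"
  proof -
    have "\<one> \<in> Units D" by simp
    then show ?thesis unfolding D_Units by simp
  qed
  have "nc_domain R"
    unfolding nc_domain_def
  proof (intro conjI ballI impI)
    show "ring R" by (rule R.A.ring_axioms)
    show "\<one>\<^bsub>R\<^esub> \<noteq> \<zero>\<^bsub>R\<^esub>" using one \<iota>.hom_one \<iota>.hom_zero by metis
    fix a b assume "a \<in> carrier R" "b \<in> carrier R" "a \<otimes>\<^bsub>R\<^esub> b = \<zero>\<^bsub>R\<^esub>"
    then show "a = \<zero>\<^bsub>R\<^esub> \<or> b = \<zero>\<^bsub>R\<^esub>"
      using D_mult_eq_zero[of "\<iota> a" "\<iota> b"] \<iota>_inj by (auto simp flip: \<iota>.hom_mult)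
  qed
  moreover have "\<exists>u\<in>Rnz. \<exists>v\<in>carrier R. a \<otimes>\<^bsub>R\<^esub> u = b \<otimes>\<^bsub>R\<^esub> v"
    if a: "a \<in> carrier R" and b: "b \<in> Rnz" for a b
  proof -
    have ib: "\<iota> b \<in> Units D" using b by (rule \<iota>_Units)
    obtain v u where v: "v \<in> carrier R" and u: "u \<in> Rnz"
      and eq: "inv \<iota> b \<otimes> \<iota> a \<otimes> \<iota> u = \<iota> v"
      using fractions[of "inv \<iota> b \<otimes> \<iota> a"] ib a by auto
    have "\<iota> (b \<otimes>\<^bsub>R\<^esub> v) = \<iota> b \<otimes> (inv \<iota> b \<otimes> (\<iota> a \<otimes> \<iota> u))"
      using a b u v ib by (simp add: D.A.m_assoc flip: eq)
    also have "\<dots> = \<iota> (a \<otimes>\<^bsub>R\<^esub> u)" using a b u ib by (simp flip: D.A.m_assoc)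
    finally have "b \<otimes>\<^bsub>R\<^esub> v = a \<otimes>\<^bsub>R\<^esub> u" using \<iota>_inject a b u v by simp
    then show ?thesis using u v by metis
  qed
  ultimately show ?thesis unfolding right_Ore_domain_def by blast
qed

sublocale ore_algebra K R
  using R.assoc_algebra_axioms right_Ore by (simp add: ore_algebra_def ore_algebra_axioms_def)

text \<open>As a set, the class of the fraction \<open>z\<close> consists of all its representatives.\<close>

definition to_frac where
  "to_frac z = {(a, b). a \<in> carrier R \<and> b \<in> Rnz \<and> z \<otimes> \<iota> b = \<iota> a}"

lemma to_frac_eq:
  assumes z: "z \<in> carrier D" and a: "a \<in> carrier R" and b: "b \<in> Rnz"
    and eq: "z \<otimes> \<iota> b = \<iota> a"
  shows "to_frac z = frac_class R a b"
proof -
  have "z \<otimes> \<iota> d = \<iota> c \<longleftrightarrow> frac_class R c d = frac_class R a b"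
    if c: "c \<in> carrier R" and d: "d \<in> Rnz" for c d
  proof -
    \<comment> \<open>The two fractions are compared over the common denominator
      \<open>d u = b v\<close>, where their equality becomes an equality of numerators in
      \<open>R\<close>.\<close>
    obtain u v where u: "u \<in> Rnz" and v: "v \<in> carrier R" and uv: "d \<otimes>\<^bsub>R\<^esub> u = b \<otimes>\<^bsub>R\<^esub> v"
      using O.ore[of d b] b d by blast
    have iu: "\<iota> u \<in> Units D" "\<iota> u \<in> carrier D" using u \<iota>_Units by auto
    have "z \<otimes> \<iota> d \<otimes> \<iota> u = z \<otimes> \<iota> (d \<otimes>\<^bsub>R\<^esub> u)" using z d u by (simp add: D.A.m_assoc)
    also have "\<dots> = z \<otimes> \<iota> b \<otimes> \<iota> v" unfolding uv using z b v by (simp add: D.A.m_assoc)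
    also have "\<dots> = \<iota> (a \<otimes>\<^bsub>R\<^esub> v)" unfolding eq using a v by simp
    finally have zd: "z \<otimes> \<iota> d \<otimes> \<iota> u = \<iota> (a \<otimes>\<^bsub>R\<^esub> v)" .
    have "z \<otimes> \<iota> d = \<iota> c \<longleftrightarrow> z \<otimes> \<iota> d \<otimes> \<iota> u = \<iota> c \<otimes> \<iota> u"
    proof
      assume "z \<otimes> \<iota> d \<otimes> \<iota> u = \<iota> c \<otimes> \<iota> u"
      then have "z \<otimes> \<iota> d \<otimes> \<iota> u \<otimes> inv \<iota> u = \<iota> c \<otimes> \<iota> u \<otimes> inv \<iota> u" by simp
      then show "z \<otimes> \<iota> d = \<iota> c" using iu z c d by (simp add: D.A.m_assoc)
    qed simp
    also have "\<dots> \<longleftrightarrow> \<iota> (a \<otimes>\<^bsub>R\<^esub> v) = \<iota> (c \<otimes>\<^bsub>R\<^esub> u)" unfolding zd using c u by simp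
    also have "\<dots> \<longleftrightarrow> a \<otimes>\<^bsub>R\<^esub> v = c \<otimes>\<^bsub>R\<^esub> u" using \<iota>_inject[of "a \<otimes>\<^bsub>R\<^esub> v" "c \<otimes>\<^bsub>R\<^esub> u"] a c u v by (auto simp del: \<iota>.hom_mult)
    also have "\<dots> \<longleftrightarrow> frac_class R c d = frac_class R a b"
    proof
      assume e: "a \<otimes>\<^bsub>R\<^esub> v = c \<otimes>\<^bsub>R\<^esub> u"
      have "d \<otimes>\<^bsub>R\<^esub> u \<in> Rnz" using O.Rnz_mult d u by blast
      then have "((c, d), (a, b)) \<in> frac_rel R"
        unfolding frac_rel_def using a b c d u v uv e[symmetric]
        by (simp, intro bexI[of _ u] bexI[of _ v]) auto
      then show "frac_class R c d = frac_class R a b"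
        using O.frac_class_eq_iff_rel a b c d by blast
    next
      assume "frac_class R c d = frac_class R a b"
      then show "a \<otimes>\<^bsub>R\<^esub> v = c \<otimes>\<^bsub>R\<^esub> u"
        using O.frac_class_eq_iff[OF c d a b] u v uv by auto
    qed
    finally show ?thesis .
  qed
  then show ?thesis unfolding to_frac_def using O.frac_class_mem_iff[OF a b] by auto
qed

lemma to_frac_iso: "to_frac \<in> alg_iso K D (fract_algebra R)"
proof -
  have rep: "\<exists>a b. a \<in> carrier R \<and> b \<in> Rnz \<and> z \<otimes> \<iota> b = \<iota> a \<and> to_frac z = frac_class R a b"
    if "z \<in> carrier D" for z
    using fractions[OF that] to_frac_eq[OF that] by blast
  have "to_frac \<in> ring_hom D F"
  proof (rule ring_hom_memI)
    fix y z assume y: "y \<in> carrier D" and z: "z \<in> carrier D"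
    obtain a b where ab: "a \<in> carrier R" "b \<in> Rnz" "y \<otimes> \<iota> b = \<iota> a" "to_frac y = frac_class R a b"
      using rep[OF y] by blast
    obtain c d where cd: "c \<in> carrier R" "d \<in> Rnz" "z \<otimes> \<iota> d = \<iota> c" "to_frac z = frac_class R c d"
      using rep[OF z] by blast
    show "to_frac y \<in> carrier F" unfolding ab(4) fract_simps using ab(1,2) by (rule O.fracsI)
    obtain u v where u: "u \<in> Rnz" and v: "v \<in> carrier R" and uv: "c \<otimes>\<^bsub>R\<^esub> u = b \<otimes>\<^bsub>R\<^esub> v"
      using O.ore[of c b] ab cd by blast
    have du: "d \<otimes>\<^bsub>R\<^esub> u \<in> Rnz" using O.Rnz_mult cd u by blast
    have C: "u \<in> carrier R" "d \<in> carrier R" "b \<in> carrier R" using u cd ab by auto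
    have "y \<otimes> z \<otimes> \<iota> (d \<otimes>\<^bsub>R\<^esub> u) = y \<otimes> (z \<otimes> \<iota> d \<otimes> \<iota> u)"
      using y z C by (simp add: D.A.m_assoc)
    also have "\<dots> = y \<otimes> \<iota> (b \<otimes>\<^bsub>R\<^esub> v)" unfolding cd(3) uv[symmetric] using cd(1) C by simp
    also have "\<dots> = y \<otimes> \<iota> b \<otimes> \<iota> v" using y C v by (simp add: D.A.m_assoc)
    also have "\<dots> = \<iota> (a \<otimes>\<^bsub>R\<^esub> v)" unfolding ab(3) using ab(1) v by simp
    finally have "to_frac (y \<otimes> z) = frac_class R (a \<otimes>\<^bsub>R\<^esub> v) (d \<otimes>\<^bsub>R\<^esub> u)"
      using to_frac_eq du y z ab v by simp
    then show "to_frac (y \<otimes> z) = to_frac y \<otimes>\<^bsub>F\<^esub> to_frac z"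
      unfolding ab(4) cd(4) fract_simps using O.frac_mult_class[OF ab(1,2) cd(1,2) u v uv] by simp
    obtain s t where s: "s \<in> Rnz" and t: "t \<in> carrier R" and st: "b \<otimes>\<^bsub>R\<^esub> s = d \<otimes>\<^bsub>R\<^esub> t"
      using O.ore[of b d] ab cd by blast
    have bs: "b \<otimes>\<^bsub>R\<^esub> s \<in> Rnz" using O.Rnz_mult ab s by blast
    have sc: "s \<in> carrier R" using s by simp
    have "y \<otimes> \<iota> (b \<otimes>\<^bsub>R\<^esub> s) = y \<otimes> \<iota> b \<otimes> \<iota> s" using y C sc by (simp add: D.A.m_assoc)
    moreover have "z \<otimes> \<iota> (b \<otimes>\<^bsub>R\<^esub> s) = z \<otimes> \<iota> d \<otimes> \<iota> t"
      unfolding st using z C t by (simp add: D.A.m_assoc)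
    moreover have "\<iota> (b \<otimes>\<^bsub>R\<^esub> s) \<in> carrier D" using C sc by simp
    ultimately have "(y \<oplus> z) \<otimes> \<iota> (b \<otimes>\<^bsub>R\<^esub> s) = \<iota> (a \<otimes>\<^bsub>R\<^esub> s \<oplus>\<^bsub>R\<^esub> c \<otimes>\<^bsub>R\<^esub> t)"
      unfolding ab(3) cd(3) using y z ab(1) cd(1) sc t D.A.l_distr[of y z "\<iota> (b \<otimes>\<^bsub>R\<^esub> s)"] by simp
    then have "to_frac (y \<oplus> z) = frac_class R (a \<otimes>\<^bsub>R\<^esub> s \<oplus>\<^bsub>R\<^esub> c \<otimes>\<^bsub>R\<^esub> t) (b \<otimes>\<^bsub>R\<^esub> s)"
      using to_frac_eq bs y z ab cd sc t by simp
    then show "to_frac (y \<oplus> z) = to_frac y \<oplus>\<^bsub>F\<^esub> to_frac z"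
      unfolding ab(4) cd(4) fract_simps
      using O.frac_add_class[OF ab(1,2) cd(1,2) sc t st] bs by simp
  next
    show "to_frac \<one> = \<one>\<^bsub>F\<^esub>"
      unfolding fract_simps by (rule to_frac_eq) (use O.one_nonzero in auto)
  qed
  moreover have "bij_betw to_frac (carrier D) (carrier F)"
  proof (rule bij_betw_imageI)
    show "inj_on to_frac (carrier D)"
    proof (rule inj_onI)
      fix y z assume y: "y \<in> carrier D" and z: "z \<in> carrier D" and e: "to_frac y = to_frac z"
      obtain a b where ab: "a \<in> carrier R" "b \<in> Rnz" "y \<otimes> \<iota> b = \<iota> a"
        using rep[OF y] by blast
      then have "(a, b) \<in> to_frac y" unfolding to_frac_def by simp
      then have "(a, b) \<in> to_frac z" unfolding e .
      then have "y \<otimes> \<iota> b = z \<otimes> \<iota> b" unfolding ab(3) to_frac_def by simp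
      then have "y \<otimes> \<iota> b \<otimes> inv \<iota> b = z \<otimes> \<iota> b \<otimes> inv \<iota> b" by simp
      then show "y = z" using \<iota>_Units[OF ab(2)] ab(2) y z by (simp add: D.A.m_assoc)
    qed
    show "to_frac ` carrier D = carrier F"
    proof
      show "to_frac ` carrier D \<subseteq> carrier F" using rep unfolding fract_simps
        by (metis (no_types, lifting) O.fracsI image_subsetI)
      show "carrier F \<subseteq> to_frac ` carrier D"
      proof
        fix U assume "U \<in> carrier F"
        then obtain a b where U: "U = frac_class R a b" "a \<in> carrier R" "b \<in> Rnz"
          unfolding fract_simps by (rule O.fracsE)
        have ib: "\<iota> b \<in> Units D" using U by (intro \<iota>_Units)
        then have "to_frac (\<iota> a \<otimes> inv \<iota> b) = U"
          unfolding U(1) using U(2,3) by (intro to_frac_eq) (auto simp: D.A.m_assoc)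
        moreover have "\<iota> a \<otimes> inv \<iota> b \<in> carrier D" using U ib by simp
        ultimately show "U \<in> to_frac ` carrier D" by blast
      qed
    qed
  qed
  moreover have "to_frac (c \<odot> z) = c \<odot>\<^bsub>F\<^esub> to_frac z" if c: "c \<in> carrier K" and z: "z \<in> carrier D" for c z
  proof -
    obtain a b where ab: "a \<in> carrier R" "b \<in> Rnz" "z \<otimes> \<iota> b = \<iota> a" "to_frac z = frac_class R a b"
      using rep[OF z] by blast
    have "(c \<odot> z) \<otimes> \<iota> b = \<iota> (c \<odot>\<^bsub>R\<^esub> a)"
      using c z ab by (simp add: \<iota>_smult flip: D.smult_assoc_left)
    then show ?thesis unfolding ab(4) fract_smult[OF c ab(1,2)]
      using c z ab by (intro to_frac_eq) auto
  qed
  ultimately show ?thesis unfolding alg_iso_def ring_iso_def by auto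
qed

lemma fract_isomorphic: "alg_isomorphic K D (fract_algebra R)"
  using to_frac_iso unfolding alg_isomorphic_def by blast

end

text \<open>The image of \<psi> is a copy of \<open>S / Q\<close> inside \<open>D\<close>, and every
  element of \<open>D\<close> is a right fraction of elements of this image. Applied to the quantum
  affine space, this reduces the theorem to producing a suitable \<psi>.\<close>

lemma completely_prime_kernel:
  assumes S: "assoc_algebra K S" and D: "assoc_algebra K D" and U: "Units D = carrier D - {\<zero>\<^bsub>D\<^esub>}"
    and \<psi>: "\<psi> \<in> ring_hom S D"
    and smult: "\<And>c a. \<lbrakk> c \<in> carrier K; a \<in> carrier S \<rbrakk> \<Longrightarrow> \<psi> (c \<odot>\<^bsub>S\<^esub> a) = c \<odot>\<^bsub>D\<^esub> \<psi> a"
    and fractions: "\<And>z. z \<in> carrier D \<Longrightarrow>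
      \<exists>a\<in>carrier S. \<exists>b\<in>carrier S. \<psi> b \<noteq> \<zero>\<^bsub>D\<^esub> \<and> z \<otimes>\<^bsub>D\<^esub> \<psi> b = \<psi> a"
  defines "Q \<equiv> a_kernel S D \<psi>"
  shows "completely_prime Q S" "right_Ore_domain (quot_algebra S Q)"
    "alg_isomorphic K D (fract_algebra (quot_algebra S Q))"
proof -
  interpret S: assoc_algebra K S by fact
  interpret D: assoc_algebra K D by fact
  interpret \<psi>: ring_hom_ring S D \<psi>
    using S.A.ring_axioms D.A.ring_axioms \<psi> by (rule ring_hom_ringI2)
  have Q: "ideal Q S" unfolding Q_def by (rule \<psi>.kernel_is_ideal)
  interpret Q: ideal Q S by (rule Q)
  have ker: "a \<in> Q \<longleftrightarrow> a \<in> carrier S \<and> \<psi> a = \<zero>\<^bsub>D\<^esub>" for a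
    unfolding Q_def a_kernel_def' by simp
  let ?R = "quot_algebra S Q"
  obtain \<iota> where \<iota>: "\<iota> \<in> ring_hom ?R D" "\<And>a. a \<in> carrier S \<Longrightarrow> \<iota> (Q +>\<^bsub>S\<^esub> a) = \<psi> a"
    "\<And>c V. \<lbrakk> c \<in> carrier K; V \<in> carrier ?R \<rbrakk> \<Longrightarrow> \<iota> (c \<odot>\<^bsub>?R\<^esub> V) = c \<odot>\<^bsub>D\<^esub> \<iota> V"
    using S.quot_induced_hom[OF D Q \<psi> smult] ker by blast
  have C: "carrier ?R = (\<lambda>a. Q +>\<^bsub>S\<^esub> a) ` carrier S"
    unfolding quot_algebra_simps carrier_Quot ..
  have zero: "\<zero>\<^bsub>?R\<^esub> = Q" unfolding quot_algebra_simps FactRing_def by simp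
  have coset_zero: "Q +>\<^bsub>S\<^esub> a = Q \<longleftrightarrow> \<psi> a = \<zero>\<^bsub>D\<^esub>" if a: "a \<in> carrier S" for a
    using ker a Q.rcos_const_imp_mem[of a] Q.a_rcos_const[of a] by blast
  interpret fraction_embedding K ?R D \<iota>
  proof (unfold fraction_embedding_def fraction_embedding_axioms_def, intro conjI allI impI)
    show "assoc_algebra K ?R" using Q by (rule S.quot_assoc_algebra)
    show "assoc_algebra K D" by (rule D)
    fix V assume "V \<in> carrier ?R" "\<iota> V = \<zero>\<^bsub>D\<^esub>"
    moreover from this obtain a where "a \<in> carrier S" "V = Q +>\<^bsub>S\<^esub> a" unfolding C by blast
    ultimately show "V = \<zero>\<^bsub>?R\<^esub>" unfolding zero using \<iota>(2) coset_zero by simp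
  next
    fix z assume "z \<in> carrier D"
    then obtain a b where ab: "a \<in> carrier S" "b \<in> carrier S" "\<psi> b \<noteq> \<zero>\<^bsub>D\<^esub>" "z \<otimes>\<^bsub>D\<^esub> \<psi> b = \<psi> a"
      using fractions by blast
    then show "\<exists>a\<in>carrier ?R. \<exists>b\<in>carrier ?R - {\<zero>\<^bsub>?R\<^esub>}. z \<otimes>\<^bsub>D\<^esub> \<iota> b = \<iota> a"
      unfolding zero C using \<iota>(2) coset_zero
      by (intro bexI[of _ "Q +>\<^bsub>S\<^esub> a"] bexI[of _ "Q +>\<^bsub>S\<^esub> b"]) auto
  qed (use U \<iota> in auto)
  show ore: "right_Ore_domain ?R" by (rule right_Ore)
  then show "completely_prime Q S"
    using Q nc_domain_quot_algebra[OF Q] unfolding completely_prime_def right_Ore_domain_def by simp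
  show "alg_isomorphic K D (fract_algebra ?R)" by (rule fract_isomorphic)
qed

section \<open>Free algebras and quantum affine spaces\<close>

context cring begin

text \<open>The product of the free algebra, taken for arbitrary functions on words: without a
  support condition one may pass freely to \<open>\<lambda>v. f (x # v)\<close>, and identities can
  be proved by induction on the word.\<close>

definition conv :: "('x list \<Rightarrow> 'a) \<Rightarrow> ('x list \<Rightarrow> 'a) \<Rightarrow> 'x list \<Rightarrow> 'a" where
  "conv f g w = (\<Oplus>l\<in>{..length w}. f (take l w) \<otimes> g (drop l w))"

lemma conv_Nil: "\<lbrakk> range f \<subseteq> carrier R; range g \<subseteq> carrier R \<rbrakk> \<Longrightarrow> conv f g [] = f [] \<otimes> g []"
proof -
  assume "range f \<subseteq> carrier R" "range g \<subseteq> carrier R"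
  then have "\<And>w. f w \<in> carrier R" "\<And>w. g w \<in> carrier R" by auto
  then show ?thesis by (simp add: conv_def)
qed

text \<open>The splittings of \<open>x # w\<close> are sorted by their first part: it is empty, or
  it begins with \<open>x\<close>, and then what remains is a splitting of \<open>w\<close>.\<close>

lemma conv_Cons:
  assumes "range f \<subseteq> carrier R" "range g \<subseteq> carrier R"
  shows "conv f g (x # w) = f [] \<otimes> g (x # w) \<oplus> conv (\<lambda>v. f (x # v)) g w"
proof -
  have C: "\<And>w. f w \<in> carrier R" "\<And>w. g w \<in> carrier R" using assms by auto
  have "conv f g (x # w) =
      (\<Oplus>l\<in>{..length w}. f (x # take l w) \<otimes> g (drop l w)) \<oplus> f [] \<otimes> g (x # w)"
    unfolding conv_def length_Cons by (subst finsum_Suc2) (use C in \<open>auto simp: Pi_def\<close>)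
  then show ?thesis unfolding conv_def using C by (simp add: a_comm Pi_def)
qed

lemma conv_closed:
  "\<lbrakk> range f \<subseteq> carrier R; range g \<subseteq> carrier R \<rbrakk> \<Longrightarrow> range (conv f g) \<subseteq> carrier R"
  unfolding conv_def by (auto simp: image_subset_iff Pi_def intro!: finsum_closed)

lemma conv_closed' [simp]:
  "\<lbrakk> range f \<subseteq> carrier R; range g \<subseteq> carrier R \<rbrakk> \<Longrightarrow> conv f g w \<in> carrier R"
  using conv_closed by blast

lemma conv_add_left:
  assumes "range f \<subseteq> carrier R" "range f' \<subseteq> carrier R" "range g \<subseteq> carrier R"
  shows "conv (\<lambda>w. f w \<oplus> f' w) g w = conv f g w \<oplus> conv f' g w"
  unfolding conv_def using assms[THEN range_subsetD] by (simp add: l_distr finsum_addf Pi_def)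

lemma conv_add_right:
  assumes "range f \<subseteq> carrier R" "range g \<subseteq> carrier R" "range g' \<subseteq> carrier R"
  shows "conv f (\<lambda>w. g w \<oplus> g' w) w = conv f g w \<oplus> conv f g' w"
  unfolding conv_def using assms[THEN range_subsetD] by (simp add: r_distr finsum_addf Pi_def)

lemma conv_smult_left:
  assumes c: "c \<in> carrier R" and "range f \<subseteq> carrier R" "range g \<subseteq> carrier R"
  shows "conv (\<lambda>w. c \<otimes> f w) g w = c \<otimes> conv f g w"
  unfolding conv_def using c assms(2,3)[THEN range_subsetD] by (simp add: finsum_rdistr m_assoc Pi_def)

lemma conv_smult_right:
  assumes c: "c \<in> carrier R" and "range f \<subseteq> carrier R" "range g \<subseteq> carrier R"
  shows "conv f (\<lambda>w. c \<otimes> g w) w = c \<otimes> conv f g w"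
  unfolding conv_def using c assms(2,3)[THEN range_subsetD] by (simp add: finsum_rdistr m_lcomm Pi_def)

lemma conv_assoc:
  "\<lbrakk> range f \<subseteq> carrier R; range g \<subseteq> carrier R; range h \<subseteq> carrier R \<rbrakk>
    \<Longrightarrow> conv (conv f g) h w = conv f (conv g h) w"
proof (induction w arbitrary: f g)
  case Nil
  then have "f [] \<in> carrier R" "g [] \<in> carrier R" "h [] \<in> carrier R" by auto
  then show ?case using Nil by (simp add: conv_Nil conv_closed m_assoc)
next
  case (Cons x w)
  let ?f = "\<lambda>v. f (x # v)" and ?g = "\<lambda>v. g (x # v)"
  note p = Cons.prems
  have C: "range ?f \<subseteq> carrier R" "range ?g \<subseteq> carrier R" "range (\<lambda>v. f [] \<otimes> g (x # v)) \<subseteq> carrier R"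
    "f [] \<in> carrier R" "g [] \<in> carrier R" "\<And>v. h v \<in> carrier R"
    using p[THEN range_subsetD] by auto
  have "conv (conv f g) h (x # w) = conv f g [] \<otimes> h (x # w) \<oplus> conv (\<lambda>v. conv f g (x # v)) h w"
    by (rule conv_Cons[OF conv_closed[OF p(1,2)] p(3)])
  also have "conv (\<lambda>v. conv f g (x # v)) h w
      = f [] \<otimes> conv ?g h w \<oplus> conv ?f (conv g h) w"
    unfolding conv_Cons[OF p(1,2)]
      conv_add_left[OF C(3) conv_closed[OF C(1) p(2)] p(3)] conv_smult_left[OF C(4) C(2) p(3)]
      Cons.IH[OF C(1) p(2,3)] ..
  also have "conv f g [] \<otimes> h (x # w) \<oplus> (f [] \<otimes> conv ?g h w \<oplus> conv ?f (conv g h) w)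
      = f [] \<otimes> conv g h (x # w) \<oplus> conv ?f (conv g h) w"
    unfolding conv_Nil[OF p(1,2)] conv_Cons[OF p(2,3)]
    using C conv_closed'[OF C(2) p(3), of w] conv_closed'[OF C(1) conv_closed[OF p(2,3)], of w]
    by (simp add: r_distr m_assoc a_assoc)
  also have "\<dots> = conv f (conv g h) (x # w)"
    by (rule conv_Cons[OF p(1) conv_closed[OF p(2,3)], symmetric])
  finally show ?case .
qed

lemma conv_zero_left: "range g \<subseteq> carrier R \<Longrightarrow> conv (\<lambda>_. \<zero>) g w = \<zero>"
  unfolding conv_def by (simp add: image_subset_iff)

lemma conv_one_left: "range g \<subseteq> carrier R \<Longrightarrow> conv (\<lambda>w. if w = [] then \<one> else \<zero>) g w = g w"
proof (cases w)
  case Nil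
  assume "range g \<subseteq> carrier R"
  then show ?thesis using Nil by (simp add: conv_Nil image_subset_iff)
next
  case (Cons x v)
  assume g: "range g \<subseteq> carrier R"
  then have "g (x # v) \<in> carrier R" by auto
  then show ?thesis using Cons conv_Cons[of "\<lambda>w. if w = [] then \<one> else \<zero>" g x v] g
    by (simp add: conv_zero_left image_subset_iff)
qed

lemma conv_one_right: "range f \<subseteq> carrier R \<Longrightarrow> conv f (\<lambda>w. if w = [] then \<one> else \<zero>) w = f w"
proof (induction w arbitrary: f)
  case Nil
  then show ?case by (simp add: conv_Nil image_subset_iff)
next
  case (Cons x w)
  then have "f [] \<in> carrier R" "f (x # w) \<in> carrier R" "range (\<lambda>v. f (x # v)) \<subseteq> carrier R" by auto
  then show ?case
    using Cons conv_Cons[of f "\<lambda>w. if w = [] then \<one> else \<zero>" x w] by (simp add: image_subset_iff)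
qed

lemma conv_support:
  "\<lbrakk> range f \<subseteq> carrier R; range g \<subseteq> carrier R; conv f g w \<noteq> \<zero> \<rbrakk>
    \<Longrightarrow> \<exists>u v. w = u @ v \<and> f u \<noteq> \<zero> \<and> g v \<noteq> \<zero>"
proof (induction w arbitrary: f)
  case Nil
  then have C: "f [] \<in> carrier R" "g [] \<in> carrier R" by auto
  have "f [] \<noteq> \<zero> \<and> g [] \<noteq> \<zero>" using Nil C by (auto simp: conv_Nil)
  then show ?case by blast
next
  case (Cons x w)
  have C: "range (\<lambda>v. f (x # v)) \<subseteq> carrier R" "f [] \<in> carrier R" "g (x # w) \<in> carrier R"
    using Cons.prems by auto
  have "f [] \<otimes> g (x # w) \<noteq> \<zero> \<or> conv (\<lambda>v. f (x # v)) g w \<noteq> \<zero>"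
    using Cons.prems(3) unfolding conv_Cons[OF Cons.prems(1,2)] by auto
  then show ?case
  proof
    assume "f [] \<otimes> g (x # w) \<noteq> \<zero>"
    then have "f [] \<noteq> \<zero> \<and> g (x # w) \<noteq> \<zero>" using C by auto
    then show ?thesis by (intro exI[of _ "[]"] exI[of _ "x # w"]) simp
  next
    assume "conv (\<lambda>v. f (x # v)) g w \<noteq> \<zero>"
    then obtain u v where "w = u @ v" "f (x # u) \<noteq> \<zero>" "g v \<noteq> \<zero>"
      using Cons.IH[OF C(1) Cons.prems(2)] by blast
    then show ?thesis by (intro exI[of _ "x # u"] exI[of _ v]) simp
  qed
qed

end

lemma free_algebra_simps:
  "f \<in> carrier (free_algebra K n) \<longleftrightarrow> range f \<subseteq> carrier K \<and>
     (\<forall>w. w \<notin> lists {1..n} \<longrightarrow> f w = \<zero>\<^bsub>K\<^esub>) \<and> finite {w. f w \<noteq> \<zero>\<^bsub>K\<^esub>}"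
  "\<one>\<^bsub>free_algebra K n\<^esub> = (\<lambda>w. if w = [] then \<one>\<^bsub>K\<^esub> else \<zero>\<^bsub>K\<^esub>)"
  "\<zero>\<^bsub>free_algebra K n\<^esub> = (\<lambda>w. \<zero>\<^bsub>K\<^esub>)"
  "f \<oplus>\<^bsub>free_algebra K n\<^esub> g = (\<lambda>w. f w \<oplus>\<^bsub>K\<^esub> g w)"
  "c \<odot>\<^bsub>free_algebra K n\<^esub> f = (\<lambda>w. c \<otimes>\<^bsub>K\<^esub> f w)"
  by (auto simp: free_algebra_def)

context field begin

abbreviation "FA \<equiv> free_algebra R"

lemma FA_mult: "f \<otimes>\<^bsub>FA n\<^esub> g = conv f g"
  by (simp add: free_algebra_def conv_def fun_eq_iff)

lemmas FA_simps = free_algebra_simps(2-5) FA_mult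

lemma FA_carr: "f \<in> carrier (FA n) \<Longrightarrow> range f \<subseteq> carrier R"
  and FA_carr': "f \<in> carrier (FA n) \<Longrightarrow> f w \<in> carrier R"
  by (auto simp: free_algebra_simps(1))

lemma FA_memI:
  assumes "range f \<subseteq> carrier R" "finite T" "T \<subseteq> lists {1..n}" "\<And>w. w \<notin> T \<Longrightarrow> f w = \<zero>"
  shows "f \<in> carrier (FA n)"
proof -
  have "{w. f w \<noteq> \<zero>} \<subseteq> T" using assms(4) by blast
  then show ?thesis
    unfolding free_algebra_simps(1) using assms finite_subset[of _ T] by blast
qed

lemma FA_supp: "f \<in> carrier (FA n) \<Longrightarrow> finite {w. f w \<noteq> \<zero>} \<and> {w. f w \<noteq> \<zero>} \<subseteq> lists {1..n}"
  by (auto simp: free_algebra_simps(1))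

lemma FA_zero: "(\<lambda>_. \<zero>) \<in> carrier (FA n)"
  by (rule FA_memI[of _ "{}"]) auto

lemma FA_one: "(\<lambda>w. if w = [] then \<one> else \<zero>) \<in> carrier (FA n)"
  by (rule FA_memI[of _ "{[]}"]) auto

lemma FA_add: "\<lbrakk> f \<in> carrier (FA n); g \<in> carrier (FA n) \<rbrakk> \<Longrightarrow> (\<lambda>w. f w \<oplus> g w) \<in> carrier (FA n)"
  using FA_supp[of f n] FA_supp[of g n] FA_carr'[of f n] FA_carr'[of g n]
  by (intro FA_memI[of _ "{w. f w \<noteq> \<zero>} \<union> {w. g w \<noteq> \<zero>}"]) auto

lemma FA_smult: "\<lbrakk> c \<in> carrier R; f \<in> carrier (FA n) \<rbrakk> \<Longrightarrow> (\<lambda>w. c \<otimes> f w) \<in> carrier (FA n)"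
  using FA_supp[of f n] FA_carr'[of f n]
  by (intro FA_memI[of _ "{w. f w \<noteq> \<zero>}"]) auto

lemma FA_conv:
  assumes f: "f \<in> carrier (FA n)" and g: "g \<in> carrier (FA n)"
  shows "conv f g \<in> carrier (FA n)"
proof (rule FA_memI)
  let ?T = "(\<lambda>(u, v). u @ v) ` ({w. f w \<noteq> \<zero>} \<times> {w. g w \<noteq> \<zero>})"
  show "range (conv f g) \<subseteq> carrier R" using f g by (intro conv_closed FA_carr)
  show "finite ?T" using FA_supp f g by blast
  show "?T \<subseteq> lists {1..n}"
  proof
    fix w assume "w \<in> ?T"
    then obtain u v where w: "w = u @ v" and "f u \<noteq> \<zero>" "g v \<noteq> \<zero>" by auto
    then have "u \<in> lists {1..n}" "v \<in> lists {1..n}" using FA_supp[OF f] FA_supp[OF g] by blast+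
    then show "w \<in> lists {1..n}" unfolding w by (simp only: append_in_lists_conv)
  qed
  fix w assume "w \<notin> ?T"
  then show "conv f g w = \<zero>" using conv_support[OF FA_carr[OF f] FA_carr[OF g], of w] by force
qed

lemma free_algebra_assoc_algebra: "assoc_algebra R (FA n)"
proof -
  have ring: "ring (FA n)"
  proof (rule ringI)
    show "abelian_group (FA n)"
    proof (rule abelian_groupI; unfold FA_simps)
      fix f assume f: "f \<in> carrier (FA n)"
      show "\<exists>g\<in>carrier (FA n). (\<lambda>w. g w \<oplus> f w) = (\<lambda>w. \<zero>)"
      proof
        show "(\<lambda>w. \<ominus> \<one> \<otimes> f w) \<in> carrier (FA n)" using f by (intro FA_smult) auto
        show "(\<lambda>w. \<ominus> \<one> \<otimes> f w \<oplus> f w) = (\<lambda>w. \<zero>)"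
          using FA_carr'[OF f] by (simp add: fun_eq_iff l_minus l_neg)
      qed
    qed (use FA_carr' in \<open>auto simp: fun_eq_iff FA_zero FA_add a_ac\<close>)
    show "monoid (FA n)"
      by (rule monoidI; unfold FA_simps)
        (use FA_carr in \<open>auto simp: fun_eq_iff FA_one FA_conv conv_assoc conv_one_left conv_one_right\<close>)
  qed (use FA_carr in \<open>auto simp: FA_simps fun_eq_iff conv_add_left conv_add_right\<close>)
  interpret FA: ring "FA n" by (rule ring)
  have "module_axioms R (FA n)"
    by (standard; unfold FA_simps)
      (use FA_carr' in \<open>auto simp: fun_eq_iff FA_smult l_distr r_distr m_assoc\<close>)
  moreover have "assoc_algebra_axioms R (FA n)"
    by (standard; unfold FA_simps)
      (use FA_carr in \<open>auto simp: fun_eq_iff conv_smult_left conv_smult_right\<close>)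
  ultimately show ?thesis
    using ring field_axioms cring_axioms FA.abelian_group_axioms
    by (simp add: assoc_algebra_def module_def)
qed

lemma free_gen_closed: "i \<in> {1..n} \<Longrightarrow> free_gen R i \<in> carrier (FA n)"
  unfolding free_gen_def by (rule FA_memI[of _ "{[i]}"]) auto

end

section \<open>Evaluation of noncommutative polynomials\<close>

locale evaluation = assoc_algebra K D for K (structure) and D (structure) +
  fixes y :: "nat \<Rightarrow> _"
  assumes y_closed [simp]: "y i \<in> carrier D"
begin

primrec yw where
  "yw [] = \<one>\<^bsub>D\<^esub>"
| "yw (i # w) = y i \<otimes>\<^bsub>D\<^esub> yw w"

lemma yw_closed [simp]: "yw w \<in> carrier D"
  by (induction w) auto

definition ev where "ev f = (\<Oplus>\<^bsub>D\<^esub>w\<in>{w. f w \<noteq> \<zero>}. f w \<odot>\<^bsub>D\<^esub> yw w)"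

lemma ev_superset:
  assumes "range f \<subseteq> carrier K" "finite T" "{w. f w \<noteq> \<zero>} \<subseteq> T"
  shows "ev f = (\<Oplus>\<^bsub>D\<^esub>w\<in>T. f w \<odot>\<^bsub>D\<^esub> yw w)"
proof -
  have C: "\<And>w. f w \<in> carrier K" using assms(1) by auto
  show ?thesis unfolding ev_def
    by (rule M.add.finprod_mono_neutral_cong_left) (use assms C in \<open>auto simp: Pi_def\<close>)
qed

lemma ev_closed: "f \<in> carrier (K.FA n) \<Longrightarrow> ev f \<in> carrier D"
  unfolding ev_def using K.FA_carr' by (intro M.finsum_closed) (auto simp: Pi_def)

lemma ev_add:
  assumes f: "f \<in> carrier (K.FA n)" and g: "g \<in> carrier (K.FA n)"
  shows "ev (\<lambda>w. f w \<oplus> g w) = ev f \<oplus>\<^bsub>D\<^esub> ev g"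
proof -
  let ?T = "{w. f w \<noteq> \<zero>} \<union> {w. g w \<noteq> \<zero>}"
  have T: "finite ?T" using K.FA_supp f g by blast
  have C: "\<And>w. f w \<in> carrier K" "\<And>w. g w \<in> carrier K" using f g K.FA_carr' by auto
  have "ev (\<lambda>w. f w \<oplus> g w) = (\<Oplus>\<^bsub>D\<^esub>w\<in>?T. (f w \<oplus> g w) \<odot>\<^bsub>D\<^esub> yw w)"
    using T C by (intro ev_superset) auto
  also have "\<dots> = (\<Oplus>\<^bsub>D\<^esub>w\<in>?T. f w \<odot>\<^bsub>D\<^esub> yw w \<oplus>\<^bsub>D\<^esub> g w \<odot>\<^bsub>D\<^esub> yw w)"
    using C by (intro M.finsum_cong') (auto simp: M.smult_l_distr)
  also have "\<dots> = (\<Oplus>\<^bsub>D\<^esub>w\<in>?T. f w \<odot>\<^bsub>D\<^esub> yw w) \<oplus>\<^bsub>D\<^esub> (\<Oplus>\<^bsub>D\<^esub>w\<in>?T. g w \<odot>\<^bsub>D\<^esub> yw w)"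
    using C by (intro M.finsum_addf) auto
  also have "(\<Oplus>\<^bsub>D\<^esub>w\<in>?T. f w \<odot>\<^bsub>D\<^esub> yw w) = ev f"
    using T C by (intro ev_superset[symmetric]) auto
  also have "(\<Oplus>\<^bsub>D\<^esub>w\<in>?T. g w \<odot>\<^bsub>D\<^esub> yw w) = ev g"
    using T C by (intro ev_superset[symmetric]) auto
  finally show ?thesis .
qed

lemma ev_smult:
  assumes c: "c \<in> carrier K" and f: "f \<in> carrier (K.FA n)"
  shows "ev (\<lambda>w. c \<otimes> f w) = c \<odot>\<^bsub>D\<^esub> ev f"
proof -
  let ?T = "{w. f w \<noteq> \<zero>}"
  have T: "finite ?T" using K.FA_supp f by blast
  have C: "\<And>w. f w \<in> carrier K" using f K.FA_carr' by auto
  have "ev (\<lambda>w. c \<otimes> f w) = (\<Oplus>\<^bsub>D\<^esub>w\<in>?T. (c \<otimes> f w) \<odot>\<^bsub>D\<^esub> yw w)"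
    using T C c by (intro ev_superset) auto
  also have "\<dots> = (\<Oplus>\<^bsub>D\<^esub>w\<in>?T. c \<odot>\<^bsub>D\<^esub> (f w \<odot>\<^bsub>D\<^esub> yw w))"
    using C c by (intro M.finsum_cong') (auto simp: M.smult_assoc1)
  also have "\<dots> = c \<odot>\<^bsub>D\<^esub> ev f" unfolding ev_def
    using C c T by (intro M.finsum_smult_ldistr[symmetric]) auto
  finally show ?thesis .
qed

text \<open>Left multiplication by the letter \<open>i\<close> in the free algebra.\<close>

definition shift where
  "shift i f w = (case w of [] \<Rightarrow> \<zero> | j # v \<Rightarrow> if i = j then f v else \<zero>)"

lemma shift_supp: "{w. shift i f w \<noteq> \<zero>} = Cons i ` {w. f w \<noteq> \<zero>}"
proof (rule Set.set_eqI)
  fix w show "w \<in> {w. shift i f w \<noteq> \<zero>} \<longleftrightarrow> w \<in> Cons i ` {w. f w \<noteq> \<zero>}"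
    by (cases w) (auto simp: shift_def)
qed

lemma ev_shift:
  assumes f: "range f \<subseteq> carrier K" "finite {w. f w \<noteq> \<zero>}"
  shows "ev (shift i f) = y i \<otimes>\<^bsub>D\<^esub> ev f"
proof -
  have C: "\<And>w. f w \<in> carrier K" using f by auto
  have "ev (shift i f) = (\<Oplus>\<^bsub>D\<^esub>w\<in>{w. f w \<noteq> \<zero>}. shift i f (i # w) \<odot>\<^bsub>D\<^esub> yw (i # w))"
    unfolding ev_def shift_supp
    using C by (intro M.finsum_reindex) (auto simp: shift_def split: list.splits)
  also have "\<dots> = (\<Oplus>\<^bsub>D\<^esub>w\<in>{w. f w \<noteq> \<zero>}. y i \<otimes>\<^bsub>D\<^esub> (f w \<odot>\<^bsub>D\<^esub> yw w))"
    using C by (intro M.finsum_cong') (auto simp: shift_def smult_assoc_right)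
  also have "\<dots> = y i \<otimes>\<^bsub>D\<^esub> ev f" unfolding ev_def
    using C f by (intro A.finsum_rdistr[symmetric]) auto
  finally show ?thesis .
qed

definition single where
  "single c w v = (if v = w then c else \<zero>)"

lemma single_closed: "c \<in> carrier K \<Longrightarrow> range (single c w) \<subseteq> carrier K"
  by (auto simp: single_def)

text \<open>The letters of the word are split off one at a time by \<open>shift\<close>. The general
  multiplicativity of \<open>ev\<close> follows by additivity in the first factor.\<close>

lemma ev_conv_single:
  assumes c: "c \<in> carrier K" and g: "g \<in> carrier (K.FA n)"
  shows "set w \<subseteq> {1..n} \<Longrightarrow> K.conv (single c w) g \<in> carrier (K.FA n) \<and>
    ev (K.conv (single c w) g) = (c \<odot>\<^bsub>D\<^esub> yw w) \<otimes>\<^bsub>D\<^esub> ev g"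
proof (induction w)
  case Nil
  have gc: "range g \<subseteq> carrier K" using K.FA_carr g .
  have "K.conv (single c []) g v = c \<otimes> g v" for v
  proof -
    have eq: "single c [] = (\<lambda>w. c \<otimes> (if w = [] then \<one> else \<zero>))"
      using c by (auto simp: single_def fun_eq_iff)
    show ?thesis
      unfolding eq K.conv_smult_left[OF c K.FA_carr[OF K.FA_one[of n]] gc] K.conv_one_left[OF gc] ..
  qed
  then have "K.conv (single c []) g = (\<lambda>v. c \<otimes> g v)" by (simp add: fun_eq_iff)
  then show ?case using c g ev_closed[OF g]
    by (simp add: ev_smult K.FA_smult flip: smult_assoc_left)
next
  case (Cons i w)
  have gc: "range g \<subseteq> carrier K" using K.FA_carr g .
  have "K.conv (single c (i # w)) g v = shift i (K.conv (single c w) g) v" for v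
  proof (cases v)
    case Nil
    then have "g [] \<in> carrier K" using gc by auto
    then show ?thesis using Nil K.conv_Nil[OF single_closed[OF c] gc]
      by (simp add: single_def shift_def)
  next
    case (Cons j u)
    then have "g v \<in> carrier K" using gc by auto
    moreover have "(\<lambda>v. single c (i # w) (j # v)) = (if i = j then single c w else (\<lambda>_. \<zero>))"
      by (auto simp: single_def fun_eq_iff)
    moreover have "single c (i # w) [] = \<zero>" by (simp add: single_def)
    ultimately show ?thesis
      using Cons K.conv_Cons[OF single_closed[OF c] gc, of "i # w" j u]
        K.conv_zero_left[OF gc] K.conv_closed'[OF single_closed[OF c, of w] gc]
      by (simp add: shift_def)
  qed
  then have eq: "K.conv (single c (i # w)) g = shift i (K.conv (single c w) g)" by (simp add: fun_eq_iff)
  have IH: "K.conv (single c w) g \<in> carrier (K.FA n)"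
    "ev (K.conv (single c w) g) = (c \<odot>\<^bsub>D\<^esub> yw w) \<otimes>\<^bsub>D\<^esub> ev g" using Cons by auto
  have "shift i (K.conv (single c w) g) \<in> carrier (K.FA n)"
  proof (rule K.FA_memI)
    show "range (shift i (K.conv (single c w) g)) \<subseteq> carrier K"
      using K.FA_carr'[OF IH(1)] by (auto simp: shift_def split: list.splits)
    show "finite {v. shift i (K.conv (single c w) g) v \<noteq> \<zero>}"
      "{v. shift i (K.conv (single c w) g) v \<noteq> \<zero>} \<subseteq> lists {1..n}"
      unfolding shift_supp using K.FA_supp[OF IH(1)] Cons.prems by (force intro: lists.Cons)+
  qed auto
  moreover have "ev (shift i (K.conv (single c w) g)) = y i \<otimes>\<^bsub>D\<^esub> ((c \<odot>\<^bsub>D\<^esub> yw w) \<otimes>\<^bsub>D\<^esub> ev g)"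
    using ev_shift K.FA_carr[OF IH(1)] K.FA_supp[OF IH(1)] IH(2) by simp
  ultimately show ?case unfolding eq using c ev_closed[OF g]
    by (simp add: A.m_assoc flip: smult_assoc_left smult_assoc_right)
qed

lemma ev_single: "c \<in> carrier K \<Longrightarrow> ev (single c w) = c \<odot>\<^bsub>D\<^esub> yw w"
proof -
  assume c: "c \<in> carrier K"
  have "{v. single c w v \<noteq> \<zero>} \<subseteq> {w}" by (auto simp: single_def)
  then show ?thesis
    using ev_superset[OF single_closed[OF c], of "{w}" w] c by (simp add: single_def)
qed

lemma ev_mult:
  assumes f: "f \<in> carrier (K.FA n)" and g: "g \<in> carrier (K.FA n)"
  shows "ev (K.conv f g) = ev f \<otimes>\<^bsub>D\<^esub> ev g"
proof -
  have gc: "range g \<subseteq> carrier K" using K.FA_carr g .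
  \<comment> \<open>The induction runs over a finite set containing the support instead of the
    support itself, so a step whose coefficient vanishes is harmless.\<close>
  have "f \<in> carrier (K.FA n) \<Longrightarrow> {w. f w \<noteq> \<zero>} \<subseteq> T \<Longrightarrow> ev (K.conv f g) = ev f \<otimes>\<^bsub>D\<^esub> ev g"
    if "finite T" for T
    using that
  proof (induction T arbitrary: f)
    case empty
    then have "f = (\<lambda>_. \<zero>)" by auto
    moreover have "ev (\<lambda>_. \<zero>) = \<zero>\<^bsub>D\<^esub>" by (simp add: ev_def)
    moreover have "K.conv (\<lambda>_. \<zero>) g = (\<lambda>_. \<zero>)" using K.conv_zero_left[OF gc] by (simp add: fun_eq_iff)
    ultimately show ?case using ev_closed[OF g] by simp
  next
    case (insert w T)
    show ?case
    proof (cases "f w = \<zero>")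
      case True
      then have "{w. f w \<noteq> \<zero>} \<subseteq> T" using insert.prems(2) by auto
      then show ?thesis using insert by blast
    next
      case False
      let ?s = "single (f w) w" and ?f = "f(w := \<zero>)"
      have fw: "f w \<in> carrier K" using K.FA_carr'[OF insert.prems(1)] .
      have w: "set w \<subseteq> {1..n}" using K.FA_supp[OF insert.prems(1)] False by auto
      have s: "?s \<in> carrier (K.FA n)"
        by (rule K.FA_memI[OF single_closed[OF fw], of "{w}"]) (use w in \<open>auto simp: single_def\<close>)
      have f': "?f \<in> carrier (K.FA n)"
        by (rule K.FA_memI[of _ "{w. f w \<noteq> \<zero>}"])
          (use K.FA_supp[OF insert.prems(1)] K.FA_carr'[OF insert.prems(1)] in auto)
      have f: "f = (\<lambda>v. ?s v \<oplus> ?f v)"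
        using K.FA_carr'[OF insert.prems(1)] by (auto simp: single_def fun_eq_iff)
      have "{v. ?f v \<noteq> \<zero>} \<subseteq> T" using insert.prems(2) by auto
      then have IH: "ev (K.conv ?f g) = ev ?f \<otimes>\<^bsub>D\<^esub> ev g" using insert.IH f' by blast
      have "K.conv f g = (\<lambda>v. K.conv ?s g v \<oplus> K.conv ?f g v)"
        by (subst f) (rule ext, rule K.conv_add_left[OF K.FA_carr[OF s] K.FA_carr[OF f'] gc])
      then have "ev (K.conv f g) = ev (K.conv ?s g) \<oplus>\<^bsub>D\<^esub> ev (K.conv ?f g)"
        using ev_add[OF K.FA_conv[OF s g] K.FA_conv[OF f' g]] by simp
      also have "\<dots> = (ev ?s \<oplus>\<^bsub>D\<^esub> ev ?f) \<otimes>\<^bsub>D\<^esub> ev g"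
        unfolding IH using ev_conv_single[OF fw g w] ev_single[OF fw, of w]
          ev_closed[OF s] ev_closed[OF f'] ev_closed[OF g] by (simp add: A.l_distr)
      also have "ev ?s \<oplus>\<^bsub>D\<^esub> ev ?f = ev f" by (subst (3) f) (rule ev_add[OF s f', symmetric])
      finally show ?thesis .
    qed
  qed
  then show ?thesis using K.FA_supp[OF f] f by blast
qed

lemma ev_hom: "ev \<in> ring_hom (K.FA n) D"
proof (rule ring_hom_memI)
  show "ev \<one>\<^bsub>K.FA n\<^esub> = \<one>\<^bsub>D\<^esub>"
    using ev_single[of \<one> "[]"] unfolding single_def K.FA_simps by simp
qed (simp_all add: ev_closed K.FA_simps ev_add ev_mult)

lemma ev_gen: "ev (free_gen K i) = y i"
  using ev_single[of \<one> "[i]"] unfolding single_def free_gen_def by simp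

text \<open>Evaluation kills the defining relations, hence the ideal generated by them, and factors
  through the quotient. About the image it is enough to record that it contains the
  \<open>y i\<close>.\<close>

lemma quantum_affine_space_hom:
  assumes rel: "\<And>i j. \<lbrakk> i \<in> {1..n}; j \<in> {1..n} \<rbrakk> \<Longrightarrow> \<Lambda> i j \<in> carrier K \<and>
      y i \<otimes>\<^bsub>D\<^esub> y j = \<Lambda> i j \<odot>\<^bsub>D\<^esub> (y j \<otimes>\<^bsub>D\<^esub> y i)"
  obtains \<psi> where "assoc_algebra K (quantum_affine_space K n \<Lambda>)"
    "\<psi> \<in> ring_hom (quantum_affine_space K n \<Lambda>) D"
    "\<And>c f. \<lbrakk> c \<in> carrier K; f \<in> carrier (quantum_affine_space K n \<Lambda>) \<rbrakk>
      \<Longrightarrow> \<psi> (c \<odot>\<^bsub>quantum_affine_space K n \<Lambda>\<^esub> f) = c \<odot>\<^bsub>D\<^esub> \<psi> f"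
    "\<And>i. i \<in> {1..n} \<Longrightarrow> y i \<in> \<psi> ` carrier (quantum_affine_space K n \<Lambda>)"
proof -
  interpret FA: assoc_algebra K "K.FA n" by (rule K.free_algebra_assoc_algebra)
  let ?g = "free_gen K"
  interpret ev: ring_hom_ring "K.FA n" D ev
    using FA.A.ring_axioms A.ring_axioms ev_hom by (rule ring_hom_ringI2)
  let ?I = "genideal (K.FA n) (quantum_relations K n \<Lambda>)"
  note g = K.free_gen_closed
  have sm: "\<And>c f. \<lbrakk> c \<in> carrier K; f \<in> carrier (K.FA n) \<rbrakk> \<Longrightarrow> ev (c \<odot>\<^bsub>K.FA n\<^esub> f) = c \<odot>\<^bsub>D\<^esub> ev f"
    by (simp add: K.FA_simps ev_smult)
  have rel_sub: "quantum_relations K n \<Lambda> \<subseteq> a_kernel (K.FA n) D ev"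
  proof
    fix r assume "r \<in> quantum_relations K n \<Lambda>"
    then obtain i j where i: "i \<in> {1..n}" and j: "j \<in> {1..n}"
      and r: "r = ?g i \<otimes>\<^bsub>K.FA n\<^esub> ?g j \<ominus>\<^bsub>K.FA n\<^esub> \<Lambda> i j \<odot>\<^bsub>K.FA n\<^esub> (?g j \<otimes>\<^bsub>K.FA n\<^esub> ?g i)"
      unfolding quantum_relations_def Let_def by blast
    have L: "\<Lambda> i j \<in> carrier K" using rel i j by blast
    have "ev r = y i \<otimes>\<^bsub>D\<^esub> y j \<ominus>\<^bsub>D\<^esub> \<Lambda> i j \<odot>\<^bsub>D\<^esub> (y j \<otimes>\<^bsub>D\<^esub> y i)"
      unfolding r using g[OF i] g[OF j] L by (simp add: a_minus_def sm ev_gen)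
    also have "\<dots> = \<zero>\<^bsub>D\<^esub>" using rel[OF i j] L by (simp add: a_minus_def M.r_neg)
    finally show "r \<in> a_kernel (K.FA n) D ev"
      unfolding a_kernel_def' r using g[OF i] g[OF j] L by simp
  qed
  moreover have "a_kernel (K.FA n) D ev \<subseteq> carrier (K.FA n)" unfolding a_kernel_def' by auto
  ultimately have I: "ideal ?I (K.FA n)" by (intro FA.A.genideal_ideal) auto
  have "?I \<subseteq> a_kernel (K.FA n) D ev"
    using rel_sub ev.kernel_is_ideal by (intro FA.A.genideal_minimal)
  then have ker: "\<And>f. f \<in> ?I \<Longrightarrow> ev f = \<zero>\<^bsub>D\<^esub>" unfolding a_kernel_def' by auto
  obtain \<psi> where \<psi>: "\<psi> \<in> ring_hom (quantum_affine_space K n \<Lambda>) D"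
    "\<And>f. f \<in> carrier (K.FA n) \<Longrightarrow> \<psi> (?I +>\<^bsub>K.FA n\<^esub> f) = ev f"
    "\<And>c f. \<lbrakk> c \<in> carrier K; f \<in> carrier (quantum_affine_space K n \<Lambda>) \<rbrakk>
      \<Longrightarrow> \<psi> (c \<odot>\<^bsub>quantum_affine_space K n \<Lambda>\<^esub> f) = c \<odot>\<^bsub>D\<^esub> \<psi> f"
    unfolding quantum_affine_space_def
    using FA.quot_induced_hom[OF assoc_algebra_axioms I ev_hom sm ker] by blast
  show thesis
  proof (rule that[OF _ \<psi>(1) \<psi>(3)])
    show "assoc_algebra K (quantum_affine_space K n \<Lambda>)"
      unfolding quantum_affine_space_def using I by (rule FA.quot_assoc_algebra)
    fix i assume i: "i \<in> {1..n}"
    then have "\<psi> (?I +>\<^bsub>K.FA n\<^esub> ?g i) = y i" using \<psi>(2)[OF g] ev_gen by simp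
    moreover have "?I +>\<^bsub>K.FA n\<^esub> ?g i \<in> carrier (quantum_affine_space K n \<Lambda>)"
      unfolding quantum_affine_space_def quot_algebra_simps carrier_Quot using g[OF i] by blast
    ultimately show "y i \<in> \<psi> ` carrier (quantum_affine_space K n \<Lambda>)" by (metis imageI)
  qed
qed

end

section \<open>Linear spans and commuting operators\<close>

inductive_set linear_span :: "('k, 'c) ring_scheme \<Rightarrow> ('k, 'a, 'm) module_scheme \<Rightarrow> 'a set \<Rightarrow> 'a set"
  for K :: "('k, 'c) ring_scheme" and A :: "('k, 'a, 'm) module_scheme" and S :: "'a set" where
  linear_span_zero: "\<zero>\<^bsub>A\<^esub> \<in> linear_span K A S"
| linear_span_step: "\<lbrakk> c \<in> carrier K; v \<in> S; z \<in> linear_span K A S \<rbrakk>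
    \<Longrightarrow> c \<odot>\<^bsub>A\<^esub> v \<oplus>\<^bsub>A\<^esub> z \<in> linear_span K A S"

lemma linear_span_mono: "z \<in> linear_span K A S \<Longrightarrow> S \<subseteq> T \<Longrightarrow> z \<in> linear_span K A T"
  by (induction rule: linear_span.induct) (auto intro: linear_span.intros)

lemma linear_span_finite:
  "z \<in> linear_span K A S \<Longrightarrow> \<exists>F. finite F \<and> F \<subseteq> S \<and> z \<in> linear_span K A F"
proof (induction rule: linear_span.induct)
  case linear_span_zero
  then show ?case by (intro exI[of _ "{}"]) (auto intro: linear_span.intros)
next
  case (linear_span_step c v z)
  then obtain F where "finite F" "F \<subseteq> S" "z \<in> linear_span K A F" by blast
  then show ?case using linear_span_step(1,2)
    by (intro exI[of _ "insert v F"])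
      (auto intro!: linear_span.linear_span_step intro: linear_span_mono)
qed

locale plain_algebra = assoc_algebra K A for K and A (structure)

context plain_algebra begin

abbreviation "lspan \<equiv> linear_span K A"

lemmas alg_simps = smult_assoc_left[symmetric] smult_assoc_right[symmetric] M.smult_assoc1[symmetric]
  M.smult_r_distr smult_uminus A.m_assoc A.l_distr A.r_distr A.l_minus A.r_minus

lemma nonzero_smult_cancel:
  assumes "c \<in> carrier K" "c \<noteq> \<zero>\<^bsub>K\<^esub>" "a \<in> carrier A"
  shows "inv\<^bsub>K\<^esub> c \<odot> (c \<odot> a) = a"
  using assms K.field_Units by (simp flip: M.smult_assoc1)

lemma span_closed: "z \<in> lspan S \<Longrightarrow> S \<subseteq> carrier A \<Longrightarrow> z \<in> carrier A"
  by (induction rule: linear_span.induct) auto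

lemma span_add:
  assumes S: "S \<subseteq> carrier A" and z: "z \<in> lspan S" "z' \<in> lspan S"
  shows "z \<oplus> z' \<in> lspan S"
  using z(1)
proof (induction rule: linear_span.induct)
  case linear_span_zero
  then show ?case using z(2) span_closed[OF _ S] by simp
next
  case (linear_span_step c v z)
  then have "c \<odot> v \<oplus> z \<oplus> z' = c \<odot> v \<oplus> (z \<oplus> z')"
    using S span_closed[OF z(2) S] span_closed[OF _ S, of z] by (intro M.a_assoc) auto
  then show ?case using linear_span_step by (auto intro: linear_span.intros)
qed

lemma span_smult:
  assumes S: "S \<subseteq> carrier A" and c: "c \<in> carrier K" and z: "z \<in> lspan S"
  shows "c \<odot> z \<in> lspan S"
  using z
proof (induction rule: linear_span.induct)
  case linear_span_zero
  then show ?case using c by (auto intro: linear_span.intros)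
next
  case (linear_span_step d v z)
  then have "c \<odot> (d \<odot> v \<oplus> z) = (c \<otimes>\<^bsub>K\<^esub> d) \<odot> v \<oplus> c \<odot> z"
    using S c span_closed[OF _ S, of z] by (auto simp: M.smult_r_distr M.smult_assoc1)
  then show ?case using linear_span_step c by (auto intro: linear_span.intros)
qed

lemma uminus_eq_smult: "a \<in> carrier A \<Longrightarrow> \<ominus> a = (\<ominus>\<^bsub>K\<^esub> \<one>\<^bsub>K\<^esub>) \<odot> a"
  by (simp add: M.smult_l_minus)

lemma span_minus:
  assumes S: "S \<subseteq> carrier A" and z: "z \<in> lspan S" "z' \<in> lspan S"
  shows "z \<ominus> z' \<in> lspan S"
  unfolding a_minus_def uminus_eq_smult[OF span_closed[OF z(2) S]]
  by (intro span_add span_smult S z) simp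

lemma span_incl: "S \<subseteq> carrier A \<Longrightarrow> v \<in> S \<Longrightarrow> v \<in> lspan S"
  using linear_span.linear_span_step[of "\<one>\<^bsub>K\<^esub>" K v S "\<zero>" A] linear_span.linear_span_zero[of A K S]
  by (auto simp: subset_iff)

lemma span_insertE:
  assumes z: "z \<in> lspan (insert v S)" and S: "S \<subseteq> carrier A" and v: "v \<in> carrier A"
  obtains a s where "a \<in> carrier K" "s \<in> lspan S" "z = a \<odot> v \<oplus> s"
proof -
  have "\<exists>a s. a \<in> carrier K \<and> s \<in> lspan S \<and> z = a \<odot> v \<oplus> s"
    using z
  proof (induction rule: linear_span.induct)
    case linear_span_zero
    have "\<zero> = \<zero>\<^bsub>K\<^esub> \<odot> v \<oplus> \<zero>" using v by simp
    then show ?case by (metis K.zero_closed linear_span.linear_span_zero)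
  next
    case (linear_span_step c u z)
    then obtain a s where as: "a \<in> carrier K" "s \<in> lspan S" "z = a \<odot> v \<oplus> s" by blast
    have sc: "s \<in> carrier A" using as(2) S by (rule span_closed)
    show ?case
    proof (cases "u = v")
      case True
      then have "c \<odot> u \<oplus> z = (c \<oplus>\<^bsub>K\<^esub> a) \<odot> v \<oplus> s"
        unfolding as(3) using linear_span_step(1) as sc v by (simp add: M.smult_l_distr M.a_assoc)
      then show ?thesis using as linear_span_step(1) by (metis K.add.m_closed)
    next
      case False
      then have u: "u \<in> S" "u \<in> carrier A" using linear_span_step(2) S by auto
      have "c \<odot> u \<oplus> z = a \<odot> v \<oplus> (c \<odot> u \<oplus> s)"
        unfolding as(3) using linear_span_step(1) as sc v u by (simp add: M.a_lcomm)
      then show ?thesis using as u linear_span_step(1) linear_span.linear_span_step by metis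
    qed
  qed
  then show thesis using that by blast
qed

lemma span_mult:
  assumes S: "S \<subseteq> carrier A" and S': "S' \<subseteq> carrier A" and T: "T \<subseteq> carrier A"
    and ST: "\<And>v v'. \<lbrakk> v \<in> S; v' \<in> S' \<rbrakk> \<Longrightarrow> v \<otimes> v' \<in> lspan T"
    and z: "z \<in> lspan S" and z': "z' \<in> lspan S'"
  shows "z \<otimes> z' \<in> lspan T"
proof -
  note z'c = span_closed[OF z' S']
  have v: "v \<otimes> z' \<in> lspan T" if v: "v \<in> S" for v
    using z'
  proof (induction rule: linear_span.induct)
    case linear_span_zero
    have "v \<otimes> \<zero> = \<zero>" using v S by auto
    then show ?case by (simp add: linear_span.linear_span_zero)
  next
    case (linear_span_step c u z)
    have C: "v \<in> carrier A" "u \<in> carrier A" "z \<in> carrier A" "c \<in> carrier K"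
      using v S S' linear_span_step span_closed[OF _ S'] by auto
    have "v \<otimes> (c \<odot> u \<oplus> z) = c \<odot> (v \<otimes> u) \<oplus> v \<otimes> z" using C by (simp add: alg_simps)
    then show ?case using ST[OF v linear_span_step(2)] linear_span_step C T
      by (auto intro!: span_add span_smult)
  qed
  show ?thesis
    using z
  proof (induction rule: linear_span.induct)
    case linear_span_zero
    then show ?case using z'c by (simp add: linear_span.linear_span_zero)
  next
    case (linear_span_step c u z)
    have C: "u \<in> carrier A" "z \<in> carrier A" "c \<in> carrier K"
      using S linear_span_step span_closed[OF _ S] by auto
    have "(c \<odot> u \<oplus> z) \<otimes> z' = c \<odot> (u \<otimes> z') \<oplus> z \<otimes> z'" using C z'c by (simp add: alg_simps)
    then show ?case using v[OF linear_span_step(2)] linear_span_step C T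
      by (auto intro!: span_add span_smult)
  qed
qed

text \<open>Linearity is asked on a subspace \<open>B\<close> only, because each
  \<open>\<tau>_l\<close> is controlled on a subalgebra and not on all of \<open>A\<close>.\<close>

lemma span_image:
  assumes D: "assoc_algebra K D" and T: "T \<subseteq> carrier D"
    and B: "S \<subseteq> B" "B \<subseteq> carrier A" "\<zero> \<in> B" "\<And>a b. \<lbrakk> a \<in> B; b \<in> B \<rbrakk> \<Longrightarrow> a \<oplus> b \<in> B"
      "\<And>c a. \<lbrakk> c \<in> carrier K; a \<in> B \<rbrakk> \<Longrightarrow> c \<odot> a \<in> B"
    and f_add: "\<And>a b. \<lbrakk> a \<in> B; b \<in> B \<rbrakk> \<Longrightarrow> f (a \<oplus> b) = f a \<oplus>\<^bsub>D\<^esub> f b"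
    and f_smult: "\<And>c a. \<lbrakk> c \<in> carrier K; a \<in> B \<rbrakk> \<Longrightarrow> f (c \<odot> a) = c \<odot>\<^bsub>D\<^esub> f a"
    and fv: "\<And>v. v \<in> S \<Longrightarrow> f v \<in> linear_span K D T" and f0: "f \<zero> \<in> carrier D"
    and z: "z \<in> lspan S"
  shows "z \<in> B \<and> f z \<in> linear_span K D T"
  using z
proof (induction rule: linear_span.induct)
  interpret D: plain_algebra K D by (simp add: plain_algebra_def D)
  case linear_span_zero
  have "f \<zero> = f (\<zero>\<^bsub>K\<^esub> \<odot> \<zero>)" by simp
  also have "\<dots> = \<zero>\<^bsub>D\<^esub>" using B(3) f0 by (subst f_smult) auto
  finally show ?case using B(3) by (auto intro: linear_span.intros)
next
  interpret D: plain_algebra K D by (simp add: plain_algebra_def D)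
  case (linear_span_step c v z)
  then have "f (c \<odot> v \<oplus> z) = c \<odot>\<^bsub>D\<^esub> f v \<oplus>\<^bsub>D\<^esub> f z" using B by (simp add: f_add f_smult subset_iff)
  then show ?case using linear_span_step fv T B by (auto intro!: D.span_add D.span_smult)
qed

lemma linear_operatorD:
  assumes "linear_operator K A f"
  shows "\<And>a. a \<in> carrier A \<Longrightarrow> f a \<in> carrier A"
    "\<And>a b. \<lbrakk> a \<in> carrier A; b \<in> carrier A \<rbrakk> \<Longrightarrow> f (a \<oplus> b) = f a \<oplus> f b"
    "\<And>c a. \<lbrakk> c \<in> carrier K; a \<in> carrier A \<rbrakk> \<Longrightarrow> f (c \<odot> a) = c \<odot> f a"
  using assms unfolding linear_operator_def by auto

lemma linear_operator_minus:
  assumes f: "linear_operator K A f" and "a \<in> carrier A" "b \<in> carrier A"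
  shows "f (a \<ominus> b) = f a \<ominus> f b"
  using linear_operatorD[OF f] assms(2,3) by (simp add: a_minus_def uminus_eq_smult)

lemma span_operator:
  assumes f: "linear_operator K A f" and S: "S \<subseteq> carrier A"
    and fv: "\<And>v. v \<in> S \<Longrightarrow> f v \<in> lspan S" and z: "z \<in> lspan S"
  shows "f z \<in> lspan S"
  using span_image[OF assoc_algebra_axioms S S, of f z] linear_operatorD[OF f] fv z by auto

text \<open>The values \<open>Z - N\<^sub>m Z\<close> form a cocycle of the commuting operators; a joint eigenvector
  that some \<open>N\<^sub>l\<close> does not fix can be removed from all of them at once, since applying
  \<open>1 - N\<^sub>l\<close> to the \<open>m\<close>-th value is the same as applying \<open>1 - N\<^sub>m\<close> to the \<open>l\<close>-th one.\<close>

lemma commuting_operators_coboundary: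
  assumes "finite F" and "F \<subseteq> carrier A"
    and N: "\<And>m. m \<in> I \<Longrightarrow> linear_operator K A (N m)"
    and comm: "\<And>l m a. \<lbrakk> l \<in> I; m \<in> I; a \<in> carrier A \<rbrakk> \<Longrightarrow> N l (N m a) = N m (N l a)"
    and "\<And>v m. \<lbrakk> v \<in> F; m \<in> I \<rbrakk> \<Longrightarrow> \<exists>\<chi>\<in>carrier K. N m v = \<chi> \<odot> v"
    and "\<And>v. v \<in> F \<Longrightarrow> \<exists>m\<in>I. \<exists>\<chi>\<in>carrier K. \<chi> \<noteq> \<one>\<^bsub>K\<^esub> \<and> N m v = \<chi> \<odot> v"
    and "Z \<in> carrier A" and "\<And>m. m \<in> I \<Longrightarrow> Z \<ominus> N m Z \<in> lspan F"
  shows "\<exists>c\<in>lspan F. \<forall>m\<in>I. N m (Z \<ominus> c) = Z \<ominus> c"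
  using assms(1,2,5-)
proof (induction F arbitrary: Z)
  case empty
  have "N m Z = Z" if "m \<in> I" for m
  proof -
    have "Z \<ominus> N m Z = \<zero>" using empty.prems(5)[OF that] by (auto elim: linear_span.cases)
    then show ?thesis using linear_operatorD(1)[OF N[OF that]] empty.prems(4) by simp
  qed
  then show ?case using empty.prems(4)
    by (intro bexI[of _ \<zero>]) (auto intro: linear_span.intros simp: a_minus_def)
next
  case (insert v F)
  note Z = insert.prems(4)
  note Ncl = linear_operatorD(1)[OF N]
  have v: "v \<in> carrier A" and F: "F \<subseteq> carrier A" using insert.prems(1) by auto
  obtain l \<chi> where l: "l \<in> I" and \<chi>: "\<chi> \<in> carrier K" "\<chi> \<noteq> \<one>\<^bsub>K\<^esub>" and Nv: "N l v = \<chi> \<odot> v"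
    using insert.prems(3) by blast
  define \<epsilon> where "\<epsilon> = \<one>\<^bsub>K\<^esub> \<ominus>\<^bsub>K\<^esub> \<chi>"
  have \<epsilon>: "\<epsilon> \<in> carrier K" "\<epsilon> \<noteq> \<zero>\<^bsub>K\<^esub>" unfolding \<epsilon>_def using \<chi> by auto
  have v\<epsilon>: "v \<ominus> N l v = \<epsilon> \<odot> v"
    unfolding Nv \<epsilon>_def a_minus_def using v \<chi> by (simp add: M.smult_l_distr M.smult_l_minus)
  have inv\<epsilon>: "inv\<^bsub>K\<^esub> \<epsilon> \<in> carrier K" using \<epsilon> K.field_Units by auto
  obtain a s where as: "a \<in> carrier K" "s \<in> lspan F" "Z \<ominus> N l Z = a \<odot> v \<oplus> s"
    using insert.prems(5)[OF l] F v by (rule span_insertE)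
  have s: "s \<in> carrier A" using as(2) F by (rule span_closed)
  \<comment> \<open>Chosen so that \<open>b (v - N_l v)\<close> equals \<open>a v\<close>; passing
    from \<open>Z\<close> to \<open>Y = Z - b v\<close> then removes the \<open>v\<close>-term from
    the \<open>l\<close>-th value.\<close>
  define b where "b = a \<otimes>\<^bsub>K\<^esub> inv\<^bsub>K\<^esub> \<epsilon>"
  have b: "b \<in> carrier K" unfolding b_def using as inv\<epsilon> by simp
  have b\<epsilon>: "b \<odot> (\<epsilon> \<odot> v) = a \<odot> v"
    unfolding b_def using as(1) inv\<epsilon> \<epsilon> v nonzero_smult_cancel[of \<epsilon> v] by (simp add: M.smult_assoc1)
  define Y where "Y = Z \<ominus> b \<odot> v"
  have Y: "Y \<in> carrier A" unfolding Y_def using Z b v by simp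
  have diff: "Y \<ominus> N m Y = (Z \<ominus> N m Z) \<ominus> b \<odot> (v \<ominus> N m v)" if m: "m \<in> I" for m
  proof -
    have NX: "N m Z \<in> carrier A" and NV: "N m v \<in> carrier A" using Ncl[OF m] Z v by auto
    have "N m Y = N m Z \<ominus> b \<odot> N m v"
      unfolding Y_def using linear_operator_minus[OF N[OF m]] linear_operatorD(3)[OF N[OF m]] Z b v by simp
    then have "Y \<ominus> N m Y = (Z \<ominus> b \<odot> v) \<ominus> (N m Z \<ominus> b \<odot> N m v)" unfolding Y_def by simp
    also have "\<dots> = (Z \<ominus> N m Z) \<ominus> (b \<odot> v \<ominus> b \<odot> N m v)"
      using Z NX M.smult_closed[OF b v] M.smult_closed[OF b NV] by algebra
    finally show ?thesis using smult_minus[OF b v NV] by simp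
  qed
  have Yl: "Y \<ominus> N l Y = s"
  proof -
    have "Y \<ominus> N l Y = (a \<odot> v \<oplus> s) \<ominus> a \<odot> v" unfolding diff[OF l] as(3) v\<epsilon> b\<epsilon> ..
    also have "\<dots> = s" using M.smult_closed[OF as(1) v] s by algebra
    finally show ?thesis .
  qed
  have FN: "N m z \<in> lspan F" if "m \<in> I" "z \<in> lspan F" for m z
  proof (rule span_operator[OF N[OF that(1)] F _ that(2)])
    fix u assume u: "u \<in> F"
    then obtain \<chi> where "\<chi> \<in> carrier K" "N m u = \<chi> \<odot> u" using insert.prems(2) \<open>m \<in> I\<close> by blast
    then show "N m u \<in> lspan F" using span_smult[OF F] span_incl[OF F u] by simp
  qed
  \<comment> \<open>The same \<open>b\<close> works for every \<open>m\<close>. For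
    \<open>g = Y - N_m Y = a' v + s'\<close> commutation gives \<open>g - N_l g = s - N_m s\<close>,
    which lies in the span of \<open>F\<close>, while \<open>g - N_l g\<close> is
    \<open>\<epsilon> a' v\<close> up to that span. As \<open>v\<close> may depend linearly on
    \<open>F\<close>, the conclusion is that \<open>a' v\<close> lies in the span, not that
    \<open>a'\<close> vanishes.\<close>
  have YF: "Y \<ominus> N m Y \<in> lspan F" if m: "m \<in> I" for m
  proof -
    define g where "g = Y \<ominus> N m Y"
    have NY: "N m Y \<in> carrier A" "N l Y \<in> carrier A" "N l (N m Y) \<in> carrier A"
      using Ncl m l Y by auto
    have g: "g \<in> carrier A" unfolding g_def using Y NY by simp
    obtain \<mu> where \<mu>: "\<mu> \<in> carrier K" "N m v = \<mu> \<odot> v" using insert.prems(2) m by blast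
    have vF: "v \<in> lspan (insert v F)" by (rule span_incl[OF insert.prems(1)]) simp
    have "g \<in> lspan (insert v F)"
      unfolding g_def diff[OF m] \<mu>(2)
      by (intro span_minus span_smult insert.prems(1) insert.prems(5)[OF m] b vF \<mu>(1))
    then obtain a' s' where as': "a' \<in> carrier K" "s' \<in> lspan F" "g = a' \<odot> v \<oplus> s'"
      using F v by (rule span_insertE)
    have s': "s' \<in> carrier A" "N l s' \<in> carrier A"
      using span_closed[OF as'(2) F] Ncl[OF l] by auto
    have Ng: "N l g = a' \<odot> N l v \<oplus> N l s'"
      unfolding as'(3) using linear_operatorD(2,3)[OF N[OF l]] as'(1) v s' by simp
    have "g \<ominus> N l g = a' \<odot> v \<oplus> s' \<ominus> (a' \<odot> N l v \<oplus> N l s')"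
      by (simp only: Ng) (simp only: as'(3))
    also have "\<dots> = (a' \<odot> v \<ominus> a' \<odot> N l v) \<oplus> (s' \<ominus> N l s')"
      using M.smult_closed[OF as'(1) v] M.smult_closed[OF as'(1) Ncl[OF l v]] s' by algebra
    also have "a' \<odot> v \<ominus> a' \<odot> N l v = \<epsilon> \<odot> (a' \<odot> v)"
      unfolding smult_minus[OF as'(1) v Ncl[OF l v], symmetric] v\<epsilon>
      using as'(1) \<epsilon> v by (simp add: K.m_comm flip: M.smult_assoc1)
    finally have 1: "g \<ominus> N l g = \<epsilon> \<odot> (a' \<odot> v) \<oplus> (s' \<ominus> N l s')" .
    have "N l g = N l Y \<ominus> N l (N m Y)"
      unfolding g_def using linear_operator_minus[OF N[OF l] Y NY(1)] .
    then have "g \<ominus> N l g = (Y \<ominus> N l Y) \<ominus> (N m Y \<ominus> N l (N m Y))"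
      unfolding g_def using Y NY by algebra
    also have "N m Y \<ominus> N l (N m Y) = N m (Y \<ominus> N l Y)"
      unfolding comm[OF l m Y] using linear_operator_minus[OF N[OF m] Y NY(2)] by simp
    also have "(Y \<ominus> N l Y) \<ominus> N m (Y \<ominus> N l Y) \<in> lspan F"
      unfolding Yl by (intro span_minus F as(2) FN m)
    finally have "g \<ominus> N l g \<in> lspan F" .
    moreover have "s' \<ominus> N l s' \<in> lspan F" by (intro span_minus F as'(2) FN l)
    ultimately have "(g \<ominus> N l g) \<ominus> (s' \<ominus> N l s') \<in> lspan F" by (rule span_minus[OF F])
    moreover have "(g \<ominus> N l g) \<ominus> (s' \<ominus> N l s') = \<epsilon> \<odot> (a' \<odot> v)"
      unfolding 1 using M.smult_closed[OF \<epsilon>(1) M.smult_closed[OF as'(1) v]] s' by algebra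
    ultimately have "inv\<^bsub>K\<^esub> \<epsilon> \<odot> (\<epsilon> \<odot> (a' \<odot> v)) \<in> lspan F" using span_smult[OF F inv\<epsilon>] by simp
    then have "a' \<odot> v \<in> lspan F" using nonzero_smult_cancel[OF \<epsilon>] as' v by simp
    then show ?thesis unfolding g_def[symmetric] as'(3) using span_add[OF F] as' by blast
  qed
  obtain c where c: "c \<in> lspan F" "\<forall>m\<in>I. N m (Y \<ominus> c) = Y \<ominus> c"
    using insert.IH[OF F _ _ Y YF] insert.prems(2,3) by blast
  have cc: "c \<in> carrier A" using c(1) F by (rule span_closed)
  have "Y \<ominus> c = Z \<ominus> (b \<odot> v \<oplus> c)"
    unfolding Y_def using Z M.smult_closed[OF b v] cc by algebra
  moreover have "b \<odot> v \<oplus> c \<in> lspan (insert v F)"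
    using b linear_span_mono[OF c(1), of "insert v F"] by (auto intro: linear_span.intros)
  ultimately show ?case using c(2) by metis
qed

text \<open>The unwanted eigenvectors in \<open>F\<close> are removed one by one: if
  \<open>T l v = \<omega> v\<close> with \<open>\<omega> \<noteq> w l\<close>, then
  \<open>T l - \<omega>\<close> kills \<open>v\<close> but multiplies \<open>r\<close> by the
  nonzero scalar \<open>w l - \<omega>\<close>.\<close>

lemma eigenvector_span_aux:
  assumes "finite F" and G: "G \<subseteq> B" and "F \<subseteq> B"
    and B: "B \<subseteq> carrier A" "\<zero> \<in> B" "\<And>a b. \<lbrakk> a \<in> B; b \<in> B \<rbrakk> \<Longrightarrow> a \<oplus> b \<in> B"
      "\<And>c a. \<lbrakk> c \<in> carrier K; a \<in> B \<rbrakk> \<Longrightarrow> c \<odot> a \<in> B"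
    and T_add: "\<And>l a b. \<lbrakk> l \<in> I; a \<in> B; b \<in> B \<rbrakk> \<Longrightarrow> T l (a \<oplus> b) = T l a \<oplus> T l b"
    and T_smult: "\<And>l c a. \<lbrakk> l \<in> I; c \<in> carrier K; a \<in> B \<rbrakk> \<Longrightarrow> T l (c \<odot> a) = c \<odot> T l a"
    and T_closed: "\<And>l a. \<lbrakk> l \<in> I; a \<in> B \<rbrakk> \<Longrightarrow> T l a \<in> carrier A"
    and eig: "\<And>v l. \<lbrakk> v \<in> G \<union> F; l \<in> I \<rbrakk> \<Longrightarrow> \<exists>\<omega>\<in>carrier K. T l v = \<omega> \<odot> v"
    and bad: "\<And>v. v \<in> F \<Longrightarrow> \<exists>l\<in>I. \<exists>\<omega>\<in>carrier K. \<omega> \<noteq> w l \<and> T l v = \<omega> \<odot> v"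
    and r: "r \<in> lspan (G \<union> F)" and w: "\<And>l. l \<in> I \<Longrightarrow> w l \<in> carrier K \<and> T l r = w l \<odot> r"
  shows "r \<in> lspan G"
  using assms(1,3) eig bad r
proof (induction F)
  case (insert v F)
  have GF: "G \<union> F \<subseteq> B" using G insert.prems(1) by auto
  then have GFc: "G \<union> F \<subseteq> carrier A" using B(1) by auto
  have v: "v \<in> B" "v \<in> carrier A" using insert.prems(1) B(1) by auto
  obtain l \<omega> where l: "l \<in> I" and \<omega>: "\<omega> \<in> carrier K" "\<omega> \<noteq> w l" "T l v = \<omega> \<odot> v"
    using insert.prems(3) by blast
  have "r \<in> lspan (insert v (G \<union> F))" using insert.prems(4) by simp
  then obtain a s where as: "a \<in> carrier K" "s \<in> lspan (G \<union> F)" "r = a \<odot> v \<oplus> s"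
    using GFc v(2) by (rule span_insertE)
  have TS: "s \<in> B \<and> T l s \<in> lspan (G \<union> F)"
  proof (rule span_image[OF assoc_algebra_axioms GFc GF B T_add[OF l] T_smult[OF l] _ T_closed[OF l B(2)] as(2)])
    fix u assume u: "u \<in> G \<union> F"
    then obtain \<mu> where "\<mu> \<in> carrier K" "T l u = \<mu> \<odot> u" using insert.prems(2)[of u l] l by auto
    then show "T l u \<in> lspan (G \<union> F)" using span_smult[OF GFc] span_incl[OF GFc u] by simp
  qed
  have s: "s \<in> carrier A" "T l s \<in> carrier A" using TS B(1) T_closed[OF l] by auto
  have "r \<in> carrier A" unfolding as(3) using as s v by simp
  have rB: "r \<in> B" unfolding as(3) using as TS v B by blast
  have wl: "w l \<in> carrier K" "T l r = w l \<odot> r" using w[OF l] by auto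
  let ?e = "w l \<ominus>\<^bsub>K\<^esub> \<omega>"
  have e: "?e \<in> carrier K" "?e \<noteq> \<zero>\<^bsub>K\<^esub>" using wl \<omega> by auto
  have "?e \<odot> r = T l r \<ominus> \<omega> \<odot> r"
    unfolding wl(2) a_minus_def using wl \<omega> \<open>r \<in> carrier A\<close> by (simp add: M.smult_l_distr M.smult_l_minus)
  also have "T l r = a \<odot> (\<omega> \<odot> v) \<oplus> T l s"
    unfolding as(3) using as TS v B(4) by (simp add: T_add[OF l] T_smult[OF l] \<omega>(3))
  also have "\<omega> \<odot> r = a \<odot> (\<omega> \<odot> v) \<oplus> \<omega> \<odot> s"
    unfolding as(3) using as \<omega> v s by (simp add: M.smult_r_distr K.m_comm flip: M.smult_assoc1)
  also have "a \<odot> (\<omega> \<odot> v) \<oplus> T l s \<ominus> (a \<odot> (\<omega> \<odot> v) \<oplus> \<omega> \<odot> s) = T l s \<ominus> \<omega> \<odot> s"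
    using M.smult_closed[OF as(1) M.smult_closed[OF \<omega>(1) v(2)]] M.smult_closed[OF \<omega>(1) s(1)] s by algebra
  also have "\<dots> \<in> lspan (G \<union> F)" using TS as \<omega> by (intro span_minus span_smult GFc) auto
  finally have er: "?e \<odot> r \<in> lspan (G \<union> F)" .
  have "inv\<^bsub>K\<^esub> ?e \<in> carrier K" using e K.field_Units by auto
  from span_smult[OF GFc this er] have "r \<in> lspan (G \<union> F)" using nonzero_smult_cancel[OF e] \<open>r \<in> carrier A\<close> by simp
  then show ?case using insert by auto
qed simp

text \<open>For \<open>S\<close> the monomials in \<open>x_1, ..., x_(i-1)\<close> and
  \<open>T\<close> the automorphisms \<open>\<tau>_l\<close> with \<open>l \<ge> i\<close>, this
  says that an element of weight \<open>w\<close> can be written with monomials of weight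
  \<open>w\<close> alone.\<close>

lemma eigenvector_span:
  assumes S: "S \<subseteq> B" and G: "G \<subseteq> S"
    and B: "B \<subseteq> carrier A" "\<zero> \<in> B" "\<And>a b. \<lbrakk> a \<in> B; b \<in> B \<rbrakk> \<Longrightarrow> a \<oplus> b \<in> B"
      "\<And>c a. \<lbrakk> c \<in> carrier K; a \<in> B \<rbrakk> \<Longrightarrow> c \<odot> a \<in> B"
    and T: "\<And>l a b. \<lbrakk> l \<in> I; a \<in> B; b \<in> B \<rbrakk> \<Longrightarrow> T l (a \<oplus> b) = T l a \<oplus> T l b"
      "\<And>l c a. \<lbrakk> l \<in> I; c \<in> carrier K; a \<in> B \<rbrakk> \<Longrightarrow> T l (c \<odot> a) = c \<odot> T l a"
      "\<And>l a. \<lbrakk> l \<in> I; a \<in> B \<rbrakk> \<Longrightarrow> T l a \<in> carrier A"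
    and eig: "\<And>v l. \<lbrakk> v \<in> S; l \<in> I \<rbrakk> \<Longrightarrow> \<exists>\<omega>\<in>carrier K. T l v = \<omega> \<odot> v"
    and bad: "\<And>v. v \<in> S - G \<Longrightarrow> \<exists>l\<in>I. \<exists>\<omega>\<in>carrier K. \<omega> \<noteq> w l \<and> T l v = \<omega> \<odot> v"
    and r: "r \<in> lspan S" and w: "\<And>l. l \<in> I \<Longrightarrow> w l \<in> carrier K \<and> T l r = w l \<odot> r"
  shows "r \<in> lspan G"
proof -
  obtain F where F: "finite F" "F \<subseteq> S" "r \<in> lspan F" using linear_span_finite[OF r] by blast
  then have "r \<in> lspan (G \<union> (F - G))" by (auto intro: linear_span_mono)
  then show ?thesis
    using F S G by (intro eigenvector_span_aux[OF _ _ _ B T eig bad _ w, of "F - G" G]) auto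
qed

end

section \<open>Laurent polynomials in quantum-commuting elements\<close>

locale quantum_weights = plain_algebra K D for K :: "('k, 'c) ring_scheme"
    and D :: "('k, 'd, 'e) module_scheme" (structure) +
  fixes n :: nat and \<Lambda> :: "nat \<Rightarrow> nat \<Rightarrow> 'k" and q :: "nat \<Rightarrow> 'k"
  assumes D_Units: "Units D = carrier D - {\<zero>}"
    and \<Lambda>: "\<And>i j. \<lbrakk> 1 \<le> i; i \<le> n; 1 \<le> j; j \<le> n \<rbrakk> \<Longrightarrow> \<Lambda> i j \<in> carrier K - {\<zero>\<^bsub>K\<^esub>}"
    and q: "\<And>i. \<lbrakk> 1 \<le> i; i \<le> n \<rbrakk> \<Longrightarrow> q i \<in> carrier K - {\<zero>\<^bsub>K\<^esub>} \<and> q i \<noteq> \<one>\<^bsub>K\<^esub>"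
begin

text \<open>\<open>wt m l\<close> is the eigenvalue of \<open>\<tau>\<^sub>l\<close> at \<open>x\<^sub>m\<close>. The automorphism \<open>\<tau>\<^sub>m\<close> extends from the subalgebra
  generated by \<open>x\<^sub>1, \<dots>, x\<^sub>m\<^sub>-\<^sub>1\<close> to \<open>x\<^sub>m\<close> with eigenvalue \<open>q\<^sub>m\<^sup>-\<^sup>1\<close>, because \<open>\<delta>\<^sub>m \<tau>\<^sub>m = q\<^sub>m \<tau>\<^sub>m \<delta>\<^sub>m\<close>.\<close>

definition wt :: "nat \<Rightarrow> nat \<Rightarrow> 'k" where
  "wt m l = (if 1 \<le> m \<and> m < l \<and> l \<le> n then \<Lambda> l m
             else if 1 \<le> m \<and> m = l \<and> l \<le> n then inv\<^bsub>K\<^esub> (q m) else \<one>\<^bsub>K\<^esub>)"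

lemma K_inv_nonzero: "c \<in> carrier K - {\<zero>\<^bsub>K\<^esub>} \<Longrightarrow> inv\<^bsub>K\<^esub> c \<in> carrier K - {\<zero>\<^bsub>K\<^esub>}"
  using K.Units_inv_Units[of c] unfolding K.field_Units .

lemma K_mult_nonzero:
  "\<lbrakk> c \<in> carrier K - {\<zero>\<^bsub>K\<^esub>}; d \<in> carrier K - {\<zero>\<^bsub>K\<^esub>} \<rbrakk> \<Longrightarrow> c \<otimes>\<^bsub>K\<^esub> d \<in> carrier K - {\<zero>\<^bsub>K\<^esub>}"
  using K.Units_m_closed[of c d] unfolding K.field_Units .

lemma K_inv [simp]:
  "c \<in> carrier K - {\<zero>\<^bsub>K\<^esub>} \<Longrightarrow> c \<otimes>\<^bsub>K\<^esub> inv\<^bsub>K\<^esub> c = \<one>\<^bsub>K\<^esub>"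
  "c \<in> carrier K - {\<zero>\<^bsub>K\<^esub>} \<Longrightarrow> inv\<^bsub>K\<^esub> c \<otimes>\<^bsub>K\<^esub> c = \<one>\<^bsub>K\<^esub>"
  using K.Units_r_inv[of c] K.Units_l_inv[of c] unfolding K.field_Units by simp_all

lemma wt_nonzero: "wt m l \<in> carrier K - {\<zero>\<^bsub>K\<^esub>}"
  unfolding wt_def using \<Lambda> q K_inv_nonzero by auto

lemma wt_closed [simp]: "wt m l \<in> carrier K" "inv\<^bsub>K\<^esub> wt m l \<in> carrier K"
  using wt_nonzero[of m l] K_inv_nonzero[OF wt_nonzero[of m l]] by auto

lemma smult_eq_zero: "\<lbrakk> c \<in> carrier K; a \<in> carrier D; c \<odot> a = \<zero> \<rbrakk> \<Longrightarrow> c = \<zero>\<^bsub>K\<^esub> \<or> a = \<zero>"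
  using nonzero_smult_cancel[of c a] K_inv_nonzero[of c] by auto

lemma D_mult_eq_zero:
  assumes "a \<in> carrier D" "b \<in> carrier D" "a \<otimes> b = \<zero>"
  shows "a = \<zero> \<or> b = \<zero>"
proof (rule disjCI)
  assume "b \<noteq> \<zero>"
  then have "b \<in> Units D" using assms D_Units by auto
  then have "a = a \<otimes> b \<otimes> inv b" using assms(1,2) by (simp add: A.m_assoc)
  then show "a = \<zero>" unfolding assms(3) using \<open>b \<in> Units D\<close> by simp
qed

lemma quasi_commute_inv:
  assumes a: "a \<in> carrier D" and b: "b \<in> Units D" and c: "c \<in> carrier K - {\<zero>\<^bsub>K\<^esub>}"
    and eq: "a \<otimes> b = c \<odot> (b \<otimes> a)"
  shows "a \<otimes> inv b = inv\<^bsub>K\<^esub> c \<odot> (inv b \<otimes> a)"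
proof -
  have b': "b \<in> carrier D" "inv b \<in> carrier D" using b by auto
  have c': "c \<in> carrier K" "inv\<^bsub>K\<^esub> c \<in> carrier K" using c K_inv_nonzero by auto
  have "inv b \<otimes> a = inv b \<otimes> (a \<otimes> b) \<otimes> inv b" using a b b' by (simp add: A.m_assoc)
  also have "\<dots> = c \<odot> ((inv b \<otimes> b) \<otimes> (a \<otimes> inv b))"
    unfolding eq using a b' c' by (simp add: alg_simps)
  also have "\<dots> = c \<odot> (a \<otimes> inv b)" using a b b' by simp
  finally show ?thesis using nonzero_smult_cancel[of c "a \<otimes> inv b"] c a b' by simp
qed

text \<open>Laurent monomials \<open>v\<close> in the nonzero ones among \<open>y\<^sub>1, \<dots>, y\<^sub>i\<^sub>-\<^sub>1\<close>, with their weight \<open>w\<close>. Only the values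
  \<open>w l\<close> for \<open>i \<le> l \<le> n\<close> are meaningful.\<close>

inductive lmon :: "(nat \<Rightarrow> 'd) \<Rightarrow> nat \<Rightarrow> 'd \<Rightarrow> (nat \<Rightarrow> 'k) \<Rightarrow> bool" for y i where
  lmon_one: "lmon y i \<one> (\<lambda>_. \<one>\<^bsub>K\<^esub>)"
| lmon_mult: "\<lbrakk> lmon y i v w; 1 \<le> m; m < i; y m \<noteq> \<zero> \<rbrakk>
    \<Longrightarrow> lmon y i (v \<otimes> y m) (\<lambda>l. w l \<otimes>\<^bsub>K\<^esub> wt m l)"
| lmon_inv: "\<lbrakk> lmon y i v w; 1 \<le> m; m < i; y m \<noteq> \<zero> \<rbrakk>
    \<Longrightarrow> lmon y i (v \<otimes> inv (y m)) (\<lambda>l. w l \<otimes>\<^bsub>K\<^esub> inv\<^bsub>K\<^esub> wt m l)"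

text \<open>Weights are compared only at the indices \<open>l \<ge> i\<close>, those for which
  \<open>\<tau>_l\<close> is defined on all of \<open>x_1, ..., x_(i-1)\<close>. The same element of
  \<open>D\<close> may arise with several weights, so the spans \<open>H\<close> need not be the
  components of a grading.\<close>

definition lmset where "lmset y i w = {v. \<exists>w'. lmon y i v w' \<and> (\<forall>l\<in>{i..n}. w' l = w l)}"

abbreviation "H y i w \<equiv> lspan (lmset y i w)"

lemma lmon_mono: "lmon y i v w \<Longrightarrow> i \<le> j \<Longrightarrow> lmon y j v w"
  by (induction rule: lmon.induct) (auto intro: lmon.intros)

lemma lmon_cong:
  assumes v: "lmon y i v w" and y': "\<And>m. \<lbrakk> 1 \<le> m; m < i \<rbrakk> \<Longrightarrow> y' m = y m"
  shows "lmon y' i v w"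
  using v
proof (induction rule: lmon.induct)
  case lmon_one
  show ?case by (rule lmon.lmon_one)
next
  case (lmon_mult v w m)
  then show ?case using lmon.lmon_mult[of y' i v w m] y' by simp
next
  case (lmon_inv v w m)
  then show ?case using lmon.lmon_inv[of y' i v w m] y' by simp
qed

lemma H_weight_cong: "(\<And>l. \<lbrakk> i \<le> l; l \<le> n \<rbrakk> \<Longrightarrow> w l = w' l) \<Longrightarrow> H y i w = H y i w'"
  by (rule arg_cong[where f = lspan]) (auto simp: lmset_def)

lemma H_mono: "i \<le> j \<Longrightarrow> z \<in> H y i w \<Longrightarrow> z \<in> H y j w"
proof (erule linear_span_mono)
  assume "i \<le> j"
  then show "lmset y i w \<subseteq> lmset y j w"
    unfolding lmset_def using lmon_mono[of y i _ _ j] by fastforce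
qed

lemma H_cong: "(\<And>m. \<lbrakk> 1 \<le> m; m < i \<rbrakk> \<Longrightarrow> y' m = y m) \<Longrightarrow> z \<in> H y i w \<Longrightarrow> z \<in> H y' i w"
proof (erule linear_span_mono)
  assume "\<And>m. \<lbrakk> 1 \<le> m; m < i \<rbrakk> \<Longrightarrow> y' m = y m"
  then show "lmset y i w \<subseteq> lmset y' i w"
    unfolding lmset_def using lmon_cong[of y i _ _ y'] by fastforce
qed

end

section \<open>Products and commutation of Laurent monomials\<close>

locale quantum_system = quantum_weights K D n \<Lambda> q
  for K :: "('k, 'c) ring_scheme" and D :: "('k, 'd, 'e) module_scheme" (structure)
    and n :: nat and \<Lambda> :: "nat \<Rightarrow> nat \<Rightarrow> 'k" and q :: "nat \<Rightarrow> 'k" +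
  fixes y :: "nat \<Rightarrow> 'd" and i :: nat
  assumes i_le: "i \<le> Suc n"
    and y_closed: "\<And>m. \<lbrakk> 1 \<le> m; m < i \<rbrakk> \<Longrightarrow> y m \<in> carrier D"
    and y_comm: "\<And>p m. \<lbrakk> 1 \<le> p; p < i; 1 \<le> m; m < i \<rbrakk> \<Longrightarrow> y m \<otimes> y p = \<Lambda> m p \<odot> (y p \<otimes> y m)"
begin

lemma y_Units: "\<lbrakk> 1 \<le> m; m < i; y m \<noteq> \<zero> \<rbrakk> \<Longrightarrow> y m \<in> Units D"
  unfolding D_Units using y_closed by auto

lemma lmon_Units: "lmon y i v w \<Longrightarrow> v \<in> Units D"
  by (induction rule: lmon.induct) (use y_Units in \<open>auto intro!: A.Units_m_closed\<close>)

lemma lmon_closed: "lmon y i v w \<Longrightarrow> v \<in> carrier D"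
  using lmon_Units by auto

lemma lmon_weight: "lmon y i v w \<Longrightarrow> w l \<in> carrier K - {\<zero>\<^bsub>K\<^esub>}"
proof (induction rule: lmon.induct)
  case (lmon_mult v w m)
  then show ?case using K_mult_nonzero wt_nonzero by blast
next
  case (lmon_inv v w m)
  then show ?case using K_mult_nonzero wt_nonzero K_inv_nonzero by blast
qed simp

lemma lmset_closed: "lmset y i w \<subseteq> carrier D"
  unfolding lmset_def using lmon_closed by auto

lemma H_closed: "z \<in> H y i w \<Longrightarrow> z \<in> carrier D"
  by (rule span_closed[OF _ lmset_closed])

lemma H_lmon: "lmon y i v w \<Longrightarrow> v \<in> H y i w"
  by (rule span_incl[OF lmset_closed]) (auto simp: lmset_def)

lemma lmon_mult_lmon:
  assumes v: "lmon y i v w" and v': "lmon y i v' w'"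
  shows "lmon y i (v \<otimes> v') (\<lambda>l. w l \<otimes>\<^bsub>K\<^esub> w' l)"
  using v'
proof (induction rule: lmon.induct)
  case lmon_one
  have "(\<lambda>l. w l \<otimes>\<^bsub>K\<^esub> \<one>\<^bsub>K\<^esub>) = w" using lmon_weight[OF v] by (simp add: fun_eq_iff)
  then show ?case using v lmon_closed[OF v] by simp
next
  case (lmon_mult v' w' m)
  have "v \<otimes> (v' \<otimes> y m) = v \<otimes> v' \<otimes> y m"
    using lmon_closed[OF v] lmon_closed[OF lmon_mult(1)] y_closed lmon_mult by (simp add: A.m_assoc)
  moreover have "(\<lambda>l. w l \<otimes>\<^bsub>K\<^esub> (w' l \<otimes>\<^bsub>K\<^esub> wt m l)) = (\<lambda>l. w l \<otimes>\<^bsub>K\<^esub> w' l \<otimes>\<^bsub>K\<^esub> wt m l)"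
    using lmon_weight[OF v] lmon_weight[OF lmon_mult(1)] by (simp add: fun_eq_iff K.m_assoc)
  ultimately show ?case using lmon.lmon_mult lmon_mult by simp
next
  case (lmon_inv v' w' m)
  have "v \<otimes> (v' \<otimes> inv (y m)) = v \<otimes> v' \<otimes> inv (y m)"
    using lmon_closed[OF v] lmon_closed[OF lmon_inv(1)] y_Units lmon_inv by (simp add: A.m_assoc)
  moreover have "(\<lambda>l. w l \<otimes>\<^bsub>K\<^esub> (w' l \<otimes>\<^bsub>K\<^esub> inv\<^bsub>K\<^esub> wt m l)) = (\<lambda>l. w l \<otimes>\<^bsub>K\<^esub> w' l \<otimes>\<^bsub>K\<^esub> inv\<^bsub>K\<^esub> wt m l)"
    using lmon_weight[OF v] lmon_weight[OF lmon_inv(1)] by (simp add: fun_eq_iff K.m_assoc)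
  ultimately show ?case using lmon.lmon_inv lmon_inv by simp
qed

lemma H_mult:
  assumes z: "z \<in> H y i w" "z' \<in> H y i w'"
  shows "z \<otimes> z' \<in> H y i (\<lambda>l. w l \<otimes>\<^bsub>K\<^esub> w' l)"
proof (rule span_mult[OF lmset_closed lmset_closed lmset_closed _ z])
  fix v v' assume "v \<in> lmset y i w" "v' \<in> lmset y i w'"
  then have "v \<otimes> v' \<in> lmset y i (\<lambda>l. w l \<otimes>\<^bsub>K\<^esub> w' l)"
    unfolding lmset_def using lmon_mult_lmon by fastforce
  then show "v \<otimes> v' \<in> H y i (\<lambda>l. w l \<otimes>\<^bsub>K\<^esub> w' l)" by (rule span_incl[OF lmset_closed])
qed

lemma H_one: "\<one> \<in> H y i (\<lambda>_. \<one>\<^bsub>K\<^esub>)"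
  by (rule H_lmon) (rule lmon_one)

lemma H_y: "\<lbrakk> 1 \<le> m; m < i \<rbrakk> \<Longrightarrow> y m \<in> H y i (wt m)"
proof (cases "y m = \<zero>")
  case True
  then show ?thesis by (simp add: linear_span_zero)
next
  case False
  assume "1 \<le> m" "m < i"
  then show ?thesis
    using H_lmon[OF lmon_mult[of y i \<one> "\<lambda>_. \<one>\<^bsub>K\<^esub>" m, OF lmon_one _ _ False]] y_closed by simp
qed

lemma H_inv_y: "\<lbrakk> 1 \<le> m; m < i; y m \<noteq> \<zero> \<rbrakk> \<Longrightarrow> inv (y m) \<in> H y i (\<lambda>l. inv\<^bsub>K\<^esub> wt m l)"
  using H_lmon[OF lmon_inv[of y i \<one> "\<lambda>_. \<one>\<^bsub>K\<^esub>" m, OF lmon_one]] y_Units by simp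

text \<open>Only the existence of the scalar matters: it makes every Laurent monomial an eigenvector
  of conjugation by \<open>y_m\<close>.\<close>

lemma lmon_quasi_commute:
  assumes v: "lmon y i v w" and m: "1 \<le> m" "m < i"
  shows "\<exists>\<kappa>\<in>carrier K - {\<zero>\<^bsub>K\<^esub>}. y m \<otimes> v = \<kappa> \<odot> (v \<otimes> y m)"
  using v
proof (induction rule: lmon.induct)
  case lmon_one
  then show ?case using y_closed[OF m] by (intro bexI[of _ "\<one>\<^bsub>K\<^esub>"]) auto
next
  case (lmon_mult v w p)
  obtain \<kappa> where \<kappa>: "\<kappa> \<in> carrier K - {\<zero>\<^bsub>K\<^esub>}" "y m \<otimes> v = \<kappa> \<odot> (v \<otimes> y m)" using lmon_mult by blast
  have L: "\<Lambda> m p \<in> carrier K - {\<zero>\<^bsub>K\<^esub>}" using \<Lambda> lmon_mult m i_le by auto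
  have C: "v \<in> carrier D" "y m \<in> carrier D" "y p \<in> carrier D" "\<kappa> \<in> carrier K" "\<Lambda> m p \<in> carrier K"
    using lmon_mult lmon_closed y_closed m \<kappa> L by auto
  have "y m \<otimes> (v \<otimes> y p) = (y m \<otimes> v) \<otimes> y p" using C by (simp add: A.m_assoc)
  also have "\<dots> = \<kappa> \<odot> (v \<otimes> (y m \<otimes> y p))" unfolding \<kappa>(2) using C by (simp add: alg_simps)
  also have "\<dots> = (\<kappa> \<otimes>\<^bsub>K\<^esub> \<Lambda> m p) \<odot> (v \<otimes> y p \<otimes> y m)"
    unfolding y_comm[OF lmon_mult(2,3) m] using C by (simp add: alg_simps)
  finally show ?case using K_mult_nonzero[OF \<kappa>(1) L] by blast
next
  case (lmon_inv v w p)
  obtain \<kappa> where \<kappa>: "\<kappa> \<in> carrier K - {\<zero>\<^bsub>K\<^esub>}" "y m \<otimes> v = \<kappa> \<odot> (v \<otimes> y m)" using lmon_inv by blast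
  have L: "\<Lambda> m p \<in> carrier K - {\<zero>\<^bsub>K\<^esub>}" using \<Lambda> lmon_inv m i_le by auto
  have L': "inv\<^bsub>K\<^esub> \<Lambda> m p \<in> carrier K - {\<zero>\<^bsub>K\<^esub>}" using L by (rule K_inv_nonzero)
  have U: "y p \<in> Units D" using y_Units lmon_inv by simp
  have C: "v \<in> carrier D" "y m \<in> carrier D" "inv (y p) \<in> carrier D" "\<kappa> \<in> carrier K"
    "inv\<^bsub>K\<^esub> \<Lambda> m p \<in> carrier K"
    using lmon_inv lmon_closed y_closed m \<kappa> L' U by auto
  have "y m \<otimes> (v \<otimes> inv (y p)) = (y m \<otimes> v) \<otimes> inv (y p)" using C by (simp add: A.m_assoc)
  also have "\<dots> = \<kappa> \<odot> (v \<otimes> (y m \<otimes> inv (y p)))" unfolding \<kappa>(2) using C by (simp add: alg_simps)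
  also have "\<dots> = (\<kappa> \<otimes>\<^bsub>K\<^esub> inv\<^bsub>K\<^esub> \<Lambda> m p) \<odot> (v \<otimes> inv (y p) \<otimes> y m)"
    unfolding quasi_commute_inv[OF C(2) U L y_comm[OF lmon_inv(2,3) m]] using C by (simp add: alg_simps)
  finally show ?case using K_mult_nonzero[OF \<kappa>(1) L'] by blast
qed

text \<open>If \<open>v\<close> commuted past all \<open>y\<^sub>m\<close> as \<open>x\<^sub>i\<close> should, it would do so past itself, hence
  \<open>v\<^sup>2 = q\<^sub>i\<^sup>-\<^sup>1 v\<^sup>2\<close>. This is the only place where \<open>q\<^sub>i \<noteq> 1\<close> matters.\<close>

lemma lmon_not_central:
  assumes i1: "1 \<le> i" "i \<le> n" and v: "lmon y i v w" and wi: "w i = wt i i"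
  shows "\<exists>m. 1 \<le> m \<and> m < i \<and> y m \<noteq> \<zero> \<and> v \<otimes> y m \<noteq> \<Lambda> i m \<odot> (y m \<otimes> v)"
proof (rule ccontr)
  assume "\<not> ?thesis"
  then have c: "\<And>m. \<lbrakk> 1 \<le> m; m < i; y m \<noteq> \<zero> \<rbrakk> \<Longrightarrow> v \<otimes> y m = wt m i \<odot> (y m \<otimes> v)"
    using i1 by (auto simp: wt_def)
  note vc = lmon_closed[OF v]
  \<comment> \<open>Monomials \<open>u\<close> are crossed factor by factor, each factor
    contributing its weight at \<open>i\<close>; the result is then applied to \<open>u = v\<close>,
    whose weight at \<open>i\<close> is the inverse of \<open>q i\<close>.\<close>
  have "v \<otimes> u = w' i \<odot> (u \<otimes> v)" if "lmon y i u w'" for u w'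
    using that
  proof (induction rule: lmon.induct)
    case lmon_one
    then show ?case using vc by simp
  next
    case (lmon_mult u w m)
    have C: "u \<in> carrier D" "y m \<in> carrier D" "w i \<in> carrier K"
      using lmon_closed lmon_weight lmon_mult y_closed by blast+
    have "v \<otimes> (u \<otimes> y m) = (v \<otimes> u) \<otimes> y m" using C vc by (simp add: A.m_assoc)
    also have "\<dots> = w i \<odot> (u \<otimes> (v \<otimes> y m))"
      unfolding lmon_mult(5) using C vc by (simp add: alg_simps)
    also have "\<dots> = (w i \<otimes>\<^bsub>K\<^esub> wt m i) \<odot> (u \<otimes> y m \<otimes> v)"
      unfolding c[OF lmon_mult(2-4)] using C vc by (simp add: alg_simps)
    finally show ?case .
  next
    case (lmon_inv u w m)
    have U: "y m \<in> Units D" using y_Units lmon_inv by simp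
    have C: "u \<in> carrier D" "inv (y m) \<in> carrier D" "w i \<in> carrier K"
      using lmon_closed lmon_weight lmon_inv U by blast+
    have "v \<otimes> (u \<otimes> inv (y m)) = (v \<otimes> u) \<otimes> inv (y m)" using C vc by (simp add: A.m_assoc)
    also have "\<dots> = w i \<odot> (u \<otimes> (v \<otimes> inv (y m)))"
      unfolding lmon_inv(5) using C vc by (simp add: alg_simps)
    also have "\<dots> = (w i \<otimes>\<^bsub>K\<^esub> inv\<^bsub>K\<^esub> wt m i) \<odot> (u \<otimes> inv (y m) \<otimes> v)"
      unfolding quasi_commute_inv[OF vc U wt_nonzero c[OF lmon_inv(2-4)]] using C vc by (simp add: alg_simps)
    finally show ?case .
  qed
  from this[OF v] have eq: "v \<otimes> v = inv\<^bsub>K\<^esub> (q i) \<odot> (v \<otimes> v)"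
    unfolding wi using i1 by (simp add: wt_def)
  have qi: "q i \<in> carrier K - {\<zero>\<^bsub>K\<^esub>}" "q i \<noteq> \<one>\<^bsub>K\<^esub>" using q i1 by auto
  have vv: "v \<otimes> v \<in> carrier D" "v \<otimes> v \<noteq> \<zero>"
    using vc A.Units_m_closed[OF lmon_Units[OF v] lmon_Units[OF v]] unfolding D_Units by auto
  have "q i \<odot> (v \<otimes> v) = v \<otimes> v"
    using qi K_inv_nonzero[OF qi(1)] vv by (subst eq) (simp flip: M.smult_assoc1)
  then have "(q i \<ominus>\<^bsub>K\<^esub> \<one>\<^bsub>K\<^esub>) \<odot> (v \<otimes> v) = \<zero>"
    using qi vv by (simp add: a_minus_def M.smult_l_distr M.smult_l_minus M.r_neg)
  then have "q i \<ominus>\<^bsub>K\<^esub> \<one>\<^bsub>K\<^esub> = \<zero>\<^bsub>K\<^esub>" using smult_eq_zero[OF _ vv(1)] vv(2) qi by auto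
  then show False using qi by simp
qed

text \<open>In other words, \<open>c\<close> makes \<open>\<delta>\<^sub>i\<close> an inner \<open>\<tau>\<^sub>i\<close>-derivation of the Laurent polynomials in the
  previous \<open>y\<^sub>m\<close>.\<close>

lemma deleting_step:
  assumes i1: "1 \<le> i" "i \<le> n" and Z: "Z \<in> carrier D"
    and ZH: "\<And>m. \<lbrakk> 1 \<le> m; m < i; y m \<noteq> \<zero> \<rbrakk> \<Longrightarrow>
      Z \<otimes> y m \<ominus> \<Lambda> i m \<odot> (y m \<otimes> Z) \<in> H y i (\<lambda>l. wt i l \<otimes>\<^bsub>K\<^esub> wt m l)"
  shows "\<exists>c\<in>H y i (wt i). \<forall>m. 1 \<le> m \<and> m < i \<longrightarrow> (Z \<ominus> c) \<otimes> y m = \<Lambda> i m \<odot> (y m \<otimes> (Z \<ominus> c))"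
proof -
  define I where "I = {m. 1 \<le> m \<and> m < i \<and> y m \<noteq> \<zero>}"
  define N where "N m v = \<Lambda> i m \<odot> (y m \<otimes> v \<otimes> inv (y m))" for m v
  have fI: "finite I" by (rule finite_subset[of _ "{..<i}"]) (auto simp: I_def)
  have L: "\<Lambda> i m \<in> carrier K - {\<zero>\<^bsub>K\<^esub>}" and U: "y m \<in> Units D" if "m \<in> I" for m
    using \<Lambda> y_Units that i1 unfolding I_def by auto
  have C: "\<Lambda> i m \<in> carrier K" "y m \<in> carrier D" "inv (y m) \<in> carrier D" if "m \<in> I" for m
    using L U that by auto
  have N_lin: "linear_operator K D (N m)" if m: "m \<in> I" for m
    unfolding linear_operator_def N_def using C[OF m]
    by (auto simp: alg_simps K.m_comm)
  \<comment> \<open>Interchanging \<open>y_l\<close> and \<open>y_m\<close> costs the scalar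
    \<open>\<Lambda> l m\<close>, and interchanging their inverses costs the inverse scalar; in a
    conjugation the two cancel.\<close>
  have N_comm: "N l (N m a) = N m (N l a)" if l: "l \<in> I" and m: "m \<in> I" and a: "a \<in> carrier D" for l m a
  proof -
    have lm: "1 \<le> l" "l < i" "1 \<le> m" "m < i" using l m unfolding I_def by auto
    have k: "\<Lambda> l m \<in> carrier K - {\<zero>\<^bsub>K\<^esub>}" using \<Lambda> lm i_le by simp
    have k': "\<Lambda> l m \<in> carrier K" "inv\<^bsub>K\<^esub> \<Lambda> l m \<in> carrier K" using k K_inv_nonzero[OF k] by auto
    have "y l \<otimes> inv (y m) = inv\<^bsub>K\<^esub> \<Lambda> l m \<odot> (inv (y m) \<otimes> y l)"
      by (rule quasi_commute_inv[OF C(2)[OF l] U[OF m] k y_comm[OF lm(3,4,1,2)]])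
    then have "inv (y m) \<otimes> y l = \<Lambda> l m \<odot> (y l \<otimes> inv (y m))"
      using k k' C[OF l] C[OF m] by (simp flip: M.smult_assoc1)
    then have inv: "inv (y m) \<otimes> inv (y l) = inv\<^bsub>K\<^esub> \<Lambda> l m \<odot> (inv (y l) \<otimes> inv (y m))"
      using quasi_commute_inv[OF C(3)[OF m] U[OF l] k] by simp
    have "N l (N m a) = (\<Lambda> i l \<otimes>\<^bsub>K\<^esub> \<Lambda> i m) \<odot> ((y l \<otimes> y m) \<otimes> a \<otimes> (inv (y m) \<otimes> inv (y l)))"
      unfolding N_def using C[OF l] C[OF m] a by (simp add: alg_simps)
    also have "(y l \<otimes> y m) \<otimes> a \<otimes> (inv (y m) \<otimes> inv (y l))
        = (\<Lambda> l m \<otimes>\<^bsub>K\<^esub> inv\<^bsub>K\<^esub> \<Lambda> l m) \<odot> ((y m \<otimes> y l) \<otimes> a \<otimes> (inv (y l) \<otimes> inv (y m)))"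
      unfolding inv y_comm[OF lm(3,4,1,2)] using C[OF l] C[OF m] a k' by (simp add: alg_simps K.m_comm)
    also have "(\<Lambda> i l \<otimes>\<^bsub>K\<^esub> \<Lambda> i m) \<odot> \<dots> = N m (N l a)"
      unfolding N_def using C[OF l] C[OF m] a k by (simp add: alg_simps K.m_comm)
    finally show ?thesis .
  qed
  \<comment> \<open>Multiplication by \<open>inv (y m)\<close> from the right turns the given
    commutator into \<open>Z - N m Z\<close> and takes its weight from that of
    \<open>x_i x_m\<close> back to that of \<open>x_i\<close>.\<close>
  have g: "Z \<ominus> N m Z \<in> H y i (wt i)" if m: "m \<in> I" for m
  proof -
    have m': "1 \<le> m" "m < i" "y m \<noteq> \<zero>" using m unfolding I_def by auto
    have "Z \<ominus> N m Z = (Z \<otimes> y m \<ominus> \<Lambda> i m \<odot> (y m \<otimes> Z)) \<otimes> inv (y m)"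
      unfolding N_def a_minus_def using C[OF m] Z U[OF m] by (simp add: alg_simps)
    also have "\<dots> \<in> H y i (\<lambda>l. wt i l \<otimes>\<^bsub>K\<^esub> wt m l \<otimes>\<^bsub>K\<^esub> inv\<^bsub>K\<^esub> wt m l)"
      by (intro H_mult ZH H_inv_y m')
    also have "\<dots> = H y i (wt i)"
      using wt_nonzero by (intro H_weight_cong) (simp add: K.m_assoc)
    finally show ?thesis .
  qed
  have "\<forall>m\<in>I. \<exists>F. finite F \<and> F \<subseteq> lmset y i (wt i) \<and> Z \<ominus> N m Z \<in> lspan F"
    using linear_span_finite[OF g] by simp
  then obtain Fm where Fm: "\<And>m. m \<in> I \<Longrightarrow> finite (Fm m) \<and> Fm m \<subseteq> lmset y i (wt i) \<and> Z \<ominus> N m Z \<in> lspan (Fm m)"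
    by metis
  define F where "F = (\<Union>m\<in>I. Fm m)"
  have F: "finite F" "F \<subseteq> lmset y i (wt i)" unfolding F_def using Fm fI by auto
  have gF: "Z \<ominus> N m Z \<in> lspan F" if "m \<in> I" for m
    using linear_span_mono[of "Z \<ominus> N m Z" K D "Fm m" F] Fm[OF that] that unfolding F_def by blast
  have mon: "\<exists>w. lmon y i v w \<and> w i = wt i i" if "v \<in> F" for v
    using that F(2) i1 unfolding lmset_def by fastforce
  have eig: "\<exists>\<chi>\<in>carrier K. N m v = \<chi> \<odot> v" if v: "v \<in> F" and m: "m \<in> I" for v m
  proof -
    obtain w where w: "lmon y i v w" using mon[OF v] by blast
    have vc: "v \<in> carrier D" using lmon_closed w .
    obtain \<kappa> where \<kappa>: "\<kappa> \<in> carrier K - {\<zero>\<^bsub>K\<^esub>}" "y m \<otimes> v = \<kappa> \<odot> (v \<otimes> y m)"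
      using lmon_quasi_commute[OF w] m unfolding I_def by blast
    have "N m v = (\<Lambda> i m \<otimes>\<^bsub>K\<^esub> \<kappa>) \<odot> v"
      unfolding N_def \<kappa>(2) using \<kappa>(1) C[OF m] U[OF m] vc by (simp add: alg_simps)
    then show ?thesis using C[OF m] \<kappa>(1) by blast
  qed
  have nonfixed: "\<exists>m\<in>I. \<exists>\<chi>\<in>carrier K. \<chi> \<noteq> \<one>\<^bsub>K\<^esub> \<and> N m v = \<chi> \<odot> v" if v: "v \<in> F" for v
  proof -
    obtain w where w: "lmon y i v w" "w i = wt i i" using mon[OF v] by blast
    have vc: "v \<in> carrier D" using lmon_closed w(1) .
    obtain m where m: "m \<in> I" and ne: "v \<otimes> y m \<noteq> \<Lambda> i m \<odot> (y m \<otimes> v)"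
      using lmon_not_central[OF i1 w] unfolding I_def by blast
    have "N m v \<noteq> v"
    proof
      assume "N m v = v"
      then have "v \<otimes> y m = N m v \<otimes> y m" by simp
      also have "\<dots> = \<Lambda> i m \<odot> (y m \<otimes> v)"
        unfolding N_def using C[OF m] U[OF m] vc by (simp add: alg_simps)
      finally show False using ne by simp
    qed
    moreover obtain \<chi> where "\<chi> \<in> carrier K" "N m v = \<chi> \<odot> v" using eig[OF v m] by blast
    ultimately show ?thesis using m vc M.smult_one[OF vc] by metis
  qed
  have Fc: "F \<subseteq> carrier D" using F(2) lmset_closed by blast
  obtain c where c: "c \<in> lspan F" and cfix: "\<forall>m\<in>I. N m (Z \<ominus> c) = Z \<ominus> c"
    using commuting_operators_coboundary[OF F(1) Fc N_lin N_comm eig nonfixed Z gF] by blast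
  have cc: "c \<in> carrier D" using c Fc by (rule span_closed)
  have "(Z \<ominus> c) \<otimes> y m = \<Lambda> i m \<odot> (y m \<otimes> (Z \<ominus> c))" if m: "1 \<le> m" "m < i" for m
  proof (cases "y m = \<zero>")
    case True
    have "\<Lambda> i m \<in> carrier K" using \<Lambda>[of i m] m i1 by simp
    then show ?thesis using True Z cc by simp
  next
    case False
    then have mI: "m \<in> I" using m unfolding I_def by simp
    have "(Z \<ominus> c) \<otimes> y m = N m (Z \<ominus> c) \<otimes> y m" using cfix mI by simp
    also have "\<dots> = \<Lambda> i m \<odot> (y m \<otimes> (Z \<ominus> c) \<otimes> (inv (y m) \<otimes> y m))"
      unfolding N_def using C[OF mI] Z cc
        A.m_assoc[of "y m \<otimes> (Z \<ominus> c)" "inv (y m)" "y m"] by (simp flip: smult_assoc_left)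
    also have "\<dots> = \<Lambda> i m \<odot> (y m \<otimes> (Z \<ominus> c))" using U[OF mI] C[OF mI] Z cc by simp
    finally show ?thesis .
  qed
  moreover have "c \<in> H y i (wt i)" using linear_span_mono[OF c F(2)] .
  ultimately show ?thesis by blast
qed

text \<open>There is no \<open>\<tau>_i\<close> on \<open>D\<close>; on an element recorded with
  weight \<open>w\<close> its place is taken by the scalar \<open>w i\<close>. The condition says
  that the commutator of \<open>Z\<close> with \<open>r\<close>, skewed in this way, has the weight
  of \<open>x_i r\<close>, as \<open>\<delta>_i(r)\<close> would have.\<close>

definition twisted where
  "twisted Z r w \<longleftrightarrow> r \<in> H y i w \<and> w i \<in> carrier K \<and>
     Z \<otimes> r \<ominus> w i \<odot> (r \<otimes> Z) \<in> H y i (\<lambda>l. wt i l \<otimes>\<^bsub>K\<^esub> w l)"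

lemma twisted_zero: "Z \<in> carrier D \<Longrightarrow> w i \<in> carrier K \<Longrightarrow> twisted Z \<zero> w"
  unfolding twisted_def by (auto intro: linear_span_zero simp: a_minus_def)

lemma twisted_add:
  assumes Z: "Z \<in> carrier D" and r: "twisted Z r w" "twisted Z r' w"
  shows "twisted Z (r \<oplus> r') w"
proof -
  have C: "r \<in> carrier D" "r' \<in> carrier D" "w i \<in> carrier K" using r H_closed unfolding twisted_def by auto
  let ?a = "Z \<otimes> r" and ?b = "Z \<otimes> r'" and ?c = "w i \<odot> (r \<otimes> Z)" and ?d = "w i \<odot> (r' \<otimes> Z)"
  have "Z \<otimes> (r \<oplus> r') \<ominus> w i \<odot> ((r \<oplus> r') \<otimes> Z) = (?a \<oplus> ?b) \<ominus> (?c \<oplus> ?d)"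
    using Z C by (simp add: A.l_distr A.r_distr M.smult_r_distr)
  also have "\<dots> = (?a \<ominus> ?c) \<oplus> (?b \<ominus> ?d)"
    using Z C M.smult_closed[of "w i" "r \<otimes> Z"] M.smult_closed[of "w i" "r' \<otimes> Z"]
      A.m_closed[of Z r] A.m_closed[of Z r'] A.m_closed[of r Z] A.m_closed[of r' Z] by algebra
  finally show ?thesis using r span_add[OF lmset_closed] unfolding twisted_def by simp
qed

lemma twisted_smult:
  assumes Z: "Z \<in> carrier D" and r: "twisted Z r w" and c: "c \<in> carrier K"
  shows "twisted Z (c \<odot> r) w"
proof -
  have C: "r \<in> carrier D" "w i \<in> carrier K" using r H_closed unfolding twisted_def by auto
  have "Z \<otimes> (c \<odot> r) \<ominus> w i \<odot> ((c \<odot> r) \<otimes> Z) = c \<odot> (Z \<otimes> r \<ominus> w i \<odot> (r \<otimes> Z))"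
    using Z C c by (simp add: a_minus_def alg_simps K.m_comm)
  then show ?thesis using r c span_smult[OF lmset_closed] unfolding twisted_def by simp
qed

text \<open>The skew Leibniz rule \<open>Z r r' - w w' r r' Z = (Z r - w r Z) r' + w r (Z r' - w' r'
  Z)\<close>, where \<open>w\<close> and \<open>w'\<close> stand for their values at
  \<open>i\<close>.\<close>

lemma twisted_mult:
  assumes Z: "Z \<in> carrier D" and r: "twisted Z r w" "twisted Z r' w'"
    and w: "\<And>l. w l \<in> carrier K" "\<And>l. w' l \<in> carrier K"
  shows "twisted Z (r \<otimes> r') (\<lambda>l. w l \<otimes>\<^bsub>K\<^esub> w' l)"
proof -
  have C: "r \<in> carrier D" "r' \<in> carrier D" using r H_closed unfolding twisted_def by auto
  have rH: "r \<in> H y i w" "r' \<in> H y i w'" using r unfolding twisted_def by auto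
  let ?a = "Z \<otimes> r \<ominus> w i \<odot> (r \<otimes> Z)" and ?b = "Z \<otimes> r' \<ominus> w' i \<odot> (r' \<otimes> Z)"
  have "?a \<otimes> r' \<in> H y i (\<lambda>l. wt i l \<otimes>\<^bsub>K\<^esub> w l \<otimes>\<^bsub>K\<^esub> w' l)"
    using r rH unfolding twisted_def by (intro H_mult) auto
  then have 1: "?a \<otimes> r' \<in> H y i (\<lambda>l. wt i l \<otimes>\<^bsub>K\<^esub> (w l \<otimes>\<^bsub>K\<^esub> w' l))"
    using w by (simp add: K.m_assoc)
  have "r \<otimes> ?b \<in> H y i (\<lambda>l. w l \<otimes>\<^bsub>K\<^esub> (wt i l \<otimes>\<^bsub>K\<^esub> w' l))"
    using r rH unfolding twisted_def by (intro H_mult) auto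
  then have 2: "w i \<odot> (r \<otimes> ?b) \<in> H y i (\<lambda>l. wt i l \<otimes>\<^bsub>K\<^esub> (w l \<otimes>\<^bsub>K\<^esub> w' l))"
    using w by (intro span_smult lmset_closed) (auto simp: K.m_lcomm)
  let ?p = "Z \<otimes> (r \<otimes> r')" and ?m = "w i \<odot> (r \<otimes> (Z \<otimes> r'))"
    and ?q = "(w i \<otimes>\<^bsub>K\<^esub> w' i) \<odot> (r \<otimes> (r' \<otimes> Z))"
  have m: "?p \<in> carrier D" "?m \<in> carrier D" "?q \<in> carrier D" using C Z w by auto
  have "?a \<otimes> r' = ?p \<ominus> ?m" using C Z w by (simp add: a_minus_def alg_simps)
  moreover have "w i \<odot> (r \<otimes> ?b) = ?m \<ominus> ?q" using C Z w by (simp add: a_minus_def alg_simps)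
  ultimately have "?a \<otimes> r' \<oplus> w i \<odot> (r \<otimes> ?b) = ?p \<ominus> ?q" using m by algebra
  moreover have "?q = (w i \<otimes>\<^bsub>K\<^esub> w' i) \<odot> (r \<otimes> r' \<otimes> Z)" using C Z by (simp add: A.m_assoc)
  ultimately show ?thesis
    using span_add[OF lmset_closed 1 2] H_mult[OF rH] w unfolding twisted_def by simp
qed

text \<open>Multiplying the commutator of \<open>y_m\<close> by \<open>inv (y m)\<close> from both
  sides gives the commutator of the inverse up to a nonzero scalar. On the way the weight loses that
  of \<open>y_m\<close> twice, which leaves the weight of \<open>x_i\<close> minus that of
  \<open>y_m\<close> in additive notation.\<close>

lemma twisted_inv:
  assumes Z: "Z \<in> carrier D" and m: "1 \<le> m" "m < i" "y m \<noteq> \<zero>" and r: "twisted Z (y m) (wt m)"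
  shows "twisted Z (inv (y m)) (\<lambda>l. inv\<^bsub>K\<^esub> wt m l)"
proof -
  let ?u = "inv (y m)" and ?k = "inv\<^bsub>K\<^esub> wt m i"
  have U: "y m \<in> Units D" using y_Units m by simp
  have C: "y m \<in> carrier D" "?u \<in> carrier D" using U by auto
  let ?a = "Z \<otimes> y m \<ominus> wt m i \<odot> (y m \<otimes> Z)"
  have kk: "?k \<otimes>\<^bsub>K\<^esub> wt m i = \<one>\<^bsub>K\<^esub>" using wt_nonzero by simp
  have "?u \<otimes> ?a \<otimes> ?u = ?u \<otimes> Z \<otimes> (y m \<otimes> ?u) \<ominus> wt m i \<odot> ((?u \<otimes> y m) \<otimes> Z \<otimes> ?u)"
    using C Z by (simp add: a_minus_def alg_simps del: A.Units_r_inv A.Units_l_inv)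
  also have "\<dots> = ?u \<otimes> Z \<ominus> wt m i \<odot> (Z \<otimes> ?u)" using C Z U by simp
  finally have e: "?u \<otimes> ?a \<otimes> ?u = ?u \<otimes> Z \<ominus> wt m i \<odot> (Z \<otimes> ?u)" .
  have "(\<ominus>\<^bsub>K\<^esub> ?k) \<odot> (?u \<otimes> ?a \<otimes> ?u) = (?k \<otimes>\<^bsub>K\<^esub> wt m i) \<odot> (Z \<otimes> ?u) \<ominus> ?k \<odot> (?u \<otimes> Z)"
    unfolding e using C Z
    by (simp add: a_minus_def alg_simps M.smult_l_minus M.a_comm M.minus_add K.l_minus)
  then have "(\<ominus>\<^bsub>K\<^esub> ?k) \<odot> (?u \<otimes> ?a \<otimes> ?u) = Z \<otimes> ?u \<ominus> ?k \<odot> (?u \<otimes> Z)"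
    unfolding kk using C Z by simp
  moreover have "?u \<otimes> ?a \<otimes> ?u \<in> H y i (\<lambda>l. inv\<^bsub>K\<^esub> wt m l \<otimes>\<^bsub>K\<^esub> (wt i l \<otimes>\<^bsub>K\<^esub> wt m l) \<otimes>\<^bsub>K\<^esub> inv\<^bsub>K\<^esub> wt m l)"
    using r unfolding twisted_def by (intro H_mult H_inv_y m) auto
  moreover have "inv\<^bsub>K\<^esub> wt m l \<otimes>\<^bsub>K\<^esub> (wt i l \<otimes>\<^bsub>K\<^esub> wt m l) \<otimes>\<^bsub>K\<^esub> inv\<^bsub>K\<^esub> wt m l = wt i l \<otimes>\<^bsub>K\<^esub> inv\<^bsub>K\<^esub> wt m l" for l
    using wt_nonzero[of m l] by (simp add: K.m_ac)
  ultimately show ?thesis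
    using span_smult[OF lmset_closed, of "\<ominus>\<^bsub>K\<^esub> ?k" "?u \<otimes> ?a \<otimes> ?u"] H_inv_y[OF m]
    unfolding twisted_def by simp
qed

lemma twisted_lmon:
  assumes Z: "Z \<in> carrier D" and j: "j \<le> i"
    and tw: "\<And>m. \<lbrakk> 1 \<le> m; m < j; y m \<noteq> \<zero> \<rbrakk> \<Longrightarrow> twisted Z (y m) (wt m)"
    and v: "lmon y j v w"
  shows "twisted Z v w"
  using v
proof (induction rule: lmon.induct)
  case lmon_one
  show ?case unfolding twisted_def using Z H_one
    by (auto simp: a_minus_def M.r_neg intro: linear_span_zero)
next
  case (lmon_mult v w m)
  have "\<And>l. w l \<in> carrier K" using lmon_weight[OF lmon_mono[OF lmon_mult(1) j]] by simp
  then show ?case using lmon_mult by (intro twisted_mult Z tw) auto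
next
  case (lmon_inv v w m)
  have "\<And>l. w l \<in> carrier K" using lmon_weight[OF lmon_mono[OF lmon_inv(1) j]] by simp
  then show ?case using lmon_inv j by (intro twisted_mult Z twisted_inv tw) auto
qed

lemma twisted_cong:
  assumes "i \<le> n" and r: "twisted Z r w'" and eq: "\<And>l. \<lbrakk> i \<le> l; l \<le> n \<rbrakk> \<Longrightarrow> w' l = w l"
  shows "twisted Z r w"
proof -
  have "H y i w' = H y i w" "H y i (\<lambda>l. wt i l \<otimes>\<^bsub>K\<^esub> w' l) = H y i (\<lambda>l. wt i l \<otimes>\<^bsub>K\<^esub> w l)"
    using eq by (intro H_weight_cong; simp)+
  then show ?thesis using r eq[of i] \<open>i \<le> n\<close> unfolding twisted_def by simp
qed

text \<open>The separate bound \<open>j\<close> serves an induction: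
  \<open>\<theta> (x m) - y m\<close> is a Laurent polynomial in the \<open>y p\<close> with
  \<open>p < m\<close>, so with \<open>j = m\<close> it is twisted as soon as these are.\<close>

lemma twisted_H:
  assumes Z: "Z \<in> carrier D" and j: "j \<le> i" "i \<le> n" and w: "w i \<in> carrier K"
    and tw: "\<And>m. \<lbrakk> 1 \<le> m; m < j; y m \<noteq> \<zero> \<rbrakk> \<Longrightarrow> twisted Z (y m) (wt m)"
    and z: "z \<in> H y j w"
  shows "twisted Z z w"
  using z
proof (induction rule: linear_span.induct)
  case linear_span_zero
  show ?case using Z w by (rule twisted_zero)
next
  case (linear_span_step c v z)
  then obtain w' where "lmon y j v w'" "\<forall>l\<in>{j..n}. w' l = w l" unfolding lmset_def by blast
  then have "twisted Z v w"
    using j twisted_cong[OF j(2) twisted_lmon[OF Z j(1) tw], of v w' w] by auto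
  then show ?case using linear_span_step by (intro twisted_add twisted_smult Z)
qed

end

section \<open>Clearing denominators of Laurent polynomials\<close>

context quantum_system begin

inductive ymon :: "'d \<Rightarrow> bool" where
  ymon_one: "ymon \<one>"
| ymon_mult: "\<lbrakk> ymon u; 1 \<le> m; m < i; y m \<noteq> \<zero> \<rbrakk> \<Longrightarrow> ymon (u \<otimes> y m)"

lemma ymon_lmon: "ymon u \<Longrightarrow> \<exists>w. lmon y i u w"
  by (induction rule: ymon.induct) (use lmon.intros in blast)+

lemma ymon_Units: "ymon u \<Longrightarrow> u \<in> Units D"
  using ymon_lmon lmon_Units by blast

lemma ymon_closed: "ymon u \<Longrightarrow> u \<in> carrier D"
  using ymon_Units by blast

lemma ymon_mult_ymon: "ymon v \<Longrightarrow> ymon u \<Longrightarrow> ymon (u \<otimes> v)"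
proof (induction rule: ymon.induct)
  case ymon_one
  then show ?case using ymon_closed by simp
next
  case (ymon_mult v m)
  have "u \<otimes> (v \<otimes> y m) = u \<otimes> v \<otimes> y m"
    using ymon_closed[OF ymon_mult(1)] ymon_closed[OF ymon_mult(6)] y_closed[OF ymon_mult(2,3)]
    by (simp add: A.m_assoc)
  then show ?case using ymon.ymon_mult ymon_mult by simp
qed

lemma ymon_quasi_commute:
  assumes u: "ymon u" and v: "ymon v"
  shows "\<exists>\<kappa>\<in>carrier K. v \<otimes> u = \<kappa> \<odot> (u \<otimes> v)"
  using v
proof (induction rule: ymon.induct)
  case ymon_one
  then show ?case using ymon_closed[OF u] by (intro bexI[of _ "\<one>\<^bsub>K\<^esub>"]) auto
next
  case (ymon_mult v m)
  obtain \<kappa> where \<kappa>: "\<kappa> \<in> carrier K" "v \<otimes> u = \<kappa> \<odot> (u \<otimes> v)" using ymon_mult by blast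
  obtain \<mu> where \<mu>: "\<mu> \<in> carrier K" "y m \<otimes> u = \<mu> \<odot> (u \<otimes> y m)"
    using ymon_lmon[OF u] lmon_quasi_commute[of u _ m] ymon_mult by blast
  have C: "u \<in> carrier D" "v \<in> carrier D" "y m \<in> carrier D"
    using ymon_closed u ymon_mult y_closed by auto
  have "v \<otimes> y m \<otimes> u = v \<otimes> (y m \<otimes> u)" using C by (simp add: A.m_assoc)
  also have "\<dots> = \<mu> \<odot> ((v \<otimes> u) \<otimes> y m)" unfolding \<mu>(2) using C \<mu>(1) by (simp add: alg_simps)
  also have "\<dots> = (\<mu> \<otimes>\<^bsub>K\<^esub> \<kappa>) \<odot> (u \<otimes> (v \<otimes> y m))" unfolding \<kappa>(2) using C \<mu>(1) \<kappa>(1) by (simp add: alg_simps)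
  finally show ?case using \<mu>(1) \<kappa>(1) by blast
qed

end

text \<open>In the application \<open>C\<close> is the image of the quantum affine space in
  \<open>D\<close>.\<close>

locale quantum_subalgebra = quantum_system +
  fixes C
  assumes C_sub: "C \<subseteq> carrier D" and C_one: "\<one> \<in> C"
    and C_add: "\<And>a b. \<lbrakk> a \<in> C; b \<in> C \<rbrakk> \<Longrightarrow> a \<oplus> b \<in> C"
    and C_mult: "\<And>a b. \<lbrakk> a \<in> C; b \<in> C \<rbrakk> \<Longrightarrow> a \<otimes> b \<in> C"
    and C_smult: "\<And>c a. \<lbrakk> c \<in> carrier K; a \<in> C \<rbrakk> \<Longrightarrow> c \<odot> a \<in> C"
    and C_y: "\<And>m. \<lbrakk> 1 \<le> m; m < i \<rbrakk> \<Longrightarrow> y m \<in> C"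
begin

lemma C_ymon: "ymon u \<Longrightarrow> u \<in> C"
  by (induction rule: ymon.induct) (simp_all add: C_one C_mult C_y)

text \<open>A factor \<open>inv (y m)\<close> at the right end is cancelled by appending
  \<open>y_m\<close> to the denominator and moving it to the front, which costs only a
  scalar.\<close>

lemma lmon_denominator: "lmon y i v w \<Longrightarrow> \<exists>u. ymon u \<and> v \<otimes> u \<in> C"
proof (induction rule: lmon.induct)
  case lmon_one
  then show ?case using C_one by (intro exI[of _ \<one>]) (auto intro: ymon_one)
next
  case (lmon_mult v w m)
  then obtain u where u: "ymon u" "v \<otimes> u \<in> C" by blast
  obtain \<mu> where \<mu>: "\<mu> \<in> carrier K" "y m \<otimes> u = \<mu> \<odot> (u \<otimes> y m)"
    using ymon_lmon[OF u(1)] lmon_quasi_commute[of u _ m] lmon_mult by blast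
  have Cl: "u \<in> carrier D" "v \<in> carrier D" "y m \<in> carrier D"
    using ymon_closed u lmon_mult y_closed lmon_closed by auto
  have "v \<otimes> y m \<otimes> u = v \<otimes> (y m \<otimes> u)" using Cl by (simp add: A.m_assoc)
  also have "\<dots> = \<mu> \<odot> ((v \<otimes> u) \<otimes> y m)" unfolding \<mu>(2) using Cl \<mu>(1) by (simp add: alg_simps)
  finally show ?case using u C_smult[OF \<mu>(1) C_mult[OF u(2) C_y[OF lmon_mult(2,3)]]] by auto
next
  case (lmon_inv v w m)
  then obtain u where u: "ymon u" "v \<otimes> u \<in> C" by blast
  obtain \<mu> where \<mu>: "\<mu> \<in> carrier K" "u \<otimes> y m = \<mu> \<odot> (y m \<otimes> u)"
    using ymon_quasi_commute[OF ymon_mult[OF ymon_one lmon_inv(2-4)] u(1)] y_closed[OF lmon_inv(2,3)] by auto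
  have U: "y m \<in> Units D" using y_Units lmon_inv by simp
  have Cl: "u \<in> carrier D" "v \<in> carrier D" "y m \<in> carrier D" "inv (y m) \<in> carrier D"
    using ymon_closed u lmon_inv lmon_closed U by auto
  have "v \<otimes> inv (y m) \<otimes> (u \<otimes> y m) = \<mu> \<odot> (v \<otimes> ((inv (y m) \<otimes> y m) \<otimes> u))"
    unfolding \<mu>(2) using Cl \<mu>(1) by (simp add: alg_simps del: A.Units_l_inv)
  also have "\<dots> = \<mu> \<odot> (v \<otimes> u)" using Cl U by simp
  finally show ?case
    using u C_smult[OF \<mu>(1) u(2)] ymon_mult[OF u(1) lmon_inv(2-4)] by auto
qed

text \<open>Monomials commute up to scalars, so a denominator may be enlarged on either side; the
  product of two denominators is then a common one.\<close>

lemma denominator_extend: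
  assumes z: "z \<in> carrier D" and u: "ymon u" "z \<otimes> u \<in> C" and v: "ymon v"
  shows "z \<otimes> (u \<otimes> v) \<in> C" "z \<otimes> (v \<otimes> u) \<in> C"
proof -
  have Cl: "u \<in> carrier D" "v \<in> carrier D" using ymon_closed u v by auto
  have "z \<otimes> (u \<otimes> v) = (z \<otimes> u) \<otimes> v" using z Cl by (simp add: A.m_assoc)
  then show 1: "z \<otimes> (u \<otimes> v) \<in> C" using C_mult[OF u(2) C_ymon[OF v]] by simp
  obtain \<kappa> where \<kappa>: "\<kappa> \<in> carrier K" "v \<otimes> u = \<kappa> \<odot> (u \<otimes> v)"
    using ymon_quasi_commute[OF u(1) v] by blast
  show "z \<otimes> (v \<otimes> u) \<in> C"
    unfolding \<kappa>(2) using C_smult[OF \<kappa>(1) 1] z Cl \<kappa>(1) by (simp flip: smult_assoc_right)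
qed

lemma H_denominator: "z \<in> H y i w \<Longrightarrow> \<exists>u. ymon u \<and> z \<otimes> u \<in> C"
proof (induction rule: linear_span.induct)
  case linear_span_zero
  have "\<zero>\<^bsub>K\<^esub> \<odot> \<one> \<in> C" using C_smult C_one by blast
  then show ?case by (intro exI[of _ \<one>]) (auto intro: ymon_one)
next
  case (linear_span_step c v z)
  then obtain w' where v: "lmon y i v w'" unfolding lmset_def by blast
  obtain u where u: "ymon u" "v \<otimes> u \<in> C" using lmon_denominator[OF v] by blast
  obtain u' where u': "ymon u'" "z \<otimes> u' \<in> C" using linear_span_step by blast
  have Cl: "u \<in> carrier D" "u' \<in> carrier D" "v \<in> carrier D" "z \<in> carrier D"
    using ymon_closed u u' lmon_closed[OF v] H_closed[OF linear_span_step(3)] by auto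
  have "(c \<odot> v \<oplus> z) \<otimes> (u \<otimes> u') = c \<odot> (v \<otimes> (u \<otimes> u')) \<oplus> z \<otimes> (u \<otimes> u')"
    using Cl linear_span_step(1) by (simp add: A.l_distr smult_assoc_left)
  moreover have "v \<otimes> (u \<otimes> u') \<in> C" "z \<otimes> (u \<otimes> u') \<in> C"
    using denominator_extend[OF Cl(3) u u'(1)] denominator_extend[OF Cl(4) u' u(1)] by auto
  ultimately have "(c \<odot> v \<oplus> z) \<otimes> (u \<otimes> u') \<in> C" using C_add C_smult linear_span_step(1) by simp
  then show ?case using ymon_mult_ymon[OF u'(1) u(1)] by blast
qed

text \<open>For the numerator and the denominator of one fraction, which have to be cleared by the
  same factor.\<close>

lemma common_ymon_denominator:
  assumes z: "z \<in> H y i w" "z' \<in> H y i w'"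
  shows "\<exists>u\<in>Units D. z \<otimes> u \<in> C \<and> z' \<otimes> u \<in> C"
proof -
  obtain u where u: "ymon u" "z \<otimes> u \<in> C" using H_denominator z by blast
  obtain u' where u': "ymon u'" "z' \<otimes> u' \<in> C" using H_denominator z by blast
  show ?thesis
    using denominator_extend[OF H_closed[OF z(1)] u u'(1)] denominator_extend[OF H_closed[OF z(2)] u' u(1)]
      ymon_Units[OF ymon_mult_ymon[OF u'(1) u(1)]] by blast
qed

end

section \<open>Deleting the derivations\<close>

locale deleting_derivations = quantum_weights K D n \<Lambda> q + AA: plain_algebra K A
  for K :: "('k, 'c) ring_scheme" and D :: "('k, 'd, 'e) module_scheme" (structure)
    and n :: nat and \<Lambda> :: "nat \<Rightarrow> nat \<Rightarrow> 'k" and q :: "nat \<Rightarrow> 'k"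
    and A :: "('k, 'a, 'm) module_scheme" +
  fixes B :: "nat \<Rightarrow> 'a set" and x :: "nat \<Rightarrow> 'a" and \<tau> \<delta> :: "nat \<Rightarrow> 'a \<Rightarrow> 'a" and \<theta> :: "'a \<Rightarrow> 'd"
  assumes \<Lambda>_diag: "\<And>i. \<lbrakk> 1 \<le> i; i \<le> n \<rbrakk> \<Longrightarrow> \<Lambda> i i = \<one>\<^bsub>K\<^esub>"
    and \<Lambda>_inv: "\<And>i j. \<lbrakk> 1 \<le> j; j < i; i \<le> n \<rbrakk> \<Longrightarrow> \<Lambda> j i = inv\<^bsub>K\<^esub> (\<Lambda> i j)"
    and B_subalgebra: "\<And>i. i \<le> n \<Longrightarrow> is_subalgebra K A (B i)"
    and B_Suc: "\<And>i. i < n \<Longrightarrow> B i \<subseteq> B (Suc i)"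
    and B_0: "B 0 = (\<lambda>c. c \<odot>\<^bsub>A\<^esub> \<one>\<^bsub>A\<^esub>) ` carrier K" and B_n: "B n = carrier A"
    and x_mem: "\<And>i. \<lbrakk> 1 \<le> i; i \<le> n \<rbrakk> \<Longrightarrow> x i \<in> B i"
    and B_gen: "\<And>i z. \<lbrakk> 1 \<le> i; i \<le> n; z \<in> B i \<rbrakk> \<Longrightarrow> \<exists>N. z \<in> left_polys A (B (i - 1)) (x i) N"
    and \<tau>_closed: "\<And>i r. \<lbrakk> 1 \<le> i; i \<le> n; r \<in> B (i - 1) \<rbrakk> \<Longrightarrow> \<tau> i r \<in> B (i - 1)"
    and \<tau>_add: "\<And>i r s. \<lbrakk> 1 \<le> i; i \<le> n; r \<in> B (i - 1); s \<in> B (i - 1) \<rbrakk> \<Longrightarrow> \<tau> i (r \<oplus>\<^bsub>A\<^esub> s) = \<tau> i r \<oplus>\<^bsub>A\<^esub> \<tau> i s"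
    and \<tau>_mult: "\<And>i r s. \<lbrakk> 1 \<le> i; i \<le> n; r \<in> B (i - 1); s \<in> B (i - 1) \<rbrakk> \<Longrightarrow> \<tau> i (r \<otimes>\<^bsub>A\<^esub> s) = \<tau> i r \<otimes>\<^bsub>A\<^esub> \<tau> i s"
    and \<tau>_one: "\<And>i. \<lbrakk> 1 \<le> i; i \<le> n \<rbrakk> \<Longrightarrow> \<tau> i \<one>\<^bsub>A\<^esub> = \<one>\<^bsub>A\<^esub>"
    and \<tau>_smult: "\<And>i c r. \<lbrakk> 1 \<le> i; i \<le> n; c \<in> carrier K; r \<in> B (i - 1) \<rbrakk> \<Longrightarrow> \<tau> i (c \<odot>\<^bsub>A\<^esub> r) = c \<odot>\<^bsub>A\<^esub> \<tau> i r"
    and \<delta>_closed: "\<And>i r. \<lbrakk> 1 \<le> i; i \<le> n; r \<in> B (i - 1) \<rbrakk> \<Longrightarrow> \<delta> i r \<in> B (i - 1)"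
    and \<delta>_smult: "\<And>i c r. \<lbrakk> 1 \<le> i; i \<le> n; c \<in> carrier K; r \<in> B (i - 1) \<rbrakk> \<Longrightarrow> \<delta> i (c \<odot>\<^bsub>A\<^esub> r) = c \<odot>\<^bsub>A\<^esub> \<delta> i r"
    and x_mult: "\<And>i r. \<lbrakk> 1 \<le> i; i \<le> n; r \<in> B (i - 1) \<rbrakk> \<Longrightarrow> x i \<otimes>\<^bsub>A\<^esub> r = \<tau> i r \<otimes>\<^bsub>A\<^esub> x i \<oplus>\<^bsub>A\<^esub> \<delta> i r"
    and \<tau>_x: "\<And>i j. \<lbrakk> 1 \<le> j; j < i; i \<le> n \<rbrakk> \<Longrightarrow> \<tau> i (x j) = \<Lambda> i j \<odot>\<^bsub>A\<^esub> x j"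
    and \<delta>_\<tau>: "\<And>i r. \<lbrakk> 1 \<le> i; i \<le> n; r \<in> B (i - 1) \<rbrakk> \<Longrightarrow> \<delta> i (\<tau> i r) = q i \<odot>\<^bsub>A\<^esub> \<tau> i (\<delta> i r)"
    and \<theta>_hom: "\<theta> \<in> ring_hom A D"
    and \<theta>_smult: "\<And>c a. \<lbrakk> c \<in> carrier K; a \<in> carrier A \<rbrakk> \<Longrightarrow> \<theta> (c \<odot>\<^bsub>A\<^esub> a) = c \<odot> \<theta> a"
begin

sublocale \<theta>: ring_hom_ring A D \<theta>
  using AA.A.ring_axioms A.ring_axioms \<theta>_hom by (rule ring_hom_ringI2)

lemma B_closed: "i \<le> n \<Longrightarrow> z \<in> B i \<Longrightarrow> z \<in> carrier A"
  using B_subalgebra[of i] subringE(1) unfolding is_subalgebra_def by blast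

lemma B_ops:
  assumes "i \<le> n"
  shows "\<zero>\<^bsub>A\<^esub> \<in> B i" "\<one>\<^bsub>A\<^esub> \<in> B i"
    "\<And>a b. \<lbrakk> a \<in> B i; b \<in> B i \<rbrakk> \<Longrightarrow> a \<oplus>\<^bsub>A\<^esub> b \<in> B i"
    "\<And>a b. \<lbrakk> a \<in> B i; b \<in> B i \<rbrakk> \<Longrightarrow> a \<otimes>\<^bsub>A\<^esub> b \<in> B i"
    "\<And>c a. \<lbrakk> c \<in> carrier K; a \<in> B i \<rbrakk> \<Longrightarrow> c \<odot>\<^bsub>A\<^esub> a \<in> B i"
  using B_subalgebra[OF assms] subringE[of "B i" A] unfolding is_subalgebra_def by auto

lemma B_mono: "i \<le> j \<Longrightarrow> j \<le> n \<Longrightarrow> B i \<subseteq> B j"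
proof (induction j rule: dec_induct)
  case (step j)
  then show ?case using B_Suc[of j] by (simp add: subset_trans)
qed simp

lemma x_mem': "\<lbrakk> 1 \<le> m; m \<le> i; i \<le> n \<rbrakk> \<Longrightarrow> x m \<in> B i"
  using x_mem[of m] B_mono[of m i] by auto

lemma x_closed: "\<lbrakk> 1 \<le> m; m \<le> n \<rbrakk> \<Longrightarrow> x m \<in> carrier A"
  using x_mem B_closed by blast

text \<open>Words in the \<open>x_m\<close> in arbitrary order, meant as a spanning set and not as a
  basis. The bound is inclusive, so \<open>xmon (i - 1)\<close> corresponds to
  \<open>lmon y i\<close>.\<close>

inductive xmon :: "nat \<Rightarrow> 'a \<Rightarrow> (nat \<Rightarrow> 'k) \<Rightarrow> bool" for i where
  xmon_one: "xmon i \<one>\<^bsub>A\<^esub> (\<lambda>_. \<one>\<^bsub>K\<^esub>)"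
| xmon_mult: "\<lbrakk> xmon i v w; 1 \<le> m; m \<le> i \<rbrakk> \<Longrightarrow> xmon i (v \<otimes>\<^bsub>A\<^esub> x m) (\<lambda>l. w l \<otimes>\<^bsub>K\<^esub> wt m l)"

lemma xmon_mem: "i \<le> n \<Longrightarrow> xmon i v w \<Longrightarrow> v \<in> B i"
  by (erule xmon.induct) (simp_all add: B_ops x_mem')

lemma xmon_weight: "xmon i v w \<Longrightarrow> w l \<in> carrier K"
  by (induction rule: xmon.induct) auto

lemma xmon_mono: "i \<le> j \<Longrightarrow> xmon i v w \<Longrightarrow> xmon j v w"
  by (erule xmon.induct) (auto intro: xmon.intros)

lemma wt_\<Lambda>: "\<lbrakk> 1 \<le> m; m < l; l \<le> n \<rbrakk> \<Longrightarrow> wt m l = \<Lambda> l m"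
  by (simp add: wt_def)

lemma xmon_\<tau>:
  assumes l: "i < l" "l \<le> n" and v: "xmon i v w"
  shows "\<tau> l v = w l \<odot>\<^bsub>A\<^esub> v"
  using v
proof (induction rule: xmon.induct)
  case xmon_one
  then show ?case using l \<tau>_one by simp
next
  case (xmon_mult v w m)
  have vB: "v \<in> B (l - 1)" using xmon_mem[OF _ xmon_mult(1)] B_mono[of i "l - 1"] l by (auto simp: subset_iff)
  have xB: "x m \<in> B (l - 1)" using x_mem' xmon_mult l by simp
  have C: "v \<in> carrier A" "x m \<in> carrier A" "w l \<in> carrier K"
    using vB xB B_closed[of "l - 1"] l xmon_weight[OF xmon_mult(1)] by auto
  have "\<tau> l (v \<otimes>\<^bsub>A\<^esub> x m) = (w l \<odot>\<^bsub>A\<^esub> v) \<otimes>\<^bsub>A\<^esub> (wt m l \<odot>\<^bsub>A\<^esub> x m)"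
    using \<tau>_mult[OF _ _ vB xB] xmon_mult \<tau>_x[of m l] l wt_\<Lambda>[of m l] by simp
  then show ?case using C by (simp add: AA.alg_simps K.m_comm)
qed

abbreviation "xmons i \<equiv> {v. \<exists>w. xmon i v w}"

lemma xmons_closed: "i \<le> n \<Longrightarrow> xmons i \<subseteq> carrier A"
  using xmon_mem B_closed by blast

lemma B_span: "i \<le> n \<Longrightarrow> z \<in> B i \<Longrightarrow> z \<in> AA.lspan (xmons i)"
proof (induction i arbitrary: z)
  case 0
  then obtain c where c: "c \<in> carrier K" "z = c \<odot>\<^bsub>A\<^esub> \<one>\<^bsub>A\<^esub>" unfolding B_0 by blast
  then have z: "z = c \<odot>\<^bsub>A\<^esub> \<one>\<^bsub>A\<^esub> \<oplus>\<^bsub>A\<^esub> \<zero>\<^bsub>A\<^esub>" by simp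
  show ?case unfolding z using c by (intro linear_span.intros) (auto intro: xmon_one)
next
  case (Suc i)
  note cl = xmons_closed[OF Suc.prems(1)]
  have xi: "x (Suc i) \<in> carrier A" using x_closed Suc.prems by simp
  have "c \<otimes>\<^bsub>A\<^esub> x (Suc i) [^]\<^bsub>A\<^esub> N \<in> AA.lspan (xmons (Suc i))" if c: "c \<in> B i" for c and N :: nat
  proof (induction N)
    case 0
    have "c \<in> AA.lspan (xmons i)" using Suc c by simp
    moreover have "xmons i \<subseteq> xmons (Suc i)" using xmon_mono[of i "Suc i"] by auto
    ultimately have "c \<in> AA.lspan (xmons (Suc i))" by (rule linear_span_mono)
    then show ?case using c B_closed[of i c] Suc.prems by simp
  next
    case (Suc N)
    have "c \<otimes>\<^bsub>A\<^esub> x (Suc i) [^]\<^bsub>A\<^esub> N \<otimes>\<^bsub>A\<^esub> x (Suc i) \<in> AA.lspan (xmons (Suc i))"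
    proof (rule AA.span_mult[OF cl _ cl _ Suc, of "{x (Suc i)}"])
      fix v v' assume "v \<in> xmons (Suc i)" "v' \<in> {x (Suc i)}"
      then have "v \<otimes>\<^bsub>A\<^esub> v' \<in> xmons (Suc i)" using xmon_mult[of "Suc i" v _ "Suc i"] by auto
      then show "v \<otimes>\<^bsub>A\<^esub> v' \<in> AA.lspan (xmons (Suc i))" by (rule AA.span_incl[OF cl])
    qed (use xi AA.span_incl[of "{x (Suc i)}"] in auto)
    moreover have "c \<in> carrier A" using c B_closed[of i c] Suc_leD[OF \<open>Suc i \<le> n\<close>] by simp
    ultimately show ?case using xi by (simp add: AA.A.m_assoc)
  qed
  note mon = this
  obtain N where "z \<in> left_polys A (B i) (x (Suc i)) N" using B_gen[of "Suc i" z] Suc.prems by auto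
  then show ?case
  proof (induction N arbitrary: z)
    case 0
    then show ?case by (simp add: linear_span_zero)
  next
    case (Suc N)
    then show ?case using mon by (auto intro!: AA.span_add[OF cl])
  qed
qed

text \<open>For \<open>l > i\<close> apply \<open>\<tau>_l\<close> to
  \<open>x_i x_m = \<lambda>_im x_m x_i + \<delta>_i(x_m)\<close>: the two products are multiplied
  by one and the same scalar, hence so is the last term. For \<open>l = i\<close> the relation
  \<open>\<delta>_i \<tau>_i = q_i \<tau>_i \<delta>_i\<close> yields the eigenvalue
  \<open>q_i^-1 \<lambda>_im\<close>; this is why \<open>wt i i\<close> is the inverse of
  \<open>q i\<close>. So \<open>\<delta>_i(x_m)\<close> carries the weight of
  \<open>x_i x_m\<close>.\<close>

lemma \<tau>_\<delta>_x:
  assumes m: "1 \<le> m" "m < i" and l: "i \<le> l" "l \<le> n"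
  shows "\<tau> l (\<delta> i (x m)) = (wt i l \<otimes>\<^bsub>K\<^esub> wt m l) \<odot>\<^bsub>A\<^esub> \<delta> i (x m)"
proof -
  have xm: "x m \<in> B (i - 1)" using x_mem' m l by simp
  have \<delta>B: "\<delta> i (x m) \<in> B (i - 1)" using \<delta>_closed xm m l by simp
  have i: "1 \<le> i" "i \<le> n" using m l by auto
  have L: "\<Lambda> i m \<in> carrier K" using \<Lambda>[of i m] m i by simp
  let ?d = "\<delta> i (x m)"
  have dc: "?d \<in> carrier A" "x m \<in> carrier A" "x i \<in> carrier A"
    using \<delta>B xm B_closed[of "i - 1"] x_closed i by auto
  show ?thesis
  proof (cases "l = i")
    case True
    have td: "\<tau> i ?d \<in> carrier A" using \<tau>_closed[OF i \<delta>B] B_closed[of "i - 1"] i by auto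
    have qi: "q i \<in> carrier K" "q i \<noteq> \<zero>\<^bsub>K\<^esub>" "inv\<^bsub>K\<^esub> (q i) \<in> carrier K"
      using q[OF i] K_inv_nonzero[of "q i"] by auto
    have "\<Lambda> i m \<odot>\<^bsub>A\<^esub> ?d = q i \<odot>\<^bsub>A\<^esub> \<tau> i ?d"
      using \<delta>_\<tau>[OF i xm] \<tau>_x[OF m i(2)] \<delta>_smult[OF i L xm] by simp
    then have "inv\<^bsub>K\<^esub> (q i) \<odot>\<^bsub>A\<^esub> (\<Lambda> i m \<odot>\<^bsub>A\<^esub> ?d) = \<tau> i ?d"
      using AA.nonzero_smult_cancel[OF qi(1,2) td] by simp
    then show ?thesis
      unfolding True using L qi dc m i by (simp add: wt_def AA.M.smult_assoc1)
  next
    case False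
    then have l': "1 \<le> l" "i \<le> l - 1" "l - 1 \<le> n" using l m by auto
    have mem: "x i \<in> B (l - 1)" "x m \<in> B (l - 1)" "?d \<in> B (l - 1)"
      using x_mem' m i l l' \<delta>B subsetD[OF B_mono[of "i - 1" "l - 1"]] by auto
    have w: "wt i l = \<Lambda> l i" "wt m l = \<Lambda> l m" using False m l by (auto simp: wt_def)
    have tx: "\<tau> l (x i) = wt i l \<odot>\<^bsub>A\<^esub> x i" "\<tau> l (x m) = wt m l \<odot>\<^bsub>A\<^esub> x m"
      unfolding w using \<tau>_x False m l by auto
    have td: "\<tau> l ?d \<in> carrier A" using \<tau>_closed[OF l'(1) l(2) mem(3)] B_closed[OF l'(3)] by blast
    let ?k = "wt i l \<otimes>\<^bsub>K\<^esub> wt m l"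
    let ?xx = "x i \<otimes>\<^bsub>A\<^esub> x m" and ?yy = "\<Lambda> i m \<odot>\<^bsub>A\<^esub> (x m \<otimes>\<^bsub>A\<^esub> x i)"
    have rel: "?xx = ?yy \<oplus>\<^bsub>A\<^esub> ?d"
      using x_mult[OF i xm] \<tau>_x[OF m i(2)] L dc by (simp add: smult_assoc_left AA.smult_assoc_left)
    have "\<tau> l ?xx = \<tau> l ?yy \<oplus>\<^bsub>A\<^esub> \<tau> l ?d"
      unfolding rel using l' l mem L B_ops[OF l'(3)] by (intro \<tau>_add) auto
    moreover have "\<tau> l ?xx = ?k \<odot>\<^bsub>A\<^esub> ?xx"
      using l' l mem dc by (simp add: \<tau>_mult tx AA.alg_simps K.m_comm)
    moreover have "\<tau> l ?yy = ?k \<odot>\<^bsub>A\<^esub> ?yy"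
      using l' l mem dc L B_ops[OF l'(3)] by (simp add: \<tau>_mult \<tau>_smult tx AA.alg_simps K.m_ac)
    ultimately have e: "?k \<odot>\<^bsub>A\<^esub> ?yy \<oplus>\<^bsub>A\<^esub> ?k \<odot>\<^bsub>A\<^esub> ?d = ?k \<odot>\<^bsub>A\<^esub> ?yy \<oplus>\<^bsub>A\<^esub> \<tau> l ?d"
      using rel dc L by (simp flip: AA.M.smult_r_distr)
    have "?k \<odot>\<^bsub>A\<^esub> ?yy \<in> carrier A" "?k \<odot>\<^bsub>A\<^esub> ?d \<in> carrier A" using dc L by auto
    then show ?thesis using e td AA.M.add.l_cancel by metis
  qed
qed

text \<open>The induction invariant. The correction \<open>\<theta> (x m) - y m\<close> is to have
  the weight of \<open>x_m\<close>, and not just to be a Laurent polynomial, because its skewed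
  commutators with the later \<open>\<theta> (x i)\<close> must be homogeneous again.\<close>

definition reduced :: "(nat \<Rightarrow> 'd) \<Rightarrow> nat \<Rightarrow> bool" where
  "reduced y i \<longleftrightarrow> (\<forall>m. 1 \<le> m \<and> m < i \<longrightarrow> y m \<in> carrier D \<and> \<theta> (x m) \<ominus> y m \<in> H y m (wt m) \<and>
     (\<forall>p. 1 \<le> p \<and> p < m \<longrightarrow> y m \<otimes> y p = \<Lambda> m p \<odot> (y p \<otimes> y m)))"

lemma reduced_system:
  assumes r: "reduced y i" and i: "i \<le> Suc n"
  shows "quantum_system K D n \<Lambda> q y i"
proof
  show "i \<le> Suc n" by fact
  show cl: "\<And>m. \<lbrakk> 1 \<le> m; m < i \<rbrakk> \<Longrightarrow> y m \<in> carrier D" using r unfolding reduced_def by blast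
  have lt: "y m \<otimes> y p = \<Lambda> m p \<odot> (y p \<otimes> y m)" if "1 \<le> p" "p < m" "m < i" for m p
    using r that unfolding reduced_def by auto
  fix p m assume p: "1 \<le> p" "p < i" and m: "1 \<le> m" "m < i"
  consider "p < m" | "p = m" | "m < p" by linarith
  then show "y m \<otimes> y p = \<Lambda> m p \<odot> (y p \<otimes> y m)"
  proof cases
    case 1
    then show ?thesis using lt p m by simp
  next
    case 2
    then show ?thesis using cl[OF m] \<Lambda>_diag[of m] m i by simp
  next
    case 3
    have "\<Lambda> p m \<in> carrier K" "\<Lambda> p m \<noteq> \<zero>\<^bsub>K\<^esub>" using \<Lambda>[of p m] p m i by auto
    then show ?thesis
      unfolding lt[OF m(1) 3 p(2)] using \<Lambda>_inv[of m p] 3 m p i cl[OF p] cl[OF m]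
      by (simp add: nonzero_smult_cancel)
  qed
qed

lemma reduced_extend:
  assumes r: "reduced y i" and i: "1 \<le> i" "i \<le> n"
  shows "\<exists>y'. reduced y' (Suc i)"
proof -
  interpret quantum_system K D n \<Lambda> q y i using reduced_system r i by simp
  let ?Z = "\<theta> (x i)"
  have Z: "?Z \<in> carrier D" using x_closed i by simp
  have cm: "\<theta> (x m) \<ominus> y m \<in> H y m (wt m)" if "1 \<le> m" "m < i" for m
    using r that unfolding reduced_def by blast
  have ym: "y m = \<theta> (x m) \<oplus> (\<ominus>\<^bsub>K\<^esub> \<one>\<^bsub>K\<^esub>) \<odot> (\<theta> (x m) \<ominus> y m)" if m: "1 \<le> m" "m < i" for m
  proof -
    have c: "\<theta> (x m) \<in> carrier D" "y m \<in> carrier D" using x_closed y_closed m i by auto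
    have "\<theta> (x m) \<oplus> (\<ominus>\<^bsub>K\<^esub> \<one>\<^bsub>K\<^esub>) \<odot> (\<theta> (x m) \<ominus> y m) = \<theta> (x m) \<ominus> (\<theta> (x m) \<ominus> y m)"
      using c uminus_eq_smult[of "\<theta> (x m) \<ominus> y m"] by (simp add: a_minus_def)
    also have "\<dots> = y m" using c by algebra
    finally show ?thesis by simp
  qed
  have \<theta>x: "\<theta> (x m) \<in> H y i (wt m)" if m: "1 \<le> m" "m < i" for m
  proof -
    have c: "\<theta> (x m) \<in> carrier D" "y m \<in> carrier D" using x_closed y_closed m i by auto
    have "y m \<oplus> (\<theta> (x m) \<ominus> y m) \<in> H y i (wt m)"
      using H_mono[OF _ cm[OF m], of i] H_y[OF m] m by (intro span_add[OF lmset_closed]) auto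
    moreover have "y m \<oplus> (\<theta> (x m) \<ominus> y m) = \<theta> (x m)" using c by algebra
    ultimately show ?thesis by simp
  qed
  have \<theta>xmon: "\<theta> v \<in> H y i w" if "xmon (i - 1) v w" for v w
    using that
  proof (induction rule: xmon.induct)
    case xmon_one
    then show ?case using H_one by simp
  next
    case (xmon_mult v w m)
    have "v \<in> carrier A" using xmon_mem[OF _ xmon_mult(1)] B_closed[of "i - 1"] i by auto
    then show ?case using H_mult[OF xmon_mult(4) \<theta>x[of m]] x_closed[of m] xmon_mult i by simp
  qed
  \<comment> \<open>Since \<open>\<tau>_l\<close> cannot be applied to \<open>\<theta> r\<close>,
    monomials of the wrong weight are discarded in \<open>A\<close>; the remaining expression is
    mapped to \<open>D\<close>, where the images of monomials are already located.\<close>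
  have \<theta>H: "\<theta> r \<in> H y i w"
    if r: "r \<in> B (i - 1)" and w: "\<And>l. l \<in> {i..n} \<Longrightarrow> w l \<in> carrier K \<and> \<tau> l r = w l \<odot>\<^bsub>A\<^esub> r" for r w
  proof -
    have i': "i - 1 \<le> n" using i by simp
    let ?G = "{v. \<exists>w'. xmon (i - 1) v w' \<and> (\<forall>l\<in>{i..n}. w' l = w l)}"
    have sub: "\<And>l. l \<in> {i..n} \<Longrightarrow> B (i - 1) \<subseteq> B (l - 1)"
      using i by (intro B_mono) auto
    have rG: "r \<in> AA.lspan ?G"
    proof (rule AA.eigenvector_span[of "xmons (i - 1)" "B (i - 1)" ?G "{i..n}" \<tau>])
      show "\<tau> l (a \<oplus>\<^bsub>A\<^esub> b) = \<tau> l a \<oplus>\<^bsub>A\<^esub> \<tau> l b"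
        if "l \<in> {i..n}" "a \<in> B (i - 1)" "b \<in> B (i - 1)" for l a b
        using \<tau>_add[of l a b] subsetD[OF sub[OF that(1)]] that i by simp
      show "\<tau> l (c \<odot>\<^bsub>A\<^esub> a) = c \<odot>\<^bsub>A\<^esub> \<tau> l a"
        if "l \<in> {i..n}" "c \<in> carrier K" "a \<in> B (i - 1)" for l c a
        using \<tau>_smult[of l c a] subsetD[OF sub[OF that(1)]] that i by simp
      show "\<tau> l a \<in> carrier A" if "l \<in> {i..n}" "a \<in> B (i - 1)" for l a
        using \<tau>_closed[of l a] B_closed[of "l - 1" "\<tau> l a"] subsetD[OF sub[OF that(1)]] that i by force
      show "\<exists>\<omega>\<in>carrier K. \<tau> l v = \<omega> \<odot>\<^bsub>A\<^esub> v" if "v \<in> xmons (i - 1)" "l \<in> {i..n}" for v l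
        using xmon_\<tau>[of "i - 1" l v] xmon_weight[of "i - 1" v _ l] that i by auto
      show "\<exists>l\<in>{i..n}. \<exists>\<omega>\<in>carrier K. \<omega> \<noteq> w l \<and> \<tau> l v = \<omega> \<odot>\<^bsub>A\<^esub> v" if v: "v \<in> xmons (i - 1) - ?G" for v
      proof -
        obtain w' where w': "xmon (i - 1) v w'" using v by blast
        then obtain l where "l \<in> {i..n}" "w' l \<noteq> w l" using v by blast
        then show ?thesis using xmon_\<tau>[of "i - 1" l v w'] xmon_weight[OF w', of l] w' i
          by (intro bexI[of _ l] bexI[of _ "w' l"]) auto
      qed
      show "r \<in> AA.lspan (xmons (i - 1))" using B_span[OF i' r] .
    qed (use i' B_ops[OF i'] B_closed[OF i'] xmon_mem w in auto)
    have Gc: "?G \<subseteq> carrier A" using xmons_closed[OF i'] by auto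
    show ?thesis
    proof (rule conjunct2[OF AA.span_image[OF assoc_algebra_axioms lmset_closed Gc subset_refl _ _ _ _ _ _ _ rG]])
      fix v assume "v \<in> ?G"
      then obtain w' where w': "xmon (i - 1) v w'" "\<forall>l\<in>{i..n}. w' l = w l" by blast
      then have "H y i w' = H y i w" by (intro H_weight_cong) auto
      then show "\<theta> v \<in> H y i w" using \<theta>xmon[OF w'(1)] by simp
    qed (use \<theta>_smult in auto)
  qed
  \<comment> \<open>The skewed commutator of \<open>\<theta> (x i)\<close> with
    \<open>\<theta> (x m)\<close> is \<open>\<theta> (\<delta> i (x m))\<close>, whose weight has
    been determined in \<open>A\<close>.\<close>
  have twx: "twisted ?Z (\<theta> (x m)) (wt m)" if m: "1 \<le> m" "m < i" for m
  proof -
    have xm: "x m \<in> B (i - 1)" using x_mem' m i by simp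
    have L: "\<Lambda> i m \<in> carrier K" using \<Lambda>[of i m] m i by simp
    have c: "x m \<in> carrier A" "x i \<in> carrier A" "\<delta> i (x m) \<in> carrier A"
      using x_closed m i \<delta>_closed[OF i xm] B_closed[of "i - 1"] by auto
    have "?Z \<otimes> \<theta> (x m) = \<theta> (x i \<otimes>\<^bsub>A\<^esub> x m)" using c by simp
    also have "\<dots> = wt m i \<odot> (\<theta> (x m) \<otimes> ?Z) \<oplus> \<theta> (\<delta> i (x m))"
      unfolding x_mult[OF i xm] \<tau>_x[OF m i(2)] wt_\<Lambda>[OF m i(2)]
      using c L by (simp add: \<theta>_smult smult_assoc_left)
    finally have "?Z \<otimes> \<theta> (x m) \<ominus> wt m i \<odot> (\<theta> (x m) \<otimes> ?Z)
        = (wt m i \<odot> (\<theta> (x m) \<otimes> ?Z) \<oplus> \<theta> (\<delta> i (x m))) \<ominus> wt m i \<odot> (\<theta> (x m) \<otimes> ?Z)" by simp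
    also have "\<dots> = \<theta> (\<delta> i (x m))"
    proof -
      have "wt m i \<odot> (\<theta> (x m) \<otimes> ?Z) \<in> carrier D" "\<theta> (\<delta> i (x m)) \<in> carrier D" using c by auto
      then show ?thesis by algebra
    qed
    also have "\<dots> \<in> H y i (\<lambda>l. wt i l \<otimes>\<^bsub>K\<^esub> wt m l)"
      using \<delta>_closed[OF i xm] \<tau>_\<delta>_x[OF m] by (intro \<theta>H) auto
    finally show ?thesis unfolding twisted_def using \<theta>x[OF m] by simp
  qed
  \<comment> \<open>From \<open>x_m\<close> to \<open>y_m\<close>: their difference in
    \<open>D\<close> is a Laurent polynomial in the \<open>y_p\<close> with \<open>p < m\<close>,
    which are twisted by the induction hypothesis.\<close>
  have twy: "1 \<le> m \<Longrightarrow> m < i \<Longrightarrow> twisted ?Z (y m) (wt m)" for m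
  proof (induction m rule: less_induct)
    case (less m)
    have "twisted ?Z (\<theta> (x m) \<ominus> y m) (wt m)"
    proof (rule twisted_H[OF Z _ i(2) _ _ cm[OF less.prems]])
      show "m \<le> i" "wt m i \<in> carrier K" using less.prems by auto
      show "twisted ?Z (y p) (wt p)" if "1 \<le> p" "p < m" for p
        using less.IH[of p] that less.prems by linarith
    qed
    then have "twisted ?Z (\<theta> (x m) \<oplus> (\<ominus>\<^bsub>K\<^esub> \<one>\<^bsub>K\<^esub>) \<odot> (\<theta> (x m) \<ominus> y m)) (wt m)"
      using twx[OF less.prems] by (intro twisted_add twisted_smult Z) auto
    then show ?case using ym[OF less.prems] by simp
  qed
  obtain c where c: "c \<in> H y i (wt i)"
    and comm: "\<And>m. \<lbrakk> 1 \<le> m; m < i \<rbrakk> \<Longrightarrow> (?Z \<ominus> c) \<otimes> y m = \<Lambda> i m \<odot> (y m \<otimes> (?Z \<ominus> c))"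
  proof -
    have "?Z \<otimes> y m \<ominus> \<Lambda> i m \<odot> (y m \<otimes> ?Z) \<in> H y i (\<lambda>l. wt i l \<otimes>\<^bsub>K\<^esub> wt m l)"
      if "1 \<le> m" "m < i" for m
      using twy[OF that] wt_\<Lambda>[OF that i(2)] unfolding twisted_def by simp
    then show thesis using deleting_step[OF i Z] that by blast
  qed
  have cc: "c \<in> carrier D" using H_closed c .
  \<comment> \<open>Only the value at \<open>i\<close> changes, so the spans attached to earlier
    indices survive, and with them the invariant.\<close>
  define y' where "y' = y(i := ?Z \<ominus> c)"
  have y'_less: "y' m = y m" if "m < i" for m using that by (simp add: y'_def)
  have "reduced y' (Suc i)"
    unfolding reduced_def
  proof (intro allI impI)
    fix m assume m: "1 \<le> m \<and> m < Suc i"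
    show "y' m \<in> carrier D \<and> \<theta> (x m) \<ominus> y' m \<in> H y' m (wt m) \<and>
        (\<forall>p. 1 \<le> p \<and> p < m \<longrightarrow> y' m \<otimes> y' p = \<Lambda> m p \<odot> (y' p \<otimes> y' m))"
    proof (cases "m = i")
      case True
      have "?Z \<ominus> (?Z \<ominus> c) = c" using Z cc by algebra
      moreover have "c \<in> H y' i (wt i)" by (rule H_cong[OF _ c]) (simp add: y'_less)
      ultimately show ?thesis unfolding True using Z cc comm by (simp add: y'_def)
    next
      case False
      then have m': "1 \<le> m" "m < i" using m by auto
      have "\<theta> (x m) \<ominus> y m \<in> H y' m (wt m)"
        by (rule H_cong[OF _ cm[OF m']]) (use m' y'_less in simp)
      then show ?thesis using r m' y'_less unfolding reduced_def by auto
    qed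
  qed
  then show ?thesis by blast
qed

lemma reduced_exists: "i \<le> n \<Longrightarrow> \<exists>y. reduced y (Suc i)"
proof (induction i)
  case 0
  then show ?case by (auto simp: reduced_def)
next
  case (Suc i)
  then show ?case using reduced_extend by auto
qed

lemma quantum_generators:
  obtains y where "quantum_system K D n \<Lambda> q y (Suc n)"
    "\<And>a. a \<in> carrier A \<Longrightarrow> \<theta> a \<in> H y (Suc n) (\<lambda>_. \<one>\<^bsub>K\<^esub>)"
proof -
  obtain y where r: "reduced y (Suc n)" using reduced_exists by blast
  interpret quantum_system K D n \<Lambda> q y "Suc n" using reduced_system r by simp
  \<comment> \<open>At \<open>Suc n\<close> no index is left at which weights are compared: every
    \<open>H y (Suc n) w\<close> is the space of all Laurent polynomials.\<close>
  have H: "H y (Suc n) w = H y (Suc n) (\<lambda>_. \<one>\<^bsub>K\<^esub>)" for w by (rule H_weight_cong) simp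
  let ?H = "H y (Suc n) (\<lambda>_. \<one>\<^bsub>K\<^esub>)"
  have \<theta>x: "\<theta> (x m) \<in> ?H" if m: "1 \<le> m" "m \<le> n" for m
  proof -
    have c: "\<theta> (x m) \<in> carrier D" "y m \<in> carrier D" using x_closed y_closed m by auto
    have "\<theta> (x m) \<ominus> y m \<in> H y m (wt m)" using r m unfolding reduced_def by auto
    then have "\<theta> (x m) \<ominus> y m \<in> ?H" using H_mono[of m "Suc n" _ y "wt m"] H[of "wt m"] m by simp
    moreover have "y m \<in> ?H" using H_y[of m] H[of "wt m"] m by simp
    ultimately have "y m \<oplus> (\<theta> (x m) \<ominus> y m) \<in> ?H" by (intro span_add[OF lmset_closed])
    moreover have "y m \<oplus> (\<theta> (x m) \<ominus> y m) = \<theta> (x m)" using c by algebra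
    ultimately show ?thesis by simp
  qed
  have xmon: "\<theta> v \<in> ?H" if "xmon n v w" for v w
    using that
  proof (induction rule: xmon.induct)
    case xmon_one
    then show ?case using H_one by simp
  next
    case (xmon_mult v w m)
    have "v \<in> carrier A" using xmon_mem[OF _ xmon_mult(1)] B_closed by auto
    then show ?case
      using H_mult[OF xmon_mult(4) \<theta>x[of m]] H x_closed[of m] xmon_mult by simp
  qed
  have "\<theta> a \<in> ?H" if "a \<in> carrier A" for a
  proof -
    have a: "a \<in> AA.lspan (xmons n)" using B_span[of n a] B_n that by simp
    show ?thesis
      by (rule conjunct2[OF AA.span_image[OF assoc_algebra_axioms lmset_closed xmons_closed subset_refl _ _ _ _ _ _ _ a]])
        (use \<theta>_smult xmon in auto)
  qed
  then show thesis using that quantum_system_axioms by blast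
qed

end

section \<open>Noetherian factor rings and the data of the iterated extension\<close>

lemma right_span_hom:
  assumes A: "ring A" and S: "ring S" and h: "h \<in> ring_hom A S" and T: "T \<subseteq> carrier A"
    and z: "z \<in> right_span A (carrier A) T"
  shows "h z \<in> right_span S (carrier S) (h ` T)"
proof -
  interpret h: ring_hom_ring A S h using A S h by (rule ring_hom_ringI2)
  show ?thesis
    using z
  proof induction
    case right_span_zero
    then show ?case by (simp add: right_span.right_span_zero)
  next
    case (right_span_step t s z)
    have "z \<in> carrier A"
      using ring.right_span_subset[OF A ring.carrier_is_subring[OF A] T] right_span_step by blast
    then have "h (t \<otimes>\<^bsub>A\<^esub> s \<oplus>\<^bsub>A\<^esub> z) = h t \<otimes>\<^bsub>S\<^esub> h s \<oplus>\<^bsub>S\<^esub> h z" using right_span_step T by auto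
    then show ?case using right_span_step by (auto intro: right_span.intros)
  qed
qed

lemma right_noetherian_image:
  assumes A: "ring A" and S: "ring S" and h: "h \<in> ring_hom A S" and surj: "h ` carrier A = carrier S"
    and noeth: "right_noetherian A (carrier A)"
  shows "right_noetherian S (carrier S)"
  unfolding right_noetherian_def
proof (intro allI impI)
  fix f :: "nat \<Rightarrow> _" assume "range f \<subseteq> carrier S"
  then have "\<forall>i. \<exists>a. a \<in> carrier A \<and> h a = f i" using surj by (metis imageE rangeI subsetD)
  then obtain g where g: "\<And>i. g i \<in> carrier A" "\<And>i. h (g i) = f i" by metis
  then obtain m where m: "g m \<in> right_span A (carrier A) (g ` {..<m})"
    using noeth unfolding right_noetherian_def by blast
  have "h (g m) \<in> right_span S (carrier S) (h ` g ` {..<m})"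
    using g(1) by (intro right_span_hom[OF A S h _ m]) auto
  then show "\<exists>m. f m \<in> right_span S (carrier S) (f ` {..<m})" using g(2) by (auto simp: image_image)
qed

text \<open>In a sequence of scalars either the first term is zero and lies in the empty span, or it
  is invertible and the second term is a multiple of it.\<close>

lemma (in plain_algebra) right_noetherian_scalars:
  "right_noetherian A ((\<lambda>c. c \<odot> \<one>) ` carrier K)"
  unfolding right_noetherian_def
proof (intro allI impI)
  fix f :: "nat \<Rightarrow> _" let ?S = "(\<lambda>c. c \<odot> \<one>) ` carrier K"
  assume f: "range f \<subseteq> ?S"
  show "\<exists>m. f m \<in> right_span A ?S (f ` {..<m})"
  proof (cases "f 0 = \<zero>")
    case True
    then have "f 0 \<in> right_span A ?S (f ` {..<0})" by (simp add: right_span_zero)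
    then show ?thesis ..
  next
    case False
    obtain c d where c: "c \<in> carrier K" "f 0 = c \<odot> \<one>" and d: "d \<in> carrier K" "f 1 = d \<odot> \<one>"
    proof -
      have "f 0 \<in> ?S" "f 1 \<in> ?S" using f by auto
      then show thesis using that by blast
    qed
    have c0: "c \<noteq> \<zero>\<^bsub>K\<^esub>" using False c by auto
    have ci: "inv\<^bsub>K\<^esub> c \<in> carrier K" "c \<otimes>\<^bsub>K\<^esub> inv\<^bsub>K\<^esub> c = \<one>\<^bsub>K\<^esub>" using c c0 K.field_Units by auto
    have "f 0 \<otimes> ((inv\<^bsub>K\<^esub> c \<otimes>\<^bsub>K\<^esub> d) \<odot> \<one>) = (c \<otimes>\<^bsub>K\<^esub> inv\<^bsub>K\<^esub> c \<otimes>\<^bsub>K\<^esub> d) \<odot> \<one>"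
      unfolding c(2) using c d ci(1) by (simp add: alg_simps K.m_ac)
    then have e: "f 0 \<otimes> ((inv\<^bsub>K\<^esub> c \<otimes>\<^bsub>K\<^esub> d) \<odot> \<one>) \<oplus> \<zero> = f 1" using ci d by simp
    have "(inv\<^bsub>K\<^esub> c \<otimes>\<^bsub>K\<^esub> d) \<odot> \<one> \<in> ?S" using ci d by blast
    then have "f 1 \<in> right_span A ?S (f ` {..<1})"
      unfolding e[symmetric] by (intro right_span_step right_span_zero) auto
    then show ?thesis ..
  qed
qed

text \<open>Vanishing coefficients are filled in up to a bound for the support, so that the sum can
  be read off degree by degree.\<close>

lemma (in ring) finsum_left_polys:
  fixes c :: "nat \<Rightarrow> 'a"
  assumes S: "subring S R" and x: "x \<in> carrier R" and c: "c \<in> UNIV \<rightarrow> S" and fin: "finite {j. c j \<noteq> \<zero>}"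
  shows "\<exists>N. (\<Oplus>j\<in>{j. c j \<noteq> \<zero>}. c j \<otimes> x [^] j) \<in> left_polys R S x N"
proof -
  have cS: "c j \<in> S" "c j \<in> carrier R" for j using c subringE(1)[OF S] by auto
  obtain N where N: "{j. c j \<noteq> \<zero>} \<subseteq> {..<N}"
    using finite_nat_iff_bounded fin by blast
  have "(\<Oplus>j\<in>{j. c j \<noteq> \<zero>}. c j \<otimes> x [^] j) = (\<Oplus>j\<in>{..<N}. c j \<otimes> x [^] j)"
    by (rule add.finprod_mono_neutral_cong_left) (use N cS x in auto)
  moreover have "(\<Oplus>j\<in>{..<M}. c j \<otimes> x [^] j) \<in> left_polys R S x M" for M
  proof (induction M)
    case (Suc M)
    have "(\<Oplus>j\<in>{..<Suc M}. c j \<otimes> x [^] j) = c M \<otimes> x [^] M \<oplus> (\<Oplus>j\<in>{..<M}. c j \<otimes> x [^] j)"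
      unfolding lessThan_Suc using cS x by (intro finsum_insert) auto
    then show ?case using Suc cS by auto
  qed simp
  ultimately show ?thesis by metis
qed

lemma skew_polynomial_ringD:
  assumes A: "assoc_algebra K A" and skew: "skew_polynomial_ring K A S R x \<tau> \<delta>"
  shows "skew_extension A R S x \<tau> \<delta>"
    and "is_subalgebra K A R" "is_subalgebra K A S"
    and "\<And>r s. \<lbrakk> r \<in> R; s \<in> R \<rbrakk> \<Longrightarrow> \<tau> (r \<oplus>\<^bsub>A\<^esub> s) = \<tau> r \<oplus>\<^bsub>A\<^esub> \<tau> s"
    and "\<And>r s. \<lbrakk> r \<in> R; s \<in> R \<rbrakk> \<Longrightarrow> \<tau> (r \<otimes>\<^bsub>A\<^esub> s) = \<tau> r \<otimes>\<^bsub>A\<^esub> \<tau> s"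
    and "\<tau> \<one>\<^bsub>A\<^esub> = \<one>\<^bsub>A\<^esub>"
    and "\<And>c r. \<lbrakk> c \<in> carrier K; r \<in> R \<rbrakk> \<Longrightarrow> \<tau> (c \<odot>\<^bsub>A\<^esub> r) = c \<odot>\<^bsub>A\<^esub> \<tau> r"
    and "\<And>c r. \<lbrakk> c \<in> carrier K; r \<in> R \<rbrakk> \<Longrightarrow> \<delta> (c \<odot>\<^bsub>A\<^esub> r) = c \<odot>\<^bsub>A\<^esub> \<delta> r"
proof -
  interpret assoc_algebra K A by (rule A)
  have sub: "is_subalgebra K A R" "is_subalgebra K A S" "R \<subseteq> S" "x \<in> S"
    and iso: "\<tau> \<in> alg_iso K (A\<lparr>carrier := R\<rparr>) (A\<lparr>carrier := R\<rparr>)"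
    and der: "skew_derivation K (A\<lparr>carrier := R\<rparr>) \<tau> \<delta>"
    and mult: "\<And>r. r \<in> R \<Longrightarrow> x \<otimes>\<^bsub>A\<^esub> r = \<tau> r \<otimes>\<^bsub>A\<^esub> x \<oplus>\<^bsub>A\<^esub> \<delta> r"
    and rep: "\<And>s. s \<in> S \<Longrightarrow> \<exists>!c. c \<in> UNIV \<rightarrow> R \<and> finite {j. c j \<noteq> \<zero>\<^bsub>A\<^esub>} \<and>
        s = (\<Oplus>\<^bsub>A\<^esub>j\<in>{j. c j \<noteq> \<zero>\<^bsub>A\<^esub>}. c j \<otimes>\<^bsub>A\<^esub> (x [^]\<^bsub>A\<^esub> (j :: nat)))"
    using skew unfolding skew_polynomial_ring_def by simp_all
  show "is_subalgebra K A R" "is_subalgebra K A S" by fact+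
  show "\<And>r s. \<lbrakk> r \<in> R; s \<in> R \<rbrakk> \<Longrightarrow> \<tau> (r \<oplus>\<^bsub>A\<^esub> s) = \<tau> r \<oplus>\<^bsub>A\<^esub> \<tau> s"
    "\<And>r s. \<lbrakk> r \<in> R; s \<in> R \<rbrakk> \<Longrightarrow> \<tau> (r \<otimes>\<^bsub>A\<^esub> s) = \<tau> r \<otimes>\<^bsub>A\<^esub> \<tau> s"
    "\<tau> \<one>\<^bsub>A\<^esub> = \<one>\<^bsub>A\<^esub>" "\<And>c r. \<lbrakk> c \<in> carrier K; r \<in> R \<rbrakk> \<Longrightarrow> \<tau> (c \<odot>\<^bsub>A\<^esub> r) = c \<odot>\<^bsub>A\<^esub> \<tau> r"
    using iso unfolding alg_iso_def ring_iso_def ring_hom_def by auto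
  show "\<And>c r. \<lbrakk> c \<in> carrier K; r \<in> R \<rbrakk> \<Longrightarrow> \<delta> (c \<odot>\<^bsub>A\<^esub> r) = c \<odot>\<^bsub>A\<^esub> \<delta> r"
    using der unfolding skew_derivation_def linear_operator_def by auto
  have RS: "subring R A" "subring S A" using sub unfolding is_subalgebra_def by auto
  have "\<tau> ` R = R" using iso unfolding alg_iso_def ring_iso_def bij_betw_def by auto
  moreover have "\<delta> r \<in> R" if "r \<in> R" for r
    using der that unfolding skew_derivation_def linear_operator_def by auto
  moreover have "\<exists>N. s \<in> left_polys A R x N" if "s \<in> S" for s
    using ex1_implies_ex[OF rep[OF that]] A.finsum_left_polys[OF RS(1), of x] subringE(1)[OF RS(2)] sub(4)
    by blast
  ultimately show "skew_extension A R S x \<tau> \<delta>"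
    using A.ring_axioms RS sub(3,4) mult
    by (simp add: skew_extension_def skew_extension_axioms_def)
qed

theorem corollary6p3:
  fixes K :: "('k, 'c) ring_scheme"
    and A :: "('k, 'a, 'm) module_scheme"
    and n :: nat
    and B :: "nat \<Rightarrow> 'a set"
    and x :: "nat \<Rightarrow> 'a"
    and \<tau> \<delta> :: "nat \<Rightarrow> 'a \<Rightarrow> 'a"
    and d :: "nat \<Rightarrow> nat \<Rightarrow> 'a \<Rightarrow> 'a"
    and q :: "nat \<Rightarrow> 'k"
    and \<Lambda> :: "nat \<Rightarrow> nat \<Rightarrow> 'k"
    and P :: "'a set"
  assumes "field K"
    and "iterated_skew_polynomial_ring K A n B x \<tau> \<delta>"
    and "\<And>i j. 1 \<le> j \<Longrightarrow> j < i \<Longrightarrow> i \<le> n \<Longrightarrow> \<Lambda> i j \<in> carrier K - {\<zero>\<^bsub>K\<^esub>}"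
    and "\<And>i j. 1 \<le> j \<Longrightarrow> j < i \<Longrightarrow> i \<le> n \<Longrightarrow> \<tau> i (x j) = \<Lambda> i j \<odot>\<^bsub>A\<^esub> x j"
    and "\<And>i. 1 \<le> i \<Longrightarrow> i \<le> n \<Longrightarrow> q i \<in> carrier K - {\<zero>\<^bsub>K\<^esub>} \<and> q i \<noteq> \<one>\<^bsub>K\<^esub>"
    and "\<And>i r. 1 \<le> i \<Longrightarrow> i \<le> n \<Longrightarrow> r \<in> B (i - 1) \<Longrightarrow>
           \<delta> i (\<tau> i r) = q i \<odot>\<^bsub>A\<^esub> \<tau> i (\<delta> i r)"
    and "\<And>i. 1 \<le> i \<Longrightarrow> i \<le> n \<Longrightarrow>
           higher_skew_derivation K (A\<lparr>carrier := B (i - 1)\<rparr>) (q i) (\<tau> i) (d i) \<and>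
           locally_nilpotent (A\<lparr>carrier := B (i - 1)\<rparr>) (d i) \<and>
           iterative K (A\<lparr>carrier := B (i - 1)\<rparr>) (q i) (d i) \<and>
           extends_skew_derivation (A\<lparr>carrier := B (i - 1)\<rparr>) (d i) (\<delta> i)"
    and "completely_prime P A"
    and "\<And>i. 1 \<le> i \<Longrightarrow> i \<le> n \<Longrightarrow> \<Lambda> i i = \<one>\<^bsub>K\<^esub>"
    and "\<And>i j. 1 \<le> j \<Longrightarrow> j < i \<Longrightarrow> i \<le> n \<Longrightarrow> \<Lambda> j i = inv\<^bsub>K\<^esub> (\<Lambda> i j)"
  shows "right_Ore_domain (quot_algebra A P) \<and>
         (\<exists>Q. completely_prime Q (quantum_affine_space K n \<Lambda>) \<and>
              right_Ore_domain (quot_algebra (quantum_affine_space K n \<Lambda>) Q) \<and>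
              alg_isomorphic K
                (fract_algebra (quot_algebra A P))
                (fract_algebra (quot_algebra (quantum_affine_space K n \<Lambda>) Q)))"
proof -
  have A: "assoc_algebra K A" and B0: "B 0 = (\<lambda>c. c \<odot>\<^bsub>A\<^esub> \<one>\<^bsub>A\<^esub>) ` carrier K" and Bn: "B n = carrier A"
    and skew: "\<And>i. \<lbrakk> 1 \<le> i; i \<le> n \<rbrakk> \<Longrightarrow> skew_polynomial_ring K A (B i) (B (i - 1)) (x i) (\<tau> i) (\<delta> i)"
    using assms(2) unfolding iterated_skew_polynomial_ring_def by auto
  interpret AA: plain_algebra K A using A by (simp add: plain_algebra_def)
  note ext = skew_polynomial_ringD[OF A skew]
  note E = ext(1)[unfolded skew_extension_def skew_extension_axioms_def]
  have P: "ideal P A" using assms(8) unfolding completely_prime_def by blast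
  let ?R = "quot_algebra A P"
  have R_alg: "assoc_algebra K ?R" by (rule AA.quot_assoc_algebra[OF P])
  interpret RR: assoc_algebra K ?R by (rule R_alg)
  have "right_noetherian A (B i)" if "i \<le> n" for i
    using that
  proof (induction i)
    case 0
    show ?case unfolding B0 by (rule AA.right_noetherian_scalars)
  next
    case (Suc i)
    then show ?case using skew_extension.right_noetherian_extension[OF ext(1)[of "Suc i"]] by simp
  qed
  then have "right_noetherian A (carrier A)" using Bn by force
  then have "right_noetherian ?R (carrier ?R)"
    by (rule right_noetherian_image[OF AA.A.ring_axioms RR.A.ring_axioms AA.quot_hom[OF P], rotated])
      (simp add: quot_algebra_simps carrier_Quot)
  moreover have "nc_domain ?R"
    using assms(8) nc_domain_quot_algebra[OF P] unfolding completely_prime_def by simp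
  ultimately have ore: "right_Ore_domain ?R" by (rule RR.A.right_noetherian_imp_Ore[rotated])
  interpret RO: ore_algebra K ?R using R_alg ore by (simp add: ore_algebra_def ore_algebra_axioms_def)
  let ?D = "fract_algebra ?R"
  interpret DD: plain_algebra K ?D using RO.fract_assoc_algebra by (simp add: plain_algebra_def)
  let ?e = "\<lambda>a. frac_class ?R a \<one>\<^bsub>?R\<^esub>"
  define \<theta> where "\<theta> a = ?e (P +>\<^bsub>A\<^esub> a)" for a
  have \<theta>_hom: "\<theta> \<in> ring_hom A ?D"
    using ring_hom_trans[OF AA.quot_hom[OF P] RO.fract_embedding(1)] unfolding \<theta>_def comp_def .
  have R_img: "carrier ?R = (\<lambda>a. P +>\<^bsub>A\<^esub> a) ` carrier A" by (simp add: quot_algebra_simps carrier_Quot)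
  have \<theta>_smult: "\<theta> (c \<odot>\<^bsub>A\<^esub> a) = c \<odot>\<^bsub>?D\<^esub> \<theta> a" if "c \<in> carrier K" "a \<in> carrier A" for c a
    using that RO.fract_embedding(2)[of c "P +>\<^bsub>A\<^esub> a"] AA.quot_smult[OF P] R_img unfolding \<theta>_def by simp
  have \<theta>_frac: "\<exists>a\<in>carrier A. \<exists>b\<in>carrier A. \<theta> b \<noteq> \<zero>\<^bsub>?D\<^esub> \<and> z \<otimes>\<^bsub>?D\<^esub> \<theta> b = \<theta> a"
    if z: "z \<in> carrier ?D" for z
  proof -
    obtain u v where uv: "z = frac_class ?R u v" "u \<in> carrier ?R" "v \<in> RO.O.Rnz"
      using z unfolding RO.fract_simps by (rule RO.O.fracsE)
    then have "z \<otimes>\<^bsub>?D\<^esub> ?e v = ?e u" "?e v \<noteq> \<zero>\<^bsub>?D\<^esub>"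
      using RO.fract_embedding(3,4) by auto
    moreover obtain a b where "a \<in> carrier A" "b \<in> carrier A" "u = P +>\<^bsub>A\<^esub> a" "v = P +>\<^bsub>A\<^esub> b"
      using uv(2,3) R_img by auto
    ultimately show ?thesis unfolding \<theta>_def by blast
  qed
  \<comment> \<open>Nonvanishing is assumed below the diagonal; the other entries inherit it by
    multiplicative antisymmetry.\<close>
  have \<Lambda>: "\<Lambda> i j \<in> carrier K - {\<zero>\<^bsub>K\<^esub>}" if "1 \<le> i" "i \<le> n" "1 \<le> j" "j \<le> n" for i j
  proof -
    consider "j < i" | "i = j" | "i < j" by linarith
    then show ?thesis
    proof cases
      case 3
      then have "\<Lambda> j i \<in> Units K" using assms(3)[of i j] that AA.K.field_Units by simp
      then show ?thesis using AA.K.Units_inv_Units assms(10)[of i j] 3 that AA.K.field_Units by metis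
    qed (use assms(3,9) that AA.K.one_not_zero in auto)
  qed
  interpret QQ: deleting_derivations K ?D n \<Lambda> q A B x \<tau> \<delta> \<theta>
  proof
    show "Units ?D = carrier ?D - {\<zero>\<^bsub>?D\<^esub>}" by (rule RO.fract_Units)
    show "is_subalgebra K A (B i)" if "i \<le> n" for i
    proof (cases "i < n")
      case True
      then show ?thesis using ext(2)[of "Suc i"] by simp
    next
      case False
      then have "i = n" using that by simp
      then show ?thesis unfolding is_subalgebra_def using Bn AA.A.carrier_is_subring by auto
    qed
    show "B i \<subseteq> B (Suc i)" if "i < n" for i using E[of "Suc i"] that by simp
    show "x i \<in> B i" if "1 \<le> i" "i \<le> n" for i using E[OF that] by blast
    show "\<exists>N. z \<in> left_polys A (B (i - 1)) (x i) N" if "1 \<le> i" "i \<le> n" "z \<in> B i" for i z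
      using E[OF that(1,2)] that(3) by blast
    show "\<tau> i r \<in> B (i - 1)" if "1 \<le> i" "i \<le> n" "r \<in> B (i - 1)" for i r
      using E[OF that(1,2)] that(3) by blast
    show "\<delta> i r \<in> B (i - 1)" if "1 \<le> i" "i \<le> n" "r \<in> B (i - 1)" for i r
      using E[OF that(1,2)] that(3) by blast
    show "x i \<otimes>\<^bsub>A\<^esub> r = \<tau> i r \<otimes>\<^bsub>A\<^esub> x i \<oplus>\<^bsub>A\<^esub> \<delta> i r" if "1 \<le> i" "i \<le> n" "r \<in> B (i - 1)" for i r
      using E[OF that(1,2)] that(3) by blast
  qed (use \<Lambda> assms ext B0 Bn \<theta>_hom \<theta>_smult in simp_all)
  obtain y where sys: "quantum_system K ?D n \<Lambda> q y (Suc n)"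
    and gen: "\<And>a. a \<in> carrier A \<Longrightarrow> \<theta> a \<in> QQ.H y (Suc n) (\<lambda>_. \<one>\<^bsub>K\<^esub>)"
    using QQ.quantum_generators by blast
  interpret QS: quantum_system K ?D n \<Lambda> q y "Suc n" by (rule sys)
  \<comment> \<open>Evaluation asks for an element of \<open>D\<close> at every index, while
    \<open>y\<close> is controlled on \<open>1..n\<close> only. Zero is a harmless default, as the
    free algebra has no letters outside this range.\<close>
  define y' where "y' i = (if i \<in> {1..n} then y i else \<zero>\<^bsub>?D\<^esub>)" for i
  interpret EV: evaluation K ?D y'
    by standard (use QS.y_closed in \<open>auto simp: y'_def\<close>)
  let ?O = "quantum_affine_space K n \<Lambda>"
  have rel: "\<Lambda> i j \<in> carrier K \<and> y' i \<otimes>\<^bsub>?D\<^esub> y' j = \<Lambda> i j \<odot>\<^bsub>?D\<^esub> (y' j \<otimes>\<^bsub>?D\<^esub> y' i)"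
    if "i \<in> {1..n}" "j \<in> {1..n}" for i j
    using \<Lambda>[of i j] QS.y_comm[of j i] that by (simp add: y'_def)
  obtain \<psi> where O: "assoc_algebra K ?O" and \<psi>: "\<psi> \<in> ring_hom ?O ?D"
    and \<psi>_smult: "\<And>c f. \<lbrakk> c \<in> carrier K; f \<in> carrier ?O \<rbrakk> \<Longrightarrow> \<psi> (c \<odot>\<^bsub>?O\<^esub> f) = c \<odot>\<^bsub>?D\<^esub> \<psi> f"
    and \<psi>_y: "\<And>i. i \<in> {1..n} \<Longrightarrow> y' i \<in> \<psi> ` carrier ?O"
    using EV.quantum_affine_space_hom[OF rel] by blast
  interpret OO: assoc_algebra K ?O by (rule O)
  interpret \<psi>: ring_hom_ring ?O ?D \<psi>
    using OO.A.ring_axioms DD.A.ring_axioms \<psi> by (rule ring_hom_ringI2)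
  interpret QC: quantum_subalgebra K ?D n \<Lambda> q y "Suc n" "\<psi> ` carrier ?O"
  proof
    show "\<psi> ` carrier ?O \<subseteq> carrier ?D" by auto
    show "\<one>\<^bsub>?D\<^esub> \<in> \<psi> ` carrier ?O" by (rule image_eqI[of _ _ "\<one>\<^bsub>?O\<^esub>"]) simp_all
    show "a \<oplus>\<^bsub>?D\<^esub> b \<in> \<psi> ` carrier ?O" if "a \<in> \<psi> ` carrier ?O" "b \<in> \<psi> ` carrier ?O" for a b
      using that by (auto simp flip: \<psi>.hom_add)
    show "a \<otimes>\<^bsub>?D\<^esub> b \<in> \<psi> ` carrier ?O" if "a \<in> \<psi> ` carrier ?O" "b \<in> \<psi> ` carrier ?O" for a b
      using that by (auto simp flip: \<psi>.hom_mult)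
    show "c \<odot>\<^bsub>?D\<^esub> a \<in> \<psi> ` carrier ?O" if "c \<in> carrier K" "a \<in> \<psi> ` carrier ?O" for c a
      using that by (auto simp flip: \<psi>_smult)
    show "y m \<in> \<psi> ` carrier ?O" if "1 \<le> m" "m < Suc n" for m
      using \<psi>_y[of m] that by (simp add: y'_def)
  qed
  \<comment> \<open>An element of \<open>D\<close> has the form
    \<open>\<theta>(a) \<theta>(b)^-1\<close>. One monomial \<open>u\<close> in the
    \<open>y_m\<close> clears both Laurent polynomials \<open>\<theta>(a)\<close> and
    \<open>\<theta>(b)\<close>, and \<open>\<theta>(a) u\<close> over \<open>\<theta>(b) u\<close>
    is the same fraction, written with values of \<psi>.\<close>
  have "\<exists>a\<in>carrier ?O. \<exists>b\<in>carrier ?O. \<psi> b \<noteq> \<zero>\<^bsub>?D\<^esub> \<and> z \<otimes>\<^bsub>?D\<^esub> \<psi> b = \<psi> a"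
    if z: "z \<in> carrier ?D" for z
  proof -
    obtain a b where ab: "a \<in> carrier A" "b \<in> carrier A" "\<theta> b \<noteq> \<zero>\<^bsub>?D\<^esub>" "z \<otimes>\<^bsub>?D\<^esub> \<theta> b = \<theta> a"
      using \<theta>_frac[OF z] by blast
    have c: "\<theta> a \<in> carrier ?D" "\<theta> b \<in> carrier ?D" using ab ring_hom_closed[OF \<theta>_hom] by auto
    obtain u where u: "u \<in> Units ?D" "\<theta> a \<otimes>\<^bsub>?D\<^esub> u \<in> \<psi> ` carrier ?O" "\<theta> b \<otimes>\<^bsub>?D\<^esub> u \<in> \<psi> ` carrier ?O"
      using QC.common_ymon_denominator[OF gen[OF ab(1)] gen[OF ab(2)]] by blast
    have uc: "u \<in> carrier ?D" "u \<noteq> \<zero>\<^bsub>?D\<^esub>" using u(1) unfolding RO.fract_Units by auto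
    have "\<theta> b \<otimes>\<^bsub>?D\<^esub> u \<noteq> \<zero>\<^bsub>?D\<^esub>" using QQ.D_mult_eq_zero[OF c(2) uc(1)] ab(3) uc(2) by blast
    moreover have "z \<otimes>\<^bsub>?D\<^esub> (\<theta> b \<otimes>\<^bsub>?D\<^esub> u) = \<theta> a \<otimes>\<^bsub>?D\<^esub> u"
      unfolding ab(4)[symmetric] using z c uc by (simp add: DD.A.m_assoc)
    moreover obtain a' b' where "a' \<in> carrier ?O" "\<theta> a \<otimes>\<^bsub>?D\<^esub> u = \<psi> a'"
      "b' \<in> carrier ?O" "\<theta> b \<otimes>\<^bsub>?D\<^esub> u = \<psi> b'"
      using u(2,3) by blast
    ultimately show ?thesis by (intro bexI[of _ a'] bexI[of _ b']) simp_all
  qed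
  note final = completely_prime_kernel[OF O RO.fract_assoc_algebra RO.fract_Units \<psi> \<psi>_smult this]
  show ?thesis using ore final by blast
qed

end
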